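(* There is a randomized algorithm with the following guarantee. Its input is an integer $n$ that is a power of $2$, integers $k\ge 1$ and $L\ge 1$ with $L\le n^{c}$ (for a fixed constant $c>0$), and query access to the entries of a vector $x\in\mathbb{C}^n$ such that $\widehat{x}$ has at most $k$ nonzero entries and every entry of $\widehat{x}$ lies in $\{-L,\dots,L\}$. The algorithm runs in expected time $O(k\log n)$ and outputs $\widehat{x}$ (as the list of its nonzero entries together with their indices) correctly with probability at least $2/3$.
   Context: $[n]=\{1,\dots,n\}$, $\omega=e^{-2\pi \mathbf{i}/n}$, and the discrete Fourier transform of $x\in\mathbb{C}^n$ is $\widehat{x}_i=\frac{1}{\sqrt n}\sum_{j\in[n]}\omega^{ij}x_j$; indices are taken modulo $n$. A query returns one entry $x_j$ in unit time; arithmetic operations on numbers take unit time. The probability is over the algorithm's internal randomness, for every fixed input $x$ satisfying the hypotheses. *)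

theory Defs
  imports "HOL-Probability.Probability"
begin

section \<open>Discrete Fourier transform\<close>

text \<open>
  A vector of length \<open>n\<close> is a function on \<^typ>\<open>int\<close> of which only the values on
  \<open>{1..n}\<close> matter; \<open>idx n j\<close> is the representative in \<open>{1..n}\<close> of \<open>j\<close> modulo \<open>n\<close>.
\<close>

definition idx :: "nat \<Rightarrow> int \<Rightarrow> int" where
  "idx n j = (j - 1) mod int n + 1"

definition omega :: "nat \<Rightarrow> complex" where
  "omega n = exp (- 2 * of_real pi * \<i> / of_nat n)"

definition dft :: "nat \<Rightarrow> (int \<Rightarrow> complex) \<Rightarrow> int \<Rightarrow> complex" where
  "dft n x i = 1 / of_real (sqrt (real n)) * (\<Sum>j\<in>{1..int n}. omega n powi (i * j) * x j)"

definition dft_support :: "nat \<Rightarrow> (int \<Rightarrow> complex) \<Rightarrow> int set" where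
  "dft_support n x = {i \<in> {1..int n}. dft n x i \<noteq> 0}"


section \<open>Randomized unit-cost programs with query access\<close>

text \<open>
  Algorithms are programs of a small imperative language over exact integers and exact complex
  numbers, with scalar variables and zero-initialised arrays of both sorts.  A program is a finite
  piece of syntax that depends neither on the input \<open>(n, k, L)\<close> nor on \<open>x\<close>.  Its only numeric
  literals are integers and the imaginary unit, so that no information can be hidden in a constant.
  There is no conversion from complex numbers to integers (no floor or rounding): information
  flows from the complex to the integer sort only through the outcomes of comparisons.
\<close>

type_synonym name = string

datatype iexp =
    N int
  | IVar name
  | IArr name iexp
  | IAdd iexp iexp
  | ISub iexp iexp
  | IMul iexp iexp
  | IDiv iexp iexp
  | IMod iexp iexp

text \<open>
  \<open>Query e\<close> reads one entry of \<open>x\<close>, and \<open>Omega e\<close> is the twiddle factor \<open>\<omega>\<close> to the power \<open>e\<close>.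
\<close>

datatype cexp =
    OfInt iexp
  | ImUnit
  | CVar name
  | CArr name iexp
  | CAdd cexp cexp
  | CSub cexp cexp
  | CMul cexp cexp
  | CDiv cexp cexp
  | CRe cexp
  | CIm cexp
  | Omega iexp
  | Query iexp

datatype bexp =
    ILe iexp iexp
  | ReLe cexp cexp
  | BNot bexp
  | BAnd bexp bexp

text \<open>
  \<open>Rand v e\<close> draws \<open>v\<close> uniformly from \<open>{0..<e}\<close>; \<open>Emit e a\<close> appends the pair \<open>(e, a)\<close> to the output.
\<close>

datatype com =
    Skip
  | IAssign name iexp
  | CAssign name cexp
  | IStore name iexp iexp
  | CStore name iexp cexp
  | Rand name iexp
  | Emit iexp cexp
  | Seq com com
  | Cond bexp com com
  | While bexp com

record state =
  ivar :: "name \<Rightarrow> int"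
  cvar :: "name \<Rightarrow> complex"
  iarr :: "name \<Rightarrow> int \<Rightarrow> int"
  carr :: "name \<Rightarrow> int \<Rightarrow> complex"
  out :: "(int \<times> complex) list"

primrec ival :: "iexp \<Rightarrow> state \<Rightarrow> int" where
  "ival (N m) s = m"
| "ival (IVar v) s = ivar s v"
| "ival (IArr a e) s = iarr s a (ival e s)"
| "ival (IAdd e f) s = ival e s + ival f s"
| "ival (ISub e f) s = ival e s - ival f s"
| "ival (IMul e f) s = ival e s * ival f s"
| "ival (IDiv e f) s = ival e s div ival f s"
| "ival (IMod e f) s = ival e s mod ival f s"

primrec cval :: "nat \<Rightarrow> (int \<Rightarrow> complex) \<Rightarrow> cexp \<Rightarrow> state \<Rightarrow> complex" where
  "cval n x (OfInt e) s = of_int (ival e s)"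
| "cval n x ImUnit s = \<i>"
| "cval n x (CVar v) s = cvar s v"
| "cval n x (CArr a e) s = carr s a (ival e s)"
| "cval n x (CAdd e f) s = cval n x e s + cval n x f s"
| "cval n x (CSub e f) s = cval n x e s - cval n x f s"
| "cval n x (CMul e f) s = cval n x e s * cval n x f s"
| "cval n x (CDiv e f) s = cval n x e s / cval n x f s"
| "cval n x (CRe e) s = of_real (Re (cval n x e s))"
| "cval n x (CIm e) s = of_real (Im (cval n x e s))"
| "cval n x (Omega e) s = omega n powi (ival e s)"
| "cval n x (Query e) s = x (idx n (ival e s))"

primrec bval :: "nat \<Rightarrow> (int \<Rightarrow> complex) \<Rightarrow> bexp \<Rightarrow> state \<Rightarrow> bool" where
  "bval n x (ILe e f) s \<longleftrightarrow> ival e s \<le> ival f s"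
| "bval n x (ReLe e f) s \<longleftrightarrow> Re (cval n x e s) \<le> Re (cval n x f s)"
| "bval n x (BNot b) s \<longleftrightarrow> \<not> bval n x b s"
| "bval n x (BAnd b d) s \<longleftrightarrow> bval n x b s \<and> bval n x d s"

text \<open>The cost of evaluating an expression is the number of its syntax nodes.\<close>

primrec icost :: "iexp \<Rightarrow> nat" where
  "icost (N m) = 1"
| "icost (IVar v) = 1"
| "icost (IArr a e) = 1 + icost e"
| "icost (IAdd e f) = 1 + icost e + icost f"
| "icost (ISub e f) = 1 + icost e + icost f"
| "icost (IMul e f) = 1 + icost e + icost f"
| "icost (IDiv e f) = 1 + icost e + icost f"
| "icost (IMod e f) = 1 + icost e + icost f"

primrec ccost :: "cexp \<Rightarrow> nat" where
  "ccost (OfInt e) = 1 + icost e"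
| "ccost ImUnit = 1"
| "ccost (CVar v) = 1"
| "ccost (CArr a e) = 1 + icost e"
| "ccost (CAdd e f) = 1 + ccost e + ccost f"
| "ccost (CSub e f) = 1 + ccost e + ccost f"
| "ccost (CMul e f) = 1 + ccost e + ccost f"
| "ccost (CDiv e f) = 1 + ccost e + ccost f"
| "ccost (CRe e) = 1 + ccost e"
| "ccost (CIm e) = 1 + ccost e"
| "ccost (Omega e) = 1 + icost e"
| "ccost (Query e) = 1 + icost e"

primrec bcost :: "bexp \<Rightarrow> nat" where
  "bcost (ILe e f) = 1 + icost e + icost f"
| "bcost (ReLe e f) = 1 + ccost e + ccost f"
| "bcost (BNot b) = 1 + bcost b"
| "bcost (BAnd b d) = 1 + bcost b + bcost d"

text \<open>
  Execution yields a subprobability distribution on pairs of final state and running time; the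
  missing mass is the probability of divergence.
\<close>

type_synonym outcome = "(state \<times> nat) spmf"

definition tick :: "nat \<Rightarrow> outcome \<Rightarrow> outcome" where
  "tick c p = map_spmf (\<lambda>(s, t). (s, c + t)) p"

definition seq_run :: "outcome \<Rightarrow> (state \<Rightarrow> outcome) \<Rightarrow> outcome" where
  "seq_run p f = bind_spmf p (\<lambda>r. tick (snd r) (f (fst r)))"

lemma tick_mono [partial_function_mono]:
  assumes "mono_spmf f"
  shows "mono_spmf (\<lambda>g. tick c (f g))"
  unfolding tick_def using assms by (rule map_spmf_mono)

lemma seq_run_mono [partial_function_mono]:
  assumes "mono_spmf p" and "\<And>s. mono_spmf (\<lambda>g. f s g)"
  shows "mono_spmf (\<lambda>g. seq_run (p g) (\<lambda>s. f s g))"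
  unfolding seq_run_def
  by (intro bind_spmf_mono assms(1) tick_mono assms(2))

partial_function (spmf) loop ::
  "(state \<Rightarrow> bool) \<Rightarrow> nat \<Rightarrow> (state \<Rightarrow> outcome) \<Rightarrow> state \<Rightarrow> outcome" where
  "loop b c body s =
     tick c (if b s then seq_run (body s) (loop b c body) else return_spmf (s, 0))"

primrec exec :: "nat \<Rightarrow> (int \<Rightarrow> complex) \<Rightarrow> com \<Rightarrow> state \<Rightarrow> outcome" where
  "exec n x Skip s = return_spmf (s, 1)"
| "exec n x (IAssign v e) s =
     return_spmf (s\<lparr>ivar := (ivar s)(v := ival e s)\<rparr>, 1 + icost e)"
| "exec n x (CAssign v e) s =
     return_spmf (s\<lparr>cvar := (cvar s)(v := cval n x e s)\<rparr>, 1 + ccost e)"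
| "exec n x (IStore a i e) s =
     return_spmf (s\<lparr>iarr := (iarr s)(a := (iarr s a)(ival i s := ival e s))\<rparr>,
                  1 + icost i + icost e)"
| "exec n x (CStore a i e) s =
     return_spmf (s\<lparr>carr := (carr s)(a := (carr s a)(ival i s := cval n x e s))\<rparr>,
                  1 + icost i + ccost e)"
| "exec n x (Rand v e) s =
     map_spmf (\<lambda>r. (s\<lparr>ivar := (ivar s)(v := r)\<rparr>, 1 + icost e))
       (spmf_of_set {0..<max 1 (ival e s)})"
| "exec n x (Emit i e) s =
     return_spmf (s\<lparr>out := out s @ [(ival i s, cval n x e s)]\<rparr>, 1 + icost i + ccost e)"
| "exec n x (Seq p q) s = seq_run (exec n x p s) (exec n x q)"
| "exec n x (Cond b p q) s =
     tick (1 + bcost b) (if bval n x b s then exec n x p s else exec n x q s)"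
| "exec n x (While b p) s = loop (bval n x b) (1 + bcost b) (exec n x p) s"

definition initial_state :: "nat \<Rightarrow> nat \<Rightarrow> nat \<Rightarrow> state" where
  "initial_state n k L =
     \<lparr>ivar = (\<lambda>_. 0)(''n'' := int n, ''k'' := int k, ''L'' := int L),
      cvar = (\<lambda>_. 0), iarr = (\<lambda>_ _. 0), carr = (\<lambda>_ _. 0), out = []\<rparr>"

definition run :: "com \<Rightarrow> nat \<Rightarrow> nat \<Rightarrow> nat \<Rightarrow> (int \<Rightarrow> complex) \<Rightarrow> outcome" where
  "run P n k L x = exec n x P (initial_state n k L)"

text \<open>Divergence counts as infinite running time.\<close>

definition expected_time :: "outcome \<Rightarrow> ennreal" where
  "expected_time p =
     (\<integral>\<^sup>+ r. (case r of None \<Rightarrow> \<infinity> | Some (s, t) \<Rightarrow> of_nat t) \<partial>measure_pmf p)"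

definition outputs_dft :: "nat \<Rightarrow> (int \<Rightarrow> complex) \<Rightarrow> state \<Rightarrow> bool" where
  "outputs_dft n x s \<longleftrightarrow>
     distinct (out s) \<and> set (out s) = (\<lambda>i. (i, dft n x i)) ` dft_support n x"

definition success_probability :: "nat \<Rightarrow> (int \<Rightarrow> complex) \<Rightarrow> outcome \<Rightarrow> real" where
  "success_probability n x p = measure (measure_spmf p) {(s, t). outputs_dft n x s}"

end

theory Submission
  imports Defs "HOL-Number_Theory.Cong" "HOL-Computational_Algebra.Polynomial"
begin

text \<open>
  The algorithm keeps an integer estimate \<open>z\<close> of the transform and improves it in passes.  A pass
  dilates the frequencies by a random odd \<open>s\<close>, multiplies the signal by a window of length about
  \<open>m B\<close> with \<open>m = O(log n)\<close>, and computes the \<open>B\<close> aliased frequency samples by an FFT of length \<open>B\<close>.  The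
  window is the \<open>m\<close>-fold convolution of a box of length \<open>B\<close>, whose frequency response is the \<open>m\<close>-th
  power of a Dirichlet kernel: it is not flat, but explicitly known, and outside four bucket widths it
  is smaller by the factor \<open>2\<^sup>m\<close>, i.e. polynomially, than inside the bucket.  So if a single residual frequency is
  audible in a bucket, the ratio of the contents for the time shifts 0 and 1 gives its position (by
  binary search on the phase), and dividing by the kernel and rounding gives its value exactly.

  Two frequencies collide with probability \<open>O(1/B)\<close>, and every error of a pass is caused by a
  collision, hence the residual sparsity \<open>\<kappa>\<close> drops to about \<open>\<kappa>\<^sup>2/B\<close>.  With \<open>B\<close> starting at a multiple of
  \<open>k\<close> and halved in each pass, doubly exponential decrease of \<open>\<kappa>\<close> is compatible with a summable
  failure probability, and \<open>O(log log n)\<close> passes suffice.  This matters for the running time: evaluating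
  an \<open>m\<close>-th power to subtract a known coefficient costs \<open>O(log m)\<close>, and all of them are subtracted in
  every pass.  If \<open>B = n\<close>, the kernel vanishes off its centre and the first pass is already exact.
\<close>

section \<open>Deterministic runs and expectations\<close>

text \<open>Randomness enters only through the draw of \<open>d\<close> in each pass. What follows
  the draw is deterministic and is described by \<open>wp\<close>; expectations (\<open>ewp\<close>)
  are needed only for the outer loop. The link between the two is a count valid for every
  \<open>d\<close>: while B >= 8 or B = n, the new residual has at most twice as many elements as
  there are ordered pairs of residual frequencies audible in a common bucket, counted over all
  buckets. The mean of this bound over \<open>d\<close> is at most 160 \<kappa>^2 / B, and Markov's
  inequality turns it into the failure probability of a pass. The constant 8192 in the choice of
  \<open>B\<close> makes these probabilities add up to at most 5/16 < 1/3.

  The language has neither rounding nor square roots. Phases and values are therefore read off by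
  binary searches on comparisons, thresholds compare squared moduli, and a Newton iterate replaces
  sqrt n. As all arithmetic is exact, the only numerical errors are that of the square root and the
  leakage from far frequencies; 2^m \<ge> 80 n^2 L makes both too small to spoil the decoding of a
  bucket without collisions.\<close>

primrec imod :: "com \<Rightarrow> name set" where
  "imod Skip = {}"
| "imod (IAssign v e) = {v}"
| "imod (CAssign v e) = {}"
| "imod (IStore a i e) = {}"
| "imod (CStore a i e) = {}"
| "imod (Rand v e) = {v}"
| "imod (Emit i e) = {}"
| "imod (Seq p q) = imod p \<union> imod q"
| "imod (Cond b p q) = imod p \<union> imod q"
| "imod (While b p) = imod p"

primrec cmod :: "com \<Rightarrow> name set" where
  "cmod Skip = {}"
| "cmod (IAssign v e) = {}"
| "cmod (CAssign v e) = {v}"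
| "cmod (IStore a i e) = {}"
| "cmod (CStore a i e) = {}"
| "cmod (Rand v e) = {}"
| "cmod (Emit i e) = {}"
| "cmod (Seq p q) = cmod p \<union> cmod q"
| "cmod (Cond b p q) = cmod p \<union> cmod q"
| "cmod (While b p) = cmod p"

primrec iamod :: "com \<Rightarrow> name set" where
  "iamod Skip = {}"
| "iamod (IAssign v e) = {}"
| "iamod (CAssign v e) = {}"
| "iamod (IStore a i e) = {a}"
| "iamod (CStore a i e) = {}"
| "iamod (Rand v e) = {}"
| "iamod (Emit i e) = {}"
| "iamod (Seq p q) = iamod p \<union> iamod q"
| "iamod (Cond b p q) = iamod p \<union> iamod q"
| "iamod (While b p) = iamod p"

primrec camod :: "com \<Rightarrow> name set" where
  "camod Skip = {}"
| "camod (IAssign v e) = {}"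
| "camod (CAssign v e) = {}"
| "camod (IStore a i e) = {}"
| "camod (CStore a i e) = {a}"
| "camod (Rand v e) = {}"
| "camod (Emit i e) = {}"
| "camod (Seq p q) = camod p \<union> camod q"
| "camod (Cond b p q) = camod p \<union> camod q"
| "camod (While b p) = camod p"

primrec emits :: "com \<Rightarrow> bool" where
  "emits Skip = False"
| "emits (IAssign v e) = False"
| "emits (CAssign v e) = False"
| "emits (IStore a i e) = False"
| "emits (CStore a i e) = False"
| "emits (Rand v e) = False"
| "emits (Emit i e) = True"
| "emits (Seq p q) = (emits p \<or> emits q)"
| "emits (Cond b p q) = (emits p \<or> emits q)"
| "emits (While b p) = emits p"

definition frame :: "com \<Rightarrow> state \<Rightarrow> state \<Rightarrow> bool" where
  "frame P s s' \<longleftrightarrow>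
     (\<forall>v. v \<notin> imod P \<longrightarrow> ivar s' v = ivar s v) \<and>
     (\<forall>v. v \<notin> cmod P \<longrightarrow> cvar s' v = cvar s v) \<and>
     (\<forall>a. a \<notin> iamod P \<longrightarrow> iarr s' a = iarr s a) \<and>
     (\<forall>a. a \<notin> camod P \<longrightarrow> carr s' a = carr s a) \<and>
     (\<not> emits P \<longrightarrow> out s' = out s)"

lemma frame_refl: "frame P s s"
  by (simp add: frame_def)

lemma frame_trans: "frame P s s' \<Longrightarrow> frame P s' s'' \<Longrightarrow> frame P s s''"
  unfolding frame_def by metis

lemma frame_Seq: "frame p s s' \<Longrightarrow> frame q s' s'' \<Longrightarrow> frame (Seq p q) s s''"
  unfolding frame_def by simp

text \<open>Since the frame condition is part of \<open>wp\<close>, loop invariants need not mention what the loop leaves alone.\<close>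

definition wp :: "nat \<Rightarrow> (int \<Rightarrow> complex) \<Rightarrow> com \<Rightarrow> (state \<Rightarrow> nat \<Rightarrow> bool) \<Rightarrow> state \<Rightarrow> bool" where
  "wp n x P Q s \<longleftrightarrow> (\<exists>s' t. exec n x P s = return_spmf (s', t) \<and> frame P s s' \<and> Q s' t)"

lemma seq_run_return: "seq_run (return_spmf (s, t)) f = tick t (f s)"
  by (simp add: seq_run_def)

lemma tick_return: "tick c (return_spmf (s, t)) = return_spmf (s, c + t)"
  by (simp add: tick_def)

lemma wp_conseq:
  assumes "wp n x P Q s" and "\<And>s' t. frame P s s' \<Longrightarrow> Q s' t \<Longrightarrow> Q' s' t"
  shows "wp n x P Q' s"
  using assms unfolding wp_def by blast

lemma wp_Skip: "Q s 1 \<Longrightarrow> wp n x Skip Q s"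
  by (simp add: wp_def frame_refl)

lemma wp_IAssign:
  "Q (s\<lparr>ivar := (ivar s)(v := ival e s)\<rparr>) (1 + icost e) \<Longrightarrow> wp n x (IAssign v e) Q s"
  by (simp add: wp_def frame_def)

lemma wp_CAssign:
  "Q (s\<lparr>cvar := (cvar s)(v := cval n x e s)\<rparr>) (1 + ccost e) \<Longrightarrow> wp n x (CAssign v e) Q s"
  by (simp add: wp_def frame_def)

lemma wp_IStore:
  "Q (s\<lparr>iarr := (iarr s)(a := (iarr s a)(ival i s := ival e s))\<rparr>) (1 + icost i + icost e)
   \<Longrightarrow> wp n x (IStore a i e) Q s"
  by (simp add: wp_def frame_def)

lemma wp_CStore:
  "Q (s\<lparr>carr := (carr s)(a := (carr s a)(ival i s := cval n x e s))\<rparr>) (1 + icost i + ccost e)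
   \<Longrightarrow> wp n x (CStore a i e) Q s"
  by (simp add: wp_def frame_def)

lemma wp_Emit:
  "Q (s\<lparr>out := out s @ [(ival i s, cval n x e s)]\<rparr>) (1 + icost i + ccost e)
   \<Longrightarrow> wp n x (Emit i e) Q s"
  by (simp add: wp_def frame_def)

lemma wp_Seq:
  assumes "wp n x p (\<lambda>s1 t1. wp n x q (\<lambda>s2 t2. Q s2 (t1 + t2)) s1) s"
  shows "wp n x (Seq p q) Q s"
proof -
  from assms obtain s1 t1 s2 t2 where
    "exec n x p s = return_spmf (s1, t1)" "frame p s s1"
    "exec n x q s1 = return_spmf (s2, t2)" "frame q s1 s2" "Q s2 (t1 + t2)"
    unfolding wp_def by blast
  then show ?thesis
    unfolding wp_def by (auto simp: seq_run_return tick_return intro: frame_Seq)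
qed

lemma wp_Cond:
  assumes "bval n x b s \<Longrightarrow> wp n x p (\<lambda>s' t. Q s' (1 + bcost b + t)) s"
    and "\<not> bval n x b s \<Longrightarrow> wp n x q (\<lambda>s' t. Q s' (1 + bcost b + t)) s"
  shows "wp n x (Cond b p q) Q s"
proof (cases "bval n x b s")
  case True
  then obtain s1 t1 where
    "exec n x p s = return_spmf (s1, t1)" "frame p s s1" "Q s1 (1 + bcost b + t1)"
    using assms(1) unfolding wp_def by blast
  then show ?thesis
    using True unfolding wp_def by (auto simp: tick_return frame_def)
next
  case False
  then obtain s1 t1 where
    "exec n x q s = return_spmf (s1, t1)" "frame q s s1" "Q s1 (1 + bcost b + t1)"
    using assms(2) unfolding wp_def by blast
  then show ?thesis
    using False unfolding wp_def by (auto simp: tick_return frame_def)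
qed

lemma wp_While:
  assumes init: "J 0 s"
    and step: "\<And>i s'. \<lbrakk>i < M; J i s'; frame p s s'\<rbrakk> \<Longrightarrow>
          bval n x b s' \<and> wp n x p (\<lambda>s'' t. J (Suc i) s'' \<and> t \<le> T) s'"
    and exit: "\<And>s'. J M s' \<Longrightarrow> frame p s s' \<Longrightarrow> \<not> bval n x b s'"
  shows "wp n x (While b p) (\<lambda>s' t. J M s' \<and> t \<le> M * (T + 1 + bcost b) + (1 + bcost b)) s"
proof -
  have "i \<le> M \<Longrightarrow> J i s' \<Longrightarrow> frame p s s' \<Longrightarrow>
      \<exists>s'' t. loop (bval n x b) (1 + bcost b) (exec n x p) s' = return_spmf (s'', t) \<and>
        frame p s s'' \<and> J M s'' \<and> t \<le> (M - i) * (T + 1 + bcost b) + (1 + bcost b)" for i s'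
  proof (induction "M - i" arbitrary: i s')
    case 0
    then have "i = M" by simp
    with 0 exit have "\<not> bval n x b s'" by blast
    then show ?case
      using 0 \<open>i = M\<close> by (subst loop.simps) (auto simp: tick_return)
  next
    case (Suc j)
    then have "i < M" by simp
    with step[of i s'] Suc.prems obtain s1 t1 where
      *: "bval n x b s'" "exec n x p s' = return_spmf (s1, t1)" "frame p s' s1" "J (Suc i) s1" "t1 \<le> T"
      unfolding wp_def by blast
    then have "frame p s s1" using Suc.prems frame_trans by blast
    moreover have "j = M - Suc i" "Suc i \<le> M" using Suc.hyps(2) by auto
    ultimately obtain s2 t2 where
      **: "loop (bval n x b) (1 + bcost b) (exec n x p) s1 = return_spmf (s2, t2)"
        "frame p s s2" "J M s2" "t2 \<le> (M - Suc i) * (T + 1 + bcost b) + (1 + bcost b)"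
      using Suc.hyps(1)[of "Suc i" s1] * by blast
    have "M - i = Suc (M - Suc i)" using \<open>i < M\<close> by simp
    then have "1 + bcost b + (t1 + t2) \<le> (M - i) * (T + 1 + bcost b) + (1 + bcost b)"
      using * ** by simp
    then show ?case
      using * ** by (subst loop.simps) (auto simp: tick_return seq_run_return)
  qed
  from this[of 0 s] show ?thesis
    using init unfolding wp_def by (auto simp: frame_refl frame_def)
qed

definition For :: "name \<Rightarrow> iexp \<Rightarrow> com \<Rightarrow> com" where
  "For v e p = Seq (IAssign v (N 0))
     (While (ILe (IAdd (IVar v) (N 1)) e) (Seq p (IAssign v (IAdd (IVar v) (N 1)))))"

lemma mod_For [simp]:
  "imod (For v e p) = insert v (imod p)" "cmod (For v e p) = cmod p"
  "iamod (For v e p) = iamod p" "camod (For v e p) = camod p" "emits (For v e p) = emits p"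
  by (auto simp: For_def)

text \<open>The bound \<open>e\<close> is evaluated anew in every iteration, hence the premise
  \<open>bound\<close>. An iteration pays 4 for the increment and \<open>5 + icost e\<close> for the
  test, the latter once more at the exit; the initialisation costs 2.\<close>

lemma wp_For:
  assumes init: "J 0 (s\<lparr>ivar := (ivar s)(v := 0)\<rparr>)"
    and bound: "\<And>i s'. \<lbrakk>J i s'; frame (For v e p) s s'\<rbrakk> \<Longrightarrow> ival e s' = int M"
    and step: "\<And>i s'. \<lbrakk>i < M; J i s'; ivar s' v = int i; frame (For v e p) s s'\<rbrakk> \<Longrightarrow>
          wp n x p (\<lambda>s'' t. J (Suc i) (s''\<lparr>ivar := (ivar s'')(v := int (Suc i))\<rparr>) \<and> t \<le> T) s'"
    and v: "v \<notin> imod p"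
  shows "wp n x (For v e p) (\<lambda>s' t. J M s' \<and> ivar s' v = int M \<and>
           t \<le> M * (T + 9 + icost e) + (7 + icost e)) s"
proof -
  let ?s0 = "s\<lparr>ivar := (ivar s)(v := 0)\<rparr>"
  let ?b = "ILe (IAdd (IVar v) (N 1)) e"
  let ?p = "Seq p (IAssign v (IAdd (IVar v) (N 1)))"
  have fr: "frame (For v e p) s s'" if "frame ?p ?s0 s'" for s'
    using that unfolding frame_def by auto
  have "wp n x (While ?b ?p) (\<lambda>s' t. (J M s' \<and> ivar s' v = int M) \<and>
      t \<le> M * ((T + 4) + 1 + bcost ?b) + (1 + bcost ?b)) ?s0"
  proof (rule wp_While)
    show "J 0 ?s0 \<and> ivar ?s0 v = int 0" using init by simp
  next
    fix i s' assume i: "i < M" and J: "J i s' \<and> ivar s' v = int i" and f: "frame ?p ?s0 s'"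
    have 1: "bval n x ?b s'" using bound[of i s'] fr[OF f] J i by simp
    have "wp n x ?p (\<lambda>s'' t. (J (Suc i) s'' \<and> ivar s'' v = int (Suc i)) \<and> t \<le> T + 4) s'"
    proof (rule wp_Seq, rule wp_conseq[OF step[OF i _ _ fr[OF f]]])
      fix s'' t
      assume f': "frame p s' s''"
        and J': "J (Suc i) (s''\<lparr>ivar := (ivar s'')(v := int (Suc i))\<rparr>) \<and> t \<le> T"
      have "ivar s'' v = int i" using f' v J by (simp add: frame_def)
      then show "wp n x (IAssign v (IAdd (IVar v) (N 1)))
           (\<lambda>s2 t2. (J (Suc i) s2 \<and> ivar s2 v = int (Suc i)) \<and> t + t2 \<le> T + 4) s''"
        using J' by (intro wp_IAssign) (simp add: add.commute)
    qed (use J in auto)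
    with 1 show "bval n x ?b s' \<and> wp n x ?p
        (\<lambda>s'' t. (J (Suc i) s'' \<and> ivar s'' v = int (Suc i)) \<and> t \<le> T + 4) s'" by blast
  next
    fix s' assume "J M s' \<and> ivar s' v = int M" "frame ?p ?s0 s'"
    then show "\<not> bval n x ?b s'" using bound[of M s'] fr by simp
  qed
  then show ?thesis
    unfolding For_def
    by (intro wp_Seq wp_IAssign) (auto elim!: wp_conseq simp: algebra_simps)
qed

section \<open>Expected values of a postcondition, with divergence valued at infinity\<close>

definition ewp :: "outcome \<Rightarrow> (state \<Rightarrow> nat \<Rightarrow> ennreal) \<Rightarrow> ennreal" where
  "ewp \<mu> \<phi> = (\<integral>\<^sup>+ r. (case r of None \<Rightarrow> \<infinity> | Some (s, t) \<Rightarrow> \<phi> s t) \<partial>measure_pmf \<mu>)"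

lemma ewp_return: "ewp (return_spmf (s, t)) \<phi> = \<phi> s t"
  by (simp add: ewp_def)

lemma ewp_bind:
  "ewp (bind_spmf \<mu> f) \<phi> =
     (\<integral>\<^sup>+ r. (case r of None \<Rightarrow> \<infinity> | Some a \<Rightarrow> ewp (f a) \<phi>) \<partial>measure_pmf \<mu>)"
  unfolding ewp_def bind_spmf_def
  by (auto simp: intro!: nn_integral_cong split: option.split)

lemma ewp_map:
  "ewp (map_spmf g \<mu>) \<phi> =
     (\<integral>\<^sup>+ r. (case r of None \<Rightarrow> \<infinity> | Some a \<Rightarrow> \<phi> (fst (g a)) (snd (g a))) \<partial>measure_pmf \<mu>)"
  unfolding ewp_def by (auto intro!: nn_integral_cong split: option.split prod.split)

lemma ewp_tick: "ewp (tick c \<mu>) \<phi> = ewp \<mu> (\<lambda>s t. \<phi> s (c + t))"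
  unfolding tick_def ewp_map by (auto simp: ewp_def intro!: nn_integral_cong split: option.split)

lemma ewp_seq_run:
  "ewp (seq_run \<mu> f) \<phi> = ewp \<mu> (\<lambda>s t. ewp (f s) (\<lambda>s' t'. \<phi> s' (t + t')))"
  unfolding seq_run_def ewp_bind ewp_tick
  by (auto simp: ewp_def intro!: nn_integral_cong split: option.split)

lemma ewp_Rand:
  assumes "ival e s = int M" and "M > 0"
  shows "ewp (exec n x (Rand v e) s) \<phi> =
    (\<Sum>d<M. \<phi> (s\<lparr>ivar := (ivar s)(v := int d)\<rparr>) (1 + icost e)) / of_nat M"
proof -
  have fin: "finite {0..<int M}" "{0..<int M} \<noteq> {}" using assms by auto
  have "spmf_of_set {0..<int M} = map_pmf Some (pmf_of_set {0..<int M})"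
    using fin by (simp add: spmf_of_set_def spmf_of_pmf_def)
  then have "ewp (exec n x (Rand v e) s) \<phi> = (\<integral>\<^sup>+ r. \<phi> (s\<lparr>ivar := (ivar s)(v := r)\<rparr>) (1 + icost e)
       \<partial>measure_pmf (pmf_of_set {0..<int M}))"
    using assms by (simp add: ewp_map max_def)
  also have "\<dots> = (\<Sum>r\<in>{0..<int M}. \<phi> (s\<lparr>ivar := (ivar s)(v := r)\<rparr>) (1 + icost e)) / of_nat M"
    using fin by (simp add: nn_integral_pmf_of_set)
  also have "(\<Sum>r\<in>{0..<int M}. \<phi> (s\<lparr>ivar := (ivar s)(v := r)\<rparr>) (1 + icost e)) =
     (\<Sum>d<M. \<phi> (s\<lparr>ivar := (ivar s)(v := int d)\<rparr>) (1 + icost e))"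
    by (rule sum.reindex_bij_witness[of _ int nat]) auto
  finally show ?thesis .
qed

text \<open>A program with a \<open>wp\<close> property has a point mass as its distribution, so its
  expectation is the value at a single final state. This carries the deterministic analysis into the
  probabilistic one.\<close>

lemma ewp_wp:
  assumes "wp n x P Q s" and "\<And>s' t. frame P s s' \<Longrightarrow> Q s' t \<Longrightarrow> \<phi> s' t \<le> B"
  shows "ewp (exec n x P s) \<phi> \<le> B"
  using assms unfolding wp_def by (auto simp: ewp_return)

lemma expected_time_ewp: "expected_time \<mu> = ewp \<mu> (\<lambda>s t. of_nat t)"
  by (simp add: expected_time_def ewp_def)

text \<open>The integrand is infinite on divergence, hence dominates the indicator of everything
  that is not a successful outcome: diverging runs are charged as failures too.\<close>

lemma success_probability_ewp:
  assumes "ewp \<mu> (\<lambda>s t. indicator {s. \<not> outputs_dft n x s} s) \<le> ennreal p" and "0 \<le> p"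
  shows "success_probability n x \<mu> \<ge> 1 - p"
proof -
  let ?A = "{(s, t). outputs_dft n x s}"
  let ?g = "\<lambda>r. case r of None \<Rightarrow> \<infinity> | Some (s, t) \<Rightarrow> (indicator {s. \<not> outputs_dft n x s} s :: ennreal)"
  have "emeasure (measure_pmf \<mu>) (- (Some ` ?A)) = (\<integral>\<^sup>+ r. indicator (- (Some ` ?A)) r \<partial>measure_pmf \<mu>)"
    by (simp add: nn_integral_indicator)
  also have "\<dots> \<le> (\<integral>\<^sup>+ r. ?g r \<partial>measure_pmf \<mu>)"
    by (intro nn_integral_mono) (auto split: option.split simp: indicator_def)
  also have "\<dots> \<le> ennreal p" using assms(1) by (simp add: ewp_def)
  finally have "measure (measure_pmf \<mu>) (- (Some ` ?A)) \<le> p"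
    using assms(2) by (simp add: measure_pmf.emeasure_eq_measure)
  moreover have "measure (measure_pmf \<mu>) (- (Some ` ?A)) = 1 - measure (measure_pmf \<mu>) (Some ` ?A)"
    using measure_pmf.prob_compl[of "Some ` ?A" \<mu>] by (simp add: Compl_eq_Diff_UNIV)
  moreover have "success_probability n x \<mu> = measure (measure_pmf \<mu>) (Some ` ?A)"
    unfolding success_probability_def by (simp add: measure_measure_spmf_conv_measure_pmf)
  ultimately show ?thesis by simp
qed

section \<open>Roots of unity and the Dirichlet kernel\<close>

lemma omega_powi_cis: "omega n powi h = cis (- (2 * pi * of_int h / real n))"
proof -
  have "omega n = cis (- (2 * pi / real n))"
    by (simp add: omega_def cis_conv_exp mult.commute mult.assoc)
  then show ?thesis by (simp add: cis_power_int mult_ac)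
qed

lemma omega_nonzero [simp]: "omega n \<noteq> 0"
  by (simp add: omega_def)

lemma norm_omega_powi [simp]: "norm (omega n powi h) = 1"
  by (simp add: omega_powi_cis)

lemma omega_powi_add: "omega n powi (a + b) = omega n powi a * omega n powi b"
  by (simp add: power_int_add)

lemma omega_powi_period: "n > 0 \<Longrightarrow> omega n powi (int n * h) = 1"
  using cis_multiple_2pi[of "- of_int h"] by (simp add: omega_powi_cis mult_ac)

lemma omega_powi_cong:
  assumes "n > 0" and "[a = b] (mod int n)"
  shows "omega n powi a = omega n powi b"
proof -
  obtain q where "a = b + int n * q"
    using assms(2) by (metis cong_iff_lin cong_sym)
  then show ?thesis using assms(1) by (simp add: omega_powi_add omega_powi_period)
qed

lemma norm_1_minus_omega:
  "norm (1 - omega n powi h) = 2 * \<bar>sin (pi * of_int h / real n)\<bar>"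
proof -
  let ?t = "pi * of_int h / real n"
  have eq: "omega n powi h = cis (- (2 * ?t))" by (simp add: omega_powi_cis algebra_simps)
  have "(norm (1 - omega n powi h))\<^sup>2 = (1 - cos (2 * ?t))\<^sup>2 + (sin (2 * ?t))\<^sup>2"
    unfolding eq cmod_power2 by simp
  also have "\<dots> = (2 * sin ?t)\<^sup>2"
  proof -
    have "cos (2 * ?t) = 1 - 2 * (sin ?t)\<^sup>2" by (rule cos_double_sin)
    moreover have "sin (2 * ?t) = 2 * sin ?t * cos ?t" by (rule sin_double)
    moreover have "(cos ?t)\<^sup>2 = 1 - (sin ?t)\<^sup>2" by (rule cos_squared_eq)
    ultimately show ?thesis
      by (simp add: power_mult_distrib) (simp add: power2_eq_square power4_eq_xxxx algebra_simps)
  qed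
  finally have "norm (1 - omega n powi h) = \<bar>2 * sin ?t\<bar>"
    by (metis abs_norm_cancel power2_eq_iff_nonneg abs_ge_zero power2_abs norm_ge_zero)
  then show ?thesis by (simp add: abs_mult)
qed

text \<open>On [0, pi/2] the concave function sin lies above its chord.\<close>

lemma Jordan_inequality:
  assumes "0 \<le> x" and "x \<le> pi / 2"
  shows "2 * x / pi \<le> sin x"
proof -
  have "convex_on {0..pi/2} (\<lambda>x. - sin x)"
  proof (rule f''_ge0_imp_convex)
    show "((\<lambda>x. - sin x) has_real_derivative (- cos x)) (at x)" for x :: real
      by (auto intro!: derivative_eq_intros)
    show "((\<lambda>x. - cos x) has_real_derivative sin x) (at x)" for x :: real
      by (auto intro!: derivative_eq_intros)
    show "sin x \<ge> 0" if "x \<in> {0..pi/2}" for x :: real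
      using that by (intro sin_ge_zero) auto
  qed auto
  from convex_onD[OF this, of "2 * x / pi" 0 "pi / 2"] assms pi_gt_zero show ?thesis
    by (simp add: field_simps)
qed

text \<open>Jordan's inequality at the half angle pi |t| / n, which is at most pi/2 for a balanced
  residue. Together with the upper bound 8 |t| / n, this determines 1 - \<omega>^t in modulus up to
  a factor 2, which is all that the kernel estimates use.\<close>

lemma chord_lower:
  assumes "n > 0" and "2 * \<bar>t\<bar> \<le> int n"
  shows "4 * \<bar>of_int t\<bar> / real n \<le> norm (1 - omega n powi t)"
proof -
  let ?x = "pi * \<bar>of_int t\<bar> / real n"
  have "real_of_int (2 * \<bar>t\<bar>) \<le> real_of_int (int n)" using assms(2) of_int_le_iff by blast
  then have "2 * \<bar>real_of_int t\<bar> \<le> real n" by simp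
  then have "?x \<le> pi / 2" using assms(1) pi_gt_zero by (simp add: field_simps)
  then have "2 * ?x / pi \<le> sin ?x" by (intro Jordan_inequality) auto
  also have "sin ?x \<le> \<bar>sin (pi * of_int t / real n)\<bar>"
    by (cases "t \<ge> 0") auto
  finally show ?thesis by (simp add: norm_1_minus_omega)
qed

lemma chord_upper:
  assumes "n > 0"
  shows "norm (1 - omega n powi t) \<le> 8 * \<bar>of_int t\<bar> / real n"
proof -
  have "2 * \<bar>sin (pi * of_int t / real n)\<bar> \<le> 2 * \<bar>pi * of_int t / real n\<bar>"
    using abs_sin_x_le_abs_x by (meson mult_left_mono zero_le_numeral)
  also have "\<dots> = 2 * pi * \<bar>of_int t\<bar> / real n" by (simp add: abs_mult)
  also have "\<dots> \<le> 8 * \<bar>of_int t\<bar> / real n"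
    using pi_less_4 by (intro divide_right_mono mult_right_mono) auto
  finally show ?thesis by (simp add: norm_1_minus_omega)
qed

lemma balanced_residue:
  assumes "n > 0"
  obtains t where "[h = t] (mod int n)" and "2 * \<bar>t\<bar> \<le> int n"
proof -
  let ?r = "h mod int n"
  define t where "t = (if 2 * ?r \<le> int n then ?r else ?r - int n)"
  have "[h = t] (mod int n)" by (auto simp: t_def cong_def)
  moreover have "0 \<le> ?r" "?r < int n" using assms by auto
  then have "2 * \<bar>t\<bar> \<le> int n" unfolding t_def by (cases "2 * ?r \<le> int n") auto
  ultimately show ?thesis by (rule that)
qed

lemma omega_powi_eq_1_iff:
  assumes "n > 0"
  shows "omega n powi h = 1 \<longleftrightarrow> int n dvd h"
proof
  assume *: "omega n powi h = 1"
  obtain t where t: "[h = t] (mod int n)" "2 * \<bar>t\<bar> \<le> int n"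
    using balanced_residue[OF assms] by blast
  then have "omega n powi t = 1" using * omega_powi_cong[OF assms] by metis
  then have "4 * \<bar>of_int t\<bar> / real n \<le> (0::real)" using chord_lower[OF assms t(2)] by simp
  then have "t = 0" using assms by (simp add: divide_le_0_iff)
  then show "int n dvd h" using t(1) by (simp add: cong_0_iff)
next
  assume "int n dvd h"
  then show "omega n powi h = 1" using omega_powi_period[OF assms] by auto
qed

lemma omega_powi_nat_mult: "omega n powi (int a * h) = (omega n powi h) ^ a"
  by (simp add: power_int_mult mult.commute flip: power_int_of_nat)

section \<open>The Dirichlet kernel, Fourier inversion, main lobe and tails\<close>

definition dirichlet :: "nat \<Rightarrow> nat \<Rightarrow> int \<Rightarrow> complex" where
  "dirichlet n B h = (\<Sum>a<B. omega n powi (int a * h))"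

lemma dirichlet_cong:
  assumes "n > 0" and "[g = h] (mod int n)"
  shows "dirichlet n B g = dirichlet n B h"
  unfolding dirichlet_def
  using assms by (intro sum.cong refl omega_powi_cong cong_mult) auto

lemma dirichlet_eq:
  assumes "n > 0"
  shows "dirichlet n B h = (if h mod int n = 0 then of_nat B
    else (1 - omega n powi (int B * h)) / (1 - omega n powi h))"
proof (cases "h mod int n = 0")
  case True
  then have "omega n powi h = 1" using assms by (simp add: omega_powi_eq_1_iff dvd_eq_mod_eq_0)
  then show ?thesis using True by (simp add: dirichlet_def omega_powi_nat_mult)
next
  case False
  then have "omega n powi h \<noteq> 1" using assms by (simp add: omega_powi_eq_1_iff dvd_eq_mod_eq_0)
  then show ?thesis using False
    unfolding dirichlet_def omega_powi_nat_mult
    by (simp add: sum_gp_strict)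
qed

lemma omega_orthogonal:
  assumes "n > 0"
  shows "(\<Sum>j\<in>{1..int n}. omega n powi (j * h)) = (if int n dvd h then of_nat n else 0)"
proof -
  have "(\<Sum>j\<in>{1..int n}. omega n powi (j * h)) = (\<Sum>a<n. omega n powi ((int a + 1) * h))"
    by (rule sum.reindex_bij_witness[of _ "\<lambda>a. int a + 1" "\<lambda>j. nat (j - 1)"]) auto
  also have "\<dots> = omega n powi h * dirichlet n n h"
    by (simp add: dirichlet_def sum_distrib_left omega_powi_add algebra_simps)
  also have "\<dots> = (if int n dvd h then of_nat n else 0)"
    using assms omega_powi_eq_1_iff[OF assms, of h]
    by (auto simp: dirichlet_eq dvd_eq_mod_eq_0 omega_powi_period)
  finally show ?thesis .
qed

lemma idx_range: "n > 0 \<Longrightarrow> idx n j \<in> {1..int n}"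
  using pos_mod_bound[of "int n" "j - 1"] by (auto simp: idx_def simp del: pos_mod_bound)

lemma idx_cong: "n > 0 \<Longrightarrow> [idx n j = j] (mod int n)"
  by (simp add: idx_def cong_def) (metis diff_add_cancel mod_add_left_eq)

lemma dft_inversion:
  assumes "n > 0"
  shows "x (idx n j) = 1 / of_real (sqrt (real n)) * (\<Sum>f\<in>{1..int n}. dft n x f * omega n powi (- (f * j)))"
proof -
  let ?i = "idx n j"
  have i: "?i \<in> {1..int n}" using idx_range[OF assms] .
  have e: "omega n powi (f * l) * omega n powi (- (f * j)) = omega n powi (f * (l - ?i))" for f l
  proof -
    have "omega n powi (f * l) * omega n powi (- (f * j)) = omega n powi (f * (l - j))"
      by (simp add: algebra_simps flip: omega_powi_add)
    also have "\<dots> = omega n powi (f * (l - ?i))"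
      using idx_cong[OF assms, of j]
      by (intro omega_powi_cong assms cong_mult cong_diff) (auto simp: cong_sym)
    finally show ?thesis .
  qed
  have "(\<Sum>f\<in>{1..int n}. dft n x f * omega n powi (- (f * j))) =
      1 / of_real (sqrt (real n)) * (\<Sum>f\<in>{1..int n}. \<Sum>l\<in>{1..int n}. x l * omega n powi (f * (l - ?i)))"
    unfolding dft_def sum_distrib_left sum_distrib_right
    by (intro sum.cong refl) (simp add: mult_ac flip: e)
  also have "(\<Sum>f\<in>{1..int n}. \<Sum>l\<in>{1..int n}. x l * omega n powi (f * (l - ?i))) =
      (\<Sum>l\<in>{1..int n}. x l * (\<Sum>f\<in>{1..int n}. omega n powi (f * (l - ?i))))"
    by (subst sum.swap) (simp add: sum_distrib_left)
  also have "\<dots> = (\<Sum>l\<in>{1..int n}. if l = ?i then x l * of_nat n else 0)"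
  proof (intro sum.cong refl)
    fix l assume l: "l \<in> {1..int n}"
    have "int n dvd (l - ?i) \<longleftrightarrow> l = ?i"
    proof
      assume "int n dvd (l - ?i)"
      moreover have "\<bar>l - ?i\<bar> < int n" using l i by auto
      ultimately show "l = ?i" using zdvd_imp_le[of "int n" "\<bar>l - ?i\<bar>"] by fastforce
    qed auto
    then show "x l * (\<Sum>f\<in>{1..int n}. omega n powi (f * (l - ?i))) = (if l = ?i then x l * of_nat n else 0)"
      by (simp add: omega_orthogonal[OF assms])
  qed
  also have "\<dots> = x ?i * of_nat n" using i by simp
  also have "x ?i * of_nat n = x ?i * (complex_of_real (sqrt (real n)) * complex_of_real (sqrt (real n)))"
    by (simp flip: of_real_mult)
  finally show ?thesis
    using assms by simp
qed

text \<open>In the closed form the numerator is at least 4 B |t| / n and the denominator at most 8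
  |t| / n. For n = B W the condition on \<open>t\<close> says |t| \<le> W / 2, so the bound covers a
  whole bucket.\<close>

lemma dirichlet_core:
  assumes "n > 0" and "B > 0" and "2 * int B * \<bar>t\<bar> \<le> int n"
  shows "real B / 2 \<le> norm (dirichlet n B t)"
proof (cases "t = 0")
  case True
  then show ?thesis by (simp add: dirichlet_def)
next
  case False
  let ?t = "\<bar>real_of_int t\<bar>"
  have "2 * (int B * \<bar>t\<bar>) \<le> int n" using assms by simp
  moreover have "1 * \<bar>t\<bar> \<le> int B * \<bar>t\<bar>" using assms by (intro mult_right_mono) auto
  ultimately have "2 * \<bar>t\<bar> \<le> int n" by linarith
  moreover have "2 * \<bar>int B * t\<bar> \<le> int n" using assms by (simp add: abs_mult)
  ultimately have "4 * ?t / real n \<le> norm (1 - omega n powi t)"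
    and lo2: "4 * (real B * ?t) / real n \<le> norm (1 - omega n powi (int B * t))"
    using chord_lower[OF assms(1), of t] chord_lower[OF assms(1), of "int B * t"]
    by (auto simp: abs_mult)
  moreover have "0 < 4 * ?t / real n" using False assms(1) by simp
  ultimately have lo: "0 < norm (1 - omega n powi t)" by linarith
  have nd: "t mod int n \<noteq> 0"
    using lo omega_powi_eq_1_iff[OF assms(1), of t] by (auto simp: dvd_eq_mod_eq_0)
  have "real B / 2 = (4 * (real B * ?t) / real n) / (8 * ?t / real n)"
    using False assms by simp
  also have "\<dots> \<le> norm (1 - omega n powi (int B * t)) / norm (1 - omega n powi t)"
    using lo lo2 chord_upper[OF assms(1), of t] by (intro frac_le) auto
  finally show ?thesis using nd by (simp add: dirichlet_eq[OF assms(1)] norm_divide)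
qed

text \<open>Inside its own bucket a frequency has kernel value at least \<open>B / 2\<close> (\<open>dirichlet_core\<close>), so the
  \<open>m\<close>-th power attenuates the far ones by \<open>2\<^sup>m\<close> relative to it.\<close>

definition far :: "nat \<Rightarrow> nat \<Rightarrow> int \<Rightarrow> bool" where
  "far n B h \<longleftrightarrow> norm (dirichlet n B h) \<le> real B / 4"

lemma far_cong: "n > 0 \<Longrightarrow> [g = h] (mod int n) \<Longrightarrow> far n B g = far n B h"
  unfolding far_def using dirichlet_cong by metis

text \<open>In the closed form the numerator is at most 2 and the denominator at least 4 |t| / n.
  The kernel is thus bounded by n / (2 |t|), which is at most B / 4 from two bucket widths
  on.\<close>

lemma not_far:
  assumes "n > 0" and "B > 0" and "\<not> far n B h"
  shows "\<exists>t. [h = t] (mod int n) \<and> int B * \<bar>t\<bar> < 2 * int n"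
proof -
  obtain t where t: "[h = t] (mod int n)" "2 * \<bar>t\<bar> \<le> int n"
    using balanced_residue[OF assms(1)] by blast
  have "int B * \<bar>t\<bar> < 2 * int n"
  proof (rule ccontr)
    assume "\<not> int B * \<bar>t\<bar> < 2 * int n"
    then have "real_of_int (2 * int n) \<le> real_of_int (int B * \<bar>t\<bar>)" using of_int_le_iff not_le by blast
    then have Bt: "2 * real n \<le> real B * \<bar>of_int t\<bar>" by simp
    then have t0: "t \<noteq> 0" using assms by auto
    have lo: "4 * \<bar>of_int t\<bar> / real n \<le> norm (1 - omega n powi t)"
      using chord_lower[OF assms(1) t(2)] .
    have pos: "0 < 4 * \<bar>of_int t\<bar> / real n" using t0 assms by simp
    then have nd: "t mod int n \<noteq> 0"
      using lo omega_powi_eq_1_iff[OF assms(1), of t] by (auto simp: dvd_eq_mod_eq_0)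
    have "norm (dirichlet n B t) = norm (1 - omega n powi (int B * t)) / norm (1 - omega n powi t)"
      using nd by (simp add: dirichlet_eq[OF assms(1)] norm_divide)
    also have "\<dots> \<le> 2 / (4 * \<bar>of_int t\<bar> / real n)"
      using norm_triangle_ineq4[of 1 "omega n powi (int B * t)"] lo pos by (intro frac_le) auto
    also have "\<dots> \<le> real B / 4" using Bt t0 assms by (simp add: field_simps)
    finally have "far n B t" by (simp add: far_def)
    then show False using assms(3) far_cong[OF assms(1) t(1)] by simp
  qed
  with t show ?thesis by blast
qed

lemma far_full:
  assumes "n > 0" and "\<not> int n dvd h"
  shows "far n n h"
  using assms by (auto simp: far_def dirichlet_eq omega_powi_period dvd_eq_mod_eq_0)

section \<open>Random dilations\<close>

text \<open>Within one class modulo \<open>c\<close> an element is determined by its quotient by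
  \<open>c\<close>, and there are n / c quotients.\<close>

lemma card_residue_class_le:
  fixes c :: nat
  assumes "c > 0" and "c dvd n" and A: "A \<subseteq> {..<n}"
    and cong: "\<And>d d'. d \<in> A \<Longrightarrow> d' \<in> A \<Longrightarrow> [int d = int d'] (mod int c)"
  shows "card A \<le> n div c"
proof -
  have "inj_on (\<lambda>d. d div c) A"
  proof (rule inj_onI)
    fix d d' assume "d \<in> A" "d' \<in> A" "d div c = d' div c"
    moreover from this have "d mod c = d' mod c"
      using cong[of d d'] by (metis cong_def zmod_int of_nat_eq_iff)
    ultimately show "d = d'" by (metis div_mult_mod_eq)
  qed
  then have "card A = card ((\<lambda>d. d div c) ` A)" by (simp add: card_image)
  also have "\<dots> \<le> card {..<n div c}"
  proof (rule card_mono)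
    show "(\<lambda>d. d div c) ` A \<subseteq> {..<n div c}"
      using A assms(1,2) by (auto simp: less_mult_imp_div_less div_mult_self_is_m dvd_div_mult_self)
  qed simp
  finally show ?thesis by simp
qed

text \<open>The multiplier \<open>2d + 1\<close> moves a nonzero difference \<open>\<delta> = 2\<^sup>a o\<close> to an odd multiple of
  \<open>2\<^sup>a\<close>, and each of them modulo \<open>2\<^sup>e\<close> is attained \<open>2\<^sup>a\<^sup>+\<^sup>1\<close> times.\<close>

lemma card_odd_multiplier_near:
  fixes \<delta> :: int and T :: nat
  assumes n: "n = 2 ^ e" and \<delta>: "\<not> int n dvd \<delta>"
  shows "card {d \<in> {..<n}. \<exists>t. [(2 * int d + 1) * \<delta> = t] (mod int n) \<and> \<bar>t\<bar> \<le> int T} \<le> 4 * T"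
    (is "card ?D \<le> _")
proof -
  from \<delta> have "\<delta> \<noteq> 0" by auto
  then obtain w where "\<delta> = 2 ^ multiplicity 2 \<delta> * w" "odd w"
    using multiplicity_decompose'[of \<delta> 2] by auto
  then obtain a where ao: "\<delta> = 2 ^ a * w" "odd w" by blast
  have ae: "a < e"
  proof (rule ccontr)
    assume "\<not> a < e"
    then have "(2::int) ^ e dvd 2 ^ a" by (simp add: le_imp_power_dvd)
    then show False using \<delta> ao n by auto
  qed
  have co: "coprime (2 ^ j :: int) w" for j using ao(2) by simp
  \<comment> \<open>The value of (2 d + 1) \<delta> modulo 2^e determines \<open>d\<close> modulo
    \<open>c\<close> only: of the e binary digits, \<delta> absorbs a and the factor 2 one
    more.\<close>
  define c where "c = (2::nat) ^ (e - a - 1)"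
  \<comment> \<open>Oddness of the cofactor q is used only to exclude q = 0. This removes the
    additive constant: the count vanishes for T < 2^a and is proportional to T in general.\<close>
  define R where "R = (\<lambda>q. 2 ^ a * q) ` ({- int (T div 2 ^ a)..int (T div 2 ^ a)} - {0})"
  have R: "card R \<le> 2 * (T div 2 ^ a)"
  proof -
    have "card R \<le> card ({- int (T div 2 ^ a)..int (T div 2 ^ a)} - {0})"
      unfolding R_def by (rule card_image_le) simp
    also have "\<dots> = 2 * (T div 2 ^ a)"
      by (subst card_Diff_singleton) auto
    finally show ?thesis .
  qed
  have "?D \<subseteq> (\<Union>t\<in>R. {d \<in> {..<n}. [(2 * int d + 1) * \<delta> = t] (mod int n)})"
  proof
    fix d assume "d \<in> ?D"
    then obtain t where d: "d < n" and t: "[(2 * int d + 1) * \<delta> = t] (mod int n)" "\<bar>t\<bar> \<le> int T" by auto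
    have "[(2 * int d + 1) * \<delta> = t] (mod 2 ^ (a + 1))"
      by (rule cong_dvd_modulus[OF t(1)]) (use ae in \<open>auto simp: n simp del: power_Suc intro!: le_imp_power_dvd\<close>)
    then obtain b where b: "t = (2 * int d + 1) * \<delta> + 2 ^ (a + 1) * b"
      by (metis cong_iff_lin)
    then have tq: "t = 2 ^ a * ((2 * int d + 1) * w + 2 * b)" by (simp add: ao algebra_simps)
    define q where "q = (2 * int d + 1) * w + 2 * b"
    have "odd q" using ao(2) by (simp add: q_def)
    then have "q \<noteq> 0" by auto
    moreover have "\<bar>q\<bar> \<le> int (T div 2 ^ a)"
    proof -
      have "\<bar>q\<bar> * 2 ^ a \<le> int T" using t(2) tq by (simp add: q_def abs_mult mult.commute)
      then have "\<bar>q\<bar> * 2 ^ a div 2 ^ a \<le> int T div 2 ^ a" by (rule zdiv_mono1) simp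
      then show ?thesis by (simp add: zdiv_int)
    qed
    ultimately have "t \<in> R"
      unfolding R_def by (intro image_eqI[of _ _ q]) (auto simp: tq q_def[symmetric] abs_le_iff)
    then show "d \<in> (\<Union>t\<in>R. {d \<in> {..<n}. [(2 * int d + 1) * \<delta> = t] (mod int n)})"
      using d t(1) by blast
  qed
  then have "card ?D \<le> card (\<Union>t\<in>R. {d \<in> {..<n}. [(2 * int d + 1) * \<delta> = t] (mod int n)})"
    by (rule card_mono[rotated]) (auto simp: R_def)
  also have "\<dots> \<le> (\<Sum>t\<in>R. card {d \<in> {..<n}. [(2 * int d + 1) * \<delta> = t] (mod int n)})"
    by (rule card_UN_le) (simp add: R_def)
  also have "\<dots> \<le> (\<Sum>t\<in>R. 2 ^ (a + 1))"
  proof (rule sum_mono)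
    fix t
    have "card {d \<in> {..<n}. [(2 * int d + 1) * \<delta> = t] (mod int n)} \<le> n div c"
    proof (rule card_residue_class_le)
      fix d d' assume "d \<in> {d \<in> {..<n}. [(2 * int d + 1) * \<delta> = t] (mod int n)}"
        "d' \<in> {d \<in> {..<n}. [(2 * int d + 1) * \<delta> = t] (mod int n)}"
      then have "[(2 * int d + 1) * \<delta> = (2 * int d' + 1) * \<delta>] (mod int n)"
        by (auto intro: cong_trans cong_sym)
      then have "2 ^ e dvd (2 * int d + 1) * \<delta> - (2 * int d' + 1) * \<delta>"
        by (simp add: n cong_iff_dvd_diff)
      also have "(2 * int d + 1) * \<delta> - (2 * int d' + 1) * \<delta> = 2 ^ (a + 1) * (w * (int d - int d'))"
        by (simp add: ao algebra_simps)
      also have "(2::int) ^ e = 2 ^ (a + 1) * int c"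
        using ae by (simp add: c_def flip: power_add power_Suc)
      finally have "int c dvd w * (int d - int d')" by simp
      moreover have "coprime (int c) w" using co[of "e - a - 1"] by (simp add: c_def)
      ultimately have "int c dvd int d - int d'" by (simp add: coprime_dvd_mult_right_iff)
      then show "[int d = int d'] (mod int c)" by (simp add: cong_iff_dvd_diff)
    qed (auto simp: c_def n intro!: le_imp_power_dvd)
    also have "n div c = 2 ^ (a + 1)"
      using ae unfolding n c_def by (subst power_diff[symmetric]) auto
    finally show "card {d \<in> {..<n}. [(2 * int d + 1) * \<delta> = t] (mod int n)} \<le> 2 ^ (a + 1)" .
  qed
  also have "\<dots> \<le> 2 * (T div 2 ^ a) * 2 ^ (a + 1)" using R by simp
  also have "\<dots> = 4 * (T div 2 ^ a * 2 ^ a)" by simp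
  also have "\<dots> \<le> 4 * T" by (intro mult_left_mono) auto
  finally show ?thesis .
qed

section \<open>Buckets and collisions under a random dilation\<close>

definition bucket :: "nat \<Rightarrow> nat \<Rightarrow> int \<Rightarrow> int" where
  "bucket n W g = ((g + int (W div 2)) mod int n) div int W"

text \<open>The multiples of \<open>n div B\<close> are the bucket centres. Pairs are ordered, so z
  audible frequencies contribute z (z - 1).\<close>

definition bad_pairs :: "nat \<Rightarrow> nat \<Rightarrow> int \<Rightarrow> int set \<Rightarrow> nat \<Rightarrow> (int \<times> int) set" where
  "bad_pairs n B s S j = {(f, f') \<in> S \<times> S. f \<noteq> f' \<and>
     \<not> far n B (int j * int (n div B) - s * f) \<and> \<not> far n B (int j * int (n div B) - s * f')}"

lemma bucket_range:
  assumes "n = B * W" and "B > 0" and "W > 0"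
  shows "0 \<le> bucket n W g" and "bucket n W g < int B"
proof -
  have n: "0 < int n" using assms by simp
  show "0 \<le> bucket n W g"
    unfolding bucket_def using n assms(3) by (simp add: pos_imp_zdiv_nonneg_iff)
  have "(g + int (W div 2)) mod int n < int B * int W" using n assms(1) by (metis of_nat_mult pos_mod_bound)
  moreover have "bucket n W g * int W \<le> (g + int (W div 2)) mod int n"
    unfolding bucket_def using assms(3) by (metis div_mult_mod_eq le_add_same_cancel1 of_nat_0_less_iff pos_mod_sign)
  ultimately have "bucket n W g * int W < int B * int W" by linarith
  then show "bucket n W g < int B" using assms(3) by simp
qed

lemma bucket_decomp:
  assumes "n = B * W" and "B > 0" and "W > 0"
  obtains r where "[g = bucket n W g * int W + r - int (W div 2)] (mod int n)" and "0 \<le> r" and "r < int W"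
proof
  let ?m = "(g + int (W div 2)) mod int n"
  have "?m = bucket n W g * int W + ?m mod int W" unfolding bucket_def by (simp add: mult.commute)
  moreover have "[g = ?m - int (W div 2)] (mod int n)"
    by (simp add: cong_def mod_diff_left_eq)
  ultimately show "[g = bucket n W g * int W + ?m mod int W - int (W div 2)] (mod int n)" by simp
  show "0 \<le> ?m mod int W" "?m mod int W < int W" using assms(3) by auto
qed

text \<open>A position is at most W / 2 away from the centre of its bucket, which is the range
  covered by \<open>dirichlet_core\<close>.\<close>

lemma bucket_core:
  assumes n: "n = B * W" "B > 0" "W > 0" and B: "even W \<or> W = 1"
  shows "real B / 2 \<le> norm (dirichlet n B (bucket n W g * int W - g))"
proof -
  obtain r where r: "[g = bucket n W g * int W + r - int (W div 2)] (mod int n)" "0 \<le> r" "r < int W"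
    using bucket_decomp[OF n] by blast
  have n0: "n > 0" using n by simp
  define t where "t = int (W div 2) - r"
  have "[bucket n W g * int W - g = bucket n W g * int W - (bucket n W g * int W + r - int (W div 2))] (mod int n)"
    by (intro cong_diff cong_refl r)
  then have c: "[bucket n W g * int W - g = t] (mod int n)" by (simp add: t_def)
  have "2 * \<bar>t\<bar> \<le> int W"
    using B r unfolding t_def by (auto elim!: evenE)
  then have "int B * (2 * \<bar>t\<bar>) \<le> int B * int W" using n(2) by (intro mult_left_mono) auto
  then have "2 * int B * \<bar>t\<bar> \<le> int n" using n(1) by simp
  then show ?thesis using dirichlet_core[OF n0 n(2)] dirichlet_cong[OF n0 c] by metis
qed

text \<open>An audible position is less than 2 W from the centre j W and at most W / 2 from the
  centre of its own bucket. The two centres differ by a multiple q W, so |q| < 3.\<close>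

lemma not_far_bucket:
  assumes n: "n = B * W" "B > 0" "W > 0" and j: "j < B"
    and nf: "\<not> far n B (int j * int W - g)"
  shows "\<exists>q\<in>{-2..2}. int j = (bucket n W g + q) mod int B"
proof -
  have n0: "n > 0" using n by simp
  obtain t where t: "[int j * int W - g = t] (mod int n)" "int B * \<bar>t\<bar> < 2 * int n"
    using not_far[OF n0 n(2) nf] by blast
  have "int B * \<bar>t\<bar> < int B * (2 * int W)" using t(2) n(1) by simp
  then have tW: "\<bar>t\<bar> < 2 * int W" using n(2) by simp
  obtain r where r: "[g = bucket n W g * int W + r - int (W div 2)] (mod int n)" "0 \<le> r" "r < int W"
    using bucket_decomp[OF n] by blast
  have "[(int j * int W - g) + g = t + (bucket n W g * int W + r - int (W div 2))] (mod int n)"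
    by (intro cong_add t r)
  then obtain k where k: "t + (bucket n W g * int W + r - int (W div 2)) = int j * int W + int n * k"
    by (auto simp: cong_iff_lin)
  define q where "q = int j + int B * k - bucket n W g"
  have q: "t + r - int (W div 2) = int W * q" using k n(1) by (simp add: q_def algebra_simps)
  have "- 3 * int W < int W * q" "int W * q < int W * 3"
    using q tW r by linarith+
  then have "int W * (-3) < int W * q" "int W * q < int W * 3" by auto
  then have "-3 < q" "q < 3" using n(3) by (simp_all only: mult_less_cancel_left_pos of_nat_0_less_iff)
  moreover have "(bucket n W g + q) mod int B = int j"
    using j by (simp add: q_def)
  ultimately show ?thesis by (intro bexI[of _ q]) auto
qed

lemma card_not_far:
  assumes n: "n = B * W" "B > 0" "W > 0"
  shows "card {j \<in> {..<B}. \<not> far n B (int j * int W - g)} \<le> 5"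
proof -
  have "int ` {j \<in> {..<B}. \<not> far n B (int j * int W - g)} \<subseteq> (\<lambda>q. (bucket n W g + q) mod int B) ` {-2..2}"
    using not_far_bucket[OF n] by blast
  then have "card (int ` {j \<in> {..<B}. \<not> far n B (int j * int W - g)}) \<le> card {-2..2::int}"
    by (meson surj_card_le finite_atLeastAtMost_int)
  then show ?thesis by (simp add: card_image)
qed

text \<open>Summation over the ordered pairs of frequencies. Two of them audible in the same bucket
  are dilated to positions less than 4 W apart, which holds for at most 16 W multipliers; each
  multiplier then accounts for at most 5 buckets, whence 80 W.\<close>

lemma sum_bad_pairs:
  assumes n: "n = B * W" "B > 0" "W > 0" "n = 2 ^ e" and S: "S \<subseteq> {1..int n}"
  shows "(\<Sum>d<n. \<Sum>j<B. card (bad_pairs n B (2 * int d + 1) S j)) \<le> 80 * W * (card S)\<^sup>2"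
proof -
  have fin: "finite S" using S finite_subset by blast
  have W: "n div B = W" using n by simp
  define J where "J d f f' = {j \<in> {..<B}. \<not> far n B (int j * int W - (2 * int d + 1) * f) \<and>
      \<not> far n B (int j * int W - (2 * int d + 1) * f')}" for d f f'
  define P where "P = {(f, f') \<in> S \<times> S. f \<noteq> f'}"
  have finP: "finite P" by (rule finite_subset[of _ "S \<times> S"]) (use fin in \<open>auto simp: P_def\<close>)
  have "card P \<le> card (S \<times> S)" unfolding P_def using fin by (intro card_mono) auto
  then have cP: "card P \<le> (card S)\<^sup>2" by (simp add: card_cartesian_product power2_eq_square)
  have eq: "(\<Sum>j<B. card (bad_pairs n B (2 * int d + 1) S j)) = (\<Sum>(f, f')\<in>P. card (J d f f'))" for d
  proof -
    have "(\<Sum>j<B. card (bad_pairs n B (2 * int d + 1) S j)) =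
        (\<Sum>j<B. \<Sum>p\<in>P. if j \<in> J d (fst p) (snd p) then 1 else 0)"
    proof (intro sum.cong refl)
      fix j assume "j \<in> {..<B}"
      then have "bad_pairs n B (2 * int d + 1) S j = {p \<in> P. j \<in> J d (fst p) (snd p)}"
        by (auto simp: bad_pairs_def P_def J_def W)
      then show "card (bad_pairs n B (2 * int d + 1) S j) = (\<Sum>p\<in>P. if j \<in> J d (fst p) (snd p) then 1 else 0)"
        using finP by (simp flip: sum.inter_filter)
    qed
    also have "\<dots> = (\<Sum>p\<in>P. \<Sum>j<B. if j \<in> J d (fst p) (snd p) then 1 else 0)" by (rule sum.swap)
    also have "\<dots> = (\<Sum>p\<in>P. card (J d (fst p) (snd p)))"
    proof (intro sum.cong refl)
      fix p
      have "{j \<in> {..<B}. j \<in> J d (fst p) (snd p)} = J d (fst p) (snd p)" by (auto simp: J_def)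
      then show "(\<Sum>j<B. if j \<in> J d (fst p) (snd p) then 1 else 0) = card (J d (fst p) (snd p))"
        by (simp flip: sum.inter_filter)
    qed
    finally show ?thesis by (simp add: case_prod_beta)
  qed
  have one: "(\<Sum>d<n. card (J d f f')) \<le> 80 * W" if "(f, f') \<in> P" for f f'
  proof -
    let ?D = "{d \<in> {..<n}. \<exists>t. [(2 * int d + 1) * (f - f') = t] (mod int n) \<and> \<bar>t\<bar> \<le> int (4 * W)}"
    have nd: "\<not> int n dvd (f - f')"
    proof
      assume "int n dvd f - f'"
      moreover have "f \<in> {1..int n}" "f' \<in> {1..int n}" using that S by (auto simp: P_def)
      then have "\<bar>f - f'\<bar> < int n" "f - f' \<noteq> 0" using that by (auto simp: P_def abs_less_iff)
      ultimately show False using zdvd_imp_le[of "int n" "\<bar>f - f'\<bar>"] by auto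
    qed
    have "(\<Sum>d<n. card (J d f f')) \<le> (\<Sum>d<n. if d \<in> ?D then 5 else 0)"
    proof (rule sum_mono)
      fix d assume d: "d \<in> {..<n}"
      have "card (J d f f') \<le> card {j \<in> {..<B}. \<not> far n B (int j * int W - (2 * int d + 1) * f)}"
        by (intro card_mono) (auto simp: J_def)
      also have "\<dots> \<le> 5" by (rule card_not_far[OF n(1-3)])
      finally have le5: "card (J d f f') \<le> 5" .
      show "card (J d f f') \<le> (if d \<in> ?D then 5 else 0)"
      proof (cases "J d f f' = {}")
        case False
        then obtain j where j: "\<not> far n B (int j * int W - (2 * int d + 1) * f)"
          "\<not> far n B (int j * int W - (2 * int d + 1) * f')" by (auto simp: J_def)
        have n0: "n > 0" using n by simp
        have bd: "\<bar>t\<bar> < 2 * int W" if "int B * \<bar>t\<bar> < 2 * int n" for t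
        proof -
          have "int B * \<bar>t\<bar> < int B * (2 * int W)" using that n(1) by simp
          then show ?thesis using n(2) by simp
        qed
        obtain t t' where t: "[int j * int W - (2 * int d + 1) * f = t] (mod int n)" "\<bar>t\<bar> < 2 * int W"
          "[int j * int W - (2 * int d + 1) * f' = t'] (mod int n)" "\<bar>t'\<bar> < 2 * int W"
          using not_far[OF n0 n(2) j(1)] not_far[OF n0 n(2) j(2)] bd by blast
        have "[(int j * int W - (2 * int d + 1) * f') - (int j * int W - (2 * int d + 1) * f) = t' - t] (mod int n)"
          by (intro cong_diff t)
        then have "[(2 * int d + 1) * (f - f') = t' - t] (mod int n)" by (simp add: algebra_simps)
        moreover have "\<bar>t' - t\<bar> \<le> int (4 * W)" using t by linarith
        ultimately have "d \<in> ?D" using d by blast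
        then show ?thesis using le5 by simp
      qed simp
    qed
    also have "\<dots> = 5 * card ?D" by (subst sum.inter_filter[symmetric]) auto
    also have "card ?D \<le> 4 * (4 * W)" by (rule card_odd_multiplier_near[OF n(4) nd])
    finally show ?thesis by simp
  qed
  have "(\<Sum>d<n. \<Sum>j<B. card (bad_pairs n B (2 * int d + 1) S j)) = (\<Sum>p\<in>P. \<Sum>d<n. card (J d (fst p) (snd p)))"
    unfolding eq by (subst sum.swap) (simp add: case_prod_beta)
  also have "\<dots> \<le> (\<Sum>p\<in>P. 80 * W)"
    by (intro sum_mono one) auto
  also have "\<dots> \<le> 80 * W * (card S)\<^sup>2" using cP by simp
  finally show ?thesis .
qed

text \<open>With n buckets a frequency is audible only exactly at its dilated position, and
  multiplication by a unit is injective modulo n.\<close>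

lemma bad_pairs_full:
  assumes "n > 0" and "S \<subseteq> {1..int n}" and "coprime s (int n)"
  shows "bad_pairs n n s S j = {}"
proof -
  have False if "f \<in> S" "f' \<in> S" "f \<noteq> f'" "\<not> far n n (int j - s * f)" "\<not> far n n (int j - s * f')" for f f'
  proof -
    have "int n dvd int j - s * f" "int n dvd int j - s * f'" using that far_full[OF assms(1)] by blast+
    then have "int n dvd (int j - s * f') - (int j - s * f)" by (rule dvd_diff[rotated])
    then have "int n dvd s * (f - f')" by (simp add: algebra_simps)
    then have "int n dvd f - f'" using assms(3) by (simp add: coprime_dvd_mult_right_iff coprime_commute)
    moreover have "f \<in> {1..int n}" "f' \<in> {1..int n}" using that assms(2) by auto
    then have "\<bar>f - f'\<bar> < int n" "f - f' \<noteq> 0" using that by (auto simp: abs_less_iff)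
    ultimately show False using zdvd_imp_le[of "int n" "\<bar>f - f'\<bar>"] by auto
  qed
  then show ?thesis using assms(1) by (auto simp: bad_pairs_def)
qed

text \<open>A bucket in which \<open>z \<ge> 2\<close> residual frequencies are audible contributes at most these and one
  spurious update to the new residual, and \<open>z + 1 \<le> 2 z (z - 1)\<close>.\<close>

lemma card_residual_le:
  assumes n: "n = B * W" "B > 0" "W > 0" "even W \<or> W = 1"
    and S: "S \<subseteq> {1..int n}" and S': "S' \<subseteq> {1..int n}"
    and good: "\<And>j f. j < B \<Longrightarrow> bad_pairs n B s S j = {} \<Longrightarrow> f \<in> S' \<Longrightarrow> bucket n W (s * f) \<noteq> int j"
    and one: "\<And>j. j < B \<Longrightarrow> \<exists>f0. {f \<in> S'. bucket n W (s * f) = int j} \<subseteq> insert f0 {f \<in> S. bucket n W (s * f) = int j}"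
  shows "card S' \<le> 2 * (\<Sum>j<B. card (bad_pairs n B s S j))"
proof -
  let ?b = "\<lambda>f. bucket n W (s * f)"
  have fin: "finite S" "finite S'" using S S' finite_subset by blast+
  have W: "n div B = W" using n by simp
  have "S' \<subseteq> (\<Union>j\<in>{..<B}. {f \<in> S'. ?b f = int j})"
  proof
    fix f assume "f \<in> S'"
    moreover have "?b f = int (nat (?b f))" "nat (?b f) < B" using bucket_range[OF n(1-3), of "s * f"] by auto
    ultimately show "f \<in> (\<Union>j\<in>{..<B}. {f \<in> S'. ?b f = int j})" by blast
  qed
  then have "card S' \<le> card (\<Union>j\<in>{..<B}. {f \<in> S'. ?b f = int j})" using fin by (intro card_mono) auto
  also have "\<dots> \<le> (\<Sum>j<B. card {f \<in> S'. ?b f = int j})" by (rule card_UN_le) simp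
  also have "\<dots> \<le> (\<Sum>j<B. 2 * card (bad_pairs n B s S j))"
  proof (rule sum_mono)
    fix j assume "j \<in> {..<B}"
    then have j: "j < B" by simp
    show "card {f \<in> S'. ?b f = int j} \<le> 2 * card (bad_pairs n B s S j)"
    proof (cases "bad_pairs n B s S j = {}")
      case True
      then have "{f \<in> S'. ?b f = int j} = {}" using good[OF j] by blast
      then have "card {f \<in> S'. ?b f = int j} = 0" by (simp only: card.empty)
      then show ?thesis by simp
    next
      case False
      define Z where "Z = {f \<in> S. \<not> far n B (int j * int W - s * f)}"
      have finZ: "finite Z" using fin by (simp add: Z_def)
      have sub: "{f \<in> S. ?b f = int j} \<subseteq> Z"
      proof
        fix f assume f: "f \<in> {f \<in> S. ?b f = int j}"
        then have "real B / 2 \<le> norm (dirichlet n B (int j * int W - s * f))"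
          using bucket_core[OF n, of "s * f"] by simp
        then show "f \<in> Z" using f n(2) by (auto simp: Z_def far_def)
      qed
      have bp: "bad_pairs n B s S j = Z \<times> Z - Id_on Z" by (auto simp: bad_pairs_def Z_def W)
      have "Id_on Z = (\<lambda>f. (f, f)) ` Z" by auto
      then have cI: "card (Id_on Z) = card Z" by (simp add: card_image inj_on_def)
      have "card (bad_pairs n B s S j) = card Z * card Z - card Z"
        unfolding bp using finZ cI \<open>Id_on Z = _\<close>
        by (subst card_Diff_subset) (auto simp: card_cartesian_product)
      moreover have "card Z \<ge> 2"
      proof (rule ccontr)
        assume "\<not> card Z \<ge> 2"
        then have "card Z = 0 \<or> card Z = Suc 0" by auto
        then have "bad_pairs n B s S j = {}" using finZ unfolding bp by (auto simp: card_Suc_eq)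
        with False show False by simp
      qed
      ultimately have b: "card Z + 1 \<le> 2 * card (bad_pairs n B s S j)"
      proof -
        assume c: "card (bad_pairs n B s S j) = card Z * card Z - card Z" and z: "2 \<le> card Z"
        have "2 * card Z \<le> card Z * card Z" using z by simp
        then show ?thesis using c z by linarith
      qed
      obtain f0 where "{f \<in> S'. ?b f = int j} \<subseteq> insert f0 {f \<in> S. ?b f = int j}" using one[OF j] by blast
      also have "\<dots> \<subseteq> insert f0 Z" using sub by blast
      finally have "card {f \<in> S'. ?b f = int j} \<le> card (insert f0 Z)" using finZ by (intro card_mono) auto
      also have "\<dots> \<le> card Z + 1" using finZ by (simp add: card_insert_if)
      finally show ?thesis using b by simp
    qed
  qed
  finally show ?thesis by (simp add: sum_distrib_left)
qed

section \<open>Filtering and decoding\<close>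

lemma sum_in_Nats:
  "(\<And>i. i \<in> A \<Longrightarrow> f i \<in> \<nat>) \<Longrightarrow> sum f A \<in> (\<nat> :: 'a::semiring_1 set)"
  by (induction A rule: infinite_finite_induct) auto

lemma coeff_power_in_Nats:
  fixes p :: "complex poly"
  assumes "\<And>i. coeff p i \<in> \<nat>"
  shows "coeff (p ^ m) i \<in> \<nat>"
proof (induction m arbitrary: i)
  case 0
  then show ?case by (cases i) auto
next
  case (Suc m)
  have "(\<Sum>j\<le>i. coeff p j * coeff (p ^ m) (i - j)) \<in> \<nat>"
    by (rule sum_in_Nats) (use assms Suc in auto)
  then show ?case by (simp add: coeff_mult)
qed

text \<open>The witnesses are the coefficients of the m-th power of 1 + z + ... + z^(B-1). They are
  natural numbers because products of polynomials with natural coefficients are again of this kind,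
  and the degree m (B - 1) is below m B.\<close>

lemma boxcar_power_coeffs:
  assumes "m > 0" and "B > 0"
  obtains c :: "nat \<Rightarrow> nat"
  where "\<And>z::complex. (\<Sum>t<m * B. of_nat (c t) * z ^ t) = (\<Sum>a<B. z ^ a) ^ m"
proof -
  define p :: "complex poly" where "p = (\<Sum>a<B. monom 1 a)"
  have cp: "coeff p i = (if i < B then 1 else 0)" for i
    by (simp add: p_def coeff_sum)
  have "degree p \<le> B - 1" by (rule degree_le) (use assms in \<open>auto simp: cp\<close>)
  then have "degree (p ^ m) \<le> (B - 1) * m"
    using degree_power_le[of p m] by (meson le_trans mult_le_mono1)
  also have "\<dots> < m * B" using assms by (simp add: mult.commute)
  finally have deg: "degree (p ^ m) < m * B" .
  have "\<forall>i. \<exists>k. coeff (p ^ m) i = of_nat k"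
    using coeff_power_in_Nats[of p m] cp by (auto elim!: Nats_cases) (metis Nats_0 Nats_1 Nats_cases)
  then obtain c where c: "\<And>i. coeff (p ^ m) i = of_nat (c i)" by metis
  have "(\<Sum>t<m * B. of_nat (c t) * z ^ t) = (\<Sum>a<B. z ^ a) ^ m" for z :: complex
  proof -
    have "poly (p ^ m) z = (\<Sum>t\<le>degree (p ^ m). coeff (p ^ m) t * z ^ t)" by (rule poly_altdef)
    also have "\<dots> = (\<Sum>t<m * B. coeff (p ^ m) t * z ^ t)"
      by (rule sum.mono_neutral_left) (use deg in \<open>auto simp: coeff_eq_0\<close>)
    finally have "poly (p ^ m) z = (\<Sum>t<m * B. of_nat (c t) * z ^ t)" by (simp only: c)
    then show ?thesis by (simp add: p_def poly_sum poly_monom)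
  qed
  then show ?thesis by (rule that)
qed

text \<open>Integer arguments are needed twice: at 1 the identity bounds the coefficients, and at
  \<open>B ^ m + 1\<close> it gives the integer from whose digits the program recovers them.\<close>

lemma boxcar_power_int:
  fixes c :: "nat \<Rightarrow> nat" and X :: int
  assumes "\<And>z::complex. (\<Sum>t<M. of_nat (c t) * z ^ t) = (\<Sum>a<B. z ^ a) ^ m"
  shows "(\<Sum>t<M. int (c t) * X ^ t) = (\<Sum>a<B. X ^ a) ^ m"
proof -
  have "(of_int (\<Sum>t<M. int (c t) * X ^ t) :: complex) = of_int ((\<Sum>a<B. X ^ a) ^ m)"
    using assms[of "of_int X"] by simp
  then show ?thesis using of_int_eq_iff by blast
qed

lemma boxcar_coeff_le:
  fixes c :: "nat \<Rightarrow> nat"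
  assumes "\<And>z::complex. (\<Sum>t<M. of_nat (c t) * z ^ t) = (\<Sum>a<B. z ^ a) ^ m" and "t < M"
  shows "int (c t) \<le> int B ^ m"
proof -
  have "int (c t) \<le> (\<Sum>t<M. int (c t))" by (rule member_le_sum) (use assms(2) in auto)
  also have "\<dots> = int B ^ m" using boxcar_power_int[OF assms(1), of 1] by simp
  finally show ?thesis .
qed

lemma base_digits:
  fixes X :: int
  assumes "i < M" and "0 \<le> c i" and "c i < X"
  shows "(\<Sum>t\<in>{i..<M}. c t * X ^ (t - i)) mod X = c i"
    and "(\<Sum>t\<in>{i..<M}. c t * X ^ (t - i)) div X = (\<Sum>t\<in>{Suc i..<M}. c t * X ^ (t - Suc i))"
proof -
  have "(\<Sum>t\<in>{i..<M}. c t * X ^ (t - i)) = c i + (\<Sum>t\<in>{Suc i..<M}. c t * X ^ (t - i))"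
    using assms(1) by (simp add: sum.atLeast_Suc_lessThan)
  also have "(\<Sum>t\<in>{Suc i..<M}. c t * X ^ (t - i)) = X * (\<Sum>t\<in>{Suc i..<M}. c t * X ^ (t - Suc i))"
    unfolding sum_distrib_left
  proof (intro sum.cong refl)
    fix t assume "t \<in> {Suc i..<M}"
    then have "t - i = Suc (t - Suc i)" by auto
    then show "c t * X ^ (t - i) = X * (c t * X ^ (t - Suc i))" by simp
  qed
  finally have *: "(\<Sum>t\<in>{i..<M}. c t * X ^ (t - i)) = c i + X * (\<Sum>t\<in>{Suc i..<M}. c t * X ^ (t - Suc i))" .
  show "(\<Sum>t\<in>{i..<M}. c t * X ^ (t - i)) mod X = c i" using assms by (simp add: *)
  show "(\<Sum>t\<in>{i..<M}. c t * X ^ (t - i)) div X = (\<Sum>t\<in>{Suc i..<M}. c t * X ^ (t - Suc i))"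
    using assms by (simp add: *)
qed

text \<open>Sampling at s (t + \<tau>) moves the frequency f to s f and turns the shift into a
  phase; the window contributes the m-th power of the kernel. Folding the samples modulo B loses
  nothing, because at a multiple of W the twiddle factor depends on t modulo B only.
  \<open>S\<close> stands for an approximation of sqrt n, so that the prefactor is close to
  1.\<close>

lemma bucket_transform:
  assumes n: "n = B * W" "B > 0" "W > 0"
    and c: "\<And>z::complex. (\<Sum>t<M. of_nat (c t) * z ^ t) = (\<Sum>a<B. z ^ a) ^ m"
  shows "(\<Sum>i<B. omega n powi (int W * (int i * int j)) *
      (\<Sum>t | t < M \<and> t mod B = i. of_nat (c t) * (S * x (idx n (s * (int t + \<tau>)))))) =
    S / of_real (sqrt (real n)) *
      (\<Sum>f\<in>{1..int n}. dft n x f * omega n powi (- (s * f * \<tau>)) * dirichlet n B (int j * int W - s * f) ^ m)"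
proof -
  have n0: "n > 0" using n by simp
  let ?r = "complex_of_real (sqrt (real n))"
  let ?g = "\<lambda>t. of_nat (c t) * (S * x (idx n (s * (int t + \<tau>))))"
  have ph: "omega n powi (int W * (int (t mod B) * int j)) = omega n powi (int t * (int j * int W))" for t
  proof -
    have "[int (t mod B) = int t] (mod int B)" by (simp add: cong_def zmod_int)
    then have "[int W * int (t mod B) = int W * int t] (mod int W * int B)"
      by (metis cong_iff_dvd_diff mult_dvd_mono dvd_refl right_diff_distrib)
    then have "[(int W * int (t mod B)) * int j = (int W * int t) * int j] (mod int W * int B)"
      by (rule cong_scalar_right)
    then show ?thesis
      using n(1) by (intro omega_powi_cong[OF n0]) (simp add: mult_ac)
  qed
  have "(\<Sum>i<B. omega n powi (int W * (int i * int j)) * (\<Sum>t | t < M \<and> t mod B = i. ?g t)) =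
      (\<Sum>i<B. \<Sum>t | t \<in> {..<M} \<and> t mod B = i. omega n powi (int t * (int j * int W)) * ?g t)"
    unfolding sum_distrib_left by (intro sum.cong refl) (use ph in auto)
  also have "\<dots> = (\<Sum>t<M. omega n powi (int t * (int j * int W)) * ?g t)"
    by (rule sum.group) (use n(2) in auto)
  also have "\<dots> = (\<Sum>t<M. \<Sum>f\<in>{1..int n}. S / ?r *
      (dft n x f * omega n powi (- (s * f * \<tau>)) * (of_nat (c t) * (omega n powi (int j * int W - s * f)) ^ t)))"
  proof (intro sum.cong refl)
    fix t
    have "omega n powi (int t * (int j * int W)) * omega n powi (- (f * (s * (int t + \<tau>)))) =
        omega n powi (- (s * f * \<tau>)) * (omega n powi (int j * int W - s * f)) ^ t" for f
      unfolding omega_powi_nat_mult[symmetric] omega_powi_add[symmetric]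
      by (simp add: algebra_simps)
    then have eq: "S / ?r * (dft n x f * omega n powi (- (s * f * \<tau>)) * (of_nat (c t) * (omega n powi (int j * int W - s * f)) ^ t))
       = S / ?r * of_nat (c t) * dft n x f * (omega n powi (int t * (int j * int W)) * omega n powi (- (f * (s * (int t + \<tau>)))))" for f
      by (simp add: mult_ac)
    then show "omega n powi (int t * (int j * int W)) * ?g t = (\<Sum>f\<in>{1..int n}. S / ?r *
      (dft n x f * omega n powi (- (s * f * \<tau>)) * (of_nat (c t) * (omega n powi (int j * int W - s * f)) ^ t)))"
      unfolding dft_inversion[OF n0, of x "s * (int t + \<tau>)"] sum_distrib_left eq
      by (intro sum.cong refl) (simp add: mult_ac)
  qed
  also have "\<dots> = (\<Sum>f\<in>{1..int n}. S / ?r * (dft n x f * omega n powi (- (s * f * \<tau>)) *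
      (\<Sum>t<M. of_nat (c t) * (omega n powi (int j * int W - s * f)) ^ t)))"
    by (subst sum.swap) (simp add: sum_distrib_left mult_ac)
  finally show ?thesis
    unfolding c by (simp add: dirichlet_def omega_powi_nat_mult sum_distrib_left mult_ac)
qed

section \<open>The approximate square root and the noise in a bucket\<close>

primrec newton_sqrt :: "nat \<Rightarrow> nat \<Rightarrow> real" where
  "newton_sqrt n 0 = real n"
| "newton_sqrt n (Suc i) = (newton_sqrt n i + real n / newton_sqrt n i) / 2"

text \<open>An iterate s with error d is followed by one with error d^2 / (2 s), which is at most d
  / 2 since s \<ge> d. Halving the error in each step suffices, as 4 m steps are affordable.\<close>

lemma newton_sqrt_bounds:
  assumes "n > 0"
  shows "sqrt (real n) \<le> newton_sqrt n i \<and> newton_sqrt n i - sqrt (real n) \<le> real n / 2 ^ i"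
proof (induction i)
  case 0
  have "sqrt (real n) \<le> real n" using assms by (intro real_le_lsqrt) (auto simp: power2_eq_square)
  then show ?case by simp
next
  case (Suc i)
  let ?r = "sqrt (real n)" and ?s = "newton_sqrt n i"
  have r: "0 < ?r" "?r \<le> ?s" using assms Suc by auto
  then have "0 < ?s" by linarith
  have "(s + r * r / s) / 2 - r = (s - r) * ((s - r) / s) / 2" if "s \<noteq> 0" for r s :: real
    using that by (simp add: field_simps)
  from this[of ?s ?r] have eq: "newton_sqrt n (Suc i) - ?r = (?s - ?r) * ((?s - ?r) / ?s) / 2"
    using r by simp
  note r = r \<open>0 < ?s\<close>
  have q: "0 \<le> (?s - ?r) / ?s" "(?s - ?r) / ?s \<le> 1" using r by (simp_all add: divide_le_eq_1)
  define p where "p = (?s - ?r) * ((?s - ?r) / ?s)"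
  have "p \<le> (?s - ?r) * 1" unfolding p_def using q r by (intro mult_left_mono) auto
  moreover have "0 \<le> p" using q r by (simp add: p_def)
  moreover have "newton_sqrt n (Suc i) - ?r = p / 2" using eq by (simp only: p_def)
  ultimately have "?r \<le> newton_sqrt n (Suc i) \<and> newton_sqrt n (Suc i) - ?r \<le> (real n / 2 ^ i) / 2"
    using Suc.IH by argo
  then show ?case by simp
qed

text \<open>\<open>q\<close> marks the frequencies whose estimate has been subtracted from the
  bucket under consideration. At an audible frequency the subtraction is complete and leaves
  \<open>xh f - z f\<close>. At a far one it may or may not have happened, and in either case at
  most (L + 4 L) (B/4)^m remains. The factor \<sigma> accounts for the inexact square root.\<close>

lemma residual_noise:
  fixes xh z :: "int \<Rightarrow> int" and L :: nat
  assumes n0: "n > 0" and eps: "norm (\<sigma> - 1) \<le> \<epsilon>"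
    and xh: "\<And>f. f \<in> {1..int n} \<Longrightarrow> \<bar>xh f\<bar> \<le> int L" and z: "\<And>f. f \<in> {1..int n} \<Longrightarrow> \<bar>z f\<bar> \<le> 4 * int L"
    and F: "finite F" "F \<subseteq> {1..int n}" "\<And>f. z f \<noteq> 0 \<Longrightarrow> f \<in> F"
    and near: "\<And>f. f \<in> {1..int n} \<Longrightarrow> \<not> far n B (g f) \<Longrightarrow> q f"
    and w: "\<And>f. norm (w f :: complex) = 1"
  shows "norm ((\<sigma> * (\<Sum>f\<in>{1..int n}. of_int (xh f) * w f * dirichlet n B (g f) ^ m)
        - (\<Sum>f | f \<in> F \<and> q f. of_int (z f) * w f * dirichlet n B (g f) ^ m))
      - (\<Sum>f | f \<in> {1..int n} \<and> xh f \<noteq> z f \<and> \<not> far n B (g f).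
           of_int (xh f - z f) * w f * dirichlet n B (g f) ^ m))
    \<le> real n * (\<epsilon> * real L * real B ^ m + 5 * real L * (real B / 4) ^ m)"
proof -
  let ?K = "\<lambda>f. w f * dirichlet n B (g f) ^ m"
  define r where "r f = of_int (xh f) - (if f \<in> F \<and> q f then of_int (z f) else 0)
      - (if xh f \<noteq> z f \<and> \<not> far n B (g f) then of_int (xh f - z f) else 0 :: complex)" for f
  have e1: "(\<Sum>f | f \<in> F \<and> q f. of_int (z f) * w f * dirichlet n B (g f) ^ m) =
      (\<Sum>f\<in>{1..int n}. (if f \<in> F \<and> q f then of_int (z f) else 0) * ?K f)"
    using F(2) by (intro sum.mono_neutral_cong_left) (auto simp: mult_ac)
  have e2: "(\<Sum>f | f \<in> {1..int n} \<and> xh f \<noteq> z f \<and> \<not> far n B (g f). of_int (xh f - z f) * w f * dirichlet n B (g f) ^ m) =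
      (\<Sum>f\<in>{1..int n}. (if xh f \<noteq> z f \<and> \<not> far n B (g f) then of_int (xh f - z f) else 0) * ?K f)"
    by (intro sum.mono_neutral_cong_left) (auto simp: mult_ac)
  have dB: "norm (dirichlet n B h) \<le> real B" for h
    unfolding dirichlet_def by (rule order_trans[OF norm_sum]) simp
  have "(\<sigma> * (\<Sum>f\<in>{1..int n}. of_int (xh f) * w f * dirichlet n B (g f) ^ m)
        - (\<Sum>f | f \<in> F \<and> q f. of_int (z f) * w f * dirichlet n B (g f) ^ m))
      - (\<Sum>f | f \<in> {1..int n} \<and> xh f \<noteq> z f \<and> \<not> far n B (g f).
           of_int (xh f - z f) * w f * dirichlet n B (g f) ^ m)
    = (\<Sum>f\<in>{1..int n}. ((\<sigma> - 1) * of_int (xh f) + r f) * ?K f)"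
    unfolding e1 e2 r_def sum_distrib_left sum_subtractf[symmetric]
    by (intro sum.cong refl) (simp add: algebra_simps)
  also have "norm \<dots> \<le> (\<Sum>f\<in>{1..int n}. \<epsilon> * real L * real B ^ m + 5 * real L * (real B / 4) ^ m)"
  proof (rule sum_norm_le)
    fix f assume f: "f \<in> {1..int n}"
    have ax: "norm (of_int (xh f) :: complex) \<le> real L"
      using xh[OF f] by (metis norm_of_int of_int_abs of_int_le_iff of_int_of_nat_eq)
    have az: "norm (of_int (z f) :: complex) \<le> 4 * real L"
    proof -
      have "real_of_int \<bar>z f\<bar> \<le> real_of_int (4 * int L)" using z[OF f] of_int_le_iff by blast
      then show ?thesis by simp
    qed
    have "norm ((\<sigma> - 1) * of_int (xh f) * ?K f) \<le> \<epsilon> * real L * real B ^ m"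
    proof -
      have "norm (\<sigma> - 1) * norm (of_int (xh f) :: complex) \<le> \<epsilon> * real L"
        using eps ax order_trans[OF norm_ge_zero eps] by (intro mult_mono) auto
      moreover have "norm (dirichlet n B (g f)) ^ m \<le> real B ^ m" using dB by (intro power_mono) auto
      ultimately show ?thesis
        unfolding norm_mult norm_power w using order_trans[OF norm_ge_zero eps]
        by (simp only: mult_1_left) (rule mult_mono, auto)
    qed
    moreover have "norm (r f * ?K f) \<le> 5 * real L * (real B / 4) ^ m"
    proof (cases "far n B (g f)")
      case True
      have "norm (r f) \<le> norm (of_int (xh f) :: complex) + norm (of_int (z f) :: complex)"
        unfolding r_def using True norm_triangle_ineq4[of "of_int (xh f) :: complex" "of_int (z f)"] by auto
      then have "norm (r f) \<le> 5 * real L" using ax az by linarith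
      then show ?thesis
        unfolding norm_mult norm_power using True
        by (simp only: w mult_1_left) (intro mult_mono power_mono, auto simp: far_def)
    next
      case False
      then have "r f = 0" using near[OF f] F(3)[of f] by (auto simp: r_def)
      then show ?thesis by simp
    qed
    ultimately show "norm (((\<sigma> - 1) * of_int (xh f) + r f) * ?K f)
        \<le> \<epsilon> * real L * real B ^ m + 5 * real L * (real B / 4) ^ m"
      using norm_triangle_ineq[of "(\<sigma> - 1) * of_int (xh f) * ?K f" "r f * ?K f"]
      by (simp add: algebra_simps)
  qed
  finally show ?thesis by simp
qed

text \<open>Relative to (B/2)^m, the factor B^m is larger by 2^m and (B/4)^m smaller by 2^m. Since n
  \<le> 2^m, the tolerance n / 2^(4 m) more than makes up for the former. Both errors are then
  multiples of L (B/2)^m / 2^m, with total constant 8 (1 + 5) = 48, below the 80 in the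
  hypothesis.\<close>

lemma noise_bound:
  fixes n L m B :: nat
  assumes "n > 0" and L: "80 * (real n)\<^sup>2 * real L \<le> 2 ^ m" and e: "\<epsilon> \<le> real n / 2 ^ (4 * m)" and L1: "L \<ge> 1"
  shows "8 * real n * (real n * (\<epsilon> * real L * real B ^ m + 5 * real L * (real B / 4) ^ m)) \<le> (real B / 2) ^ m"
proof -
  define \<mu> where "\<mu> = (real B / 2) ^ m"
  define q where "q = (2::real) ^ m"
  have q: "q > 0" and \<mu>: "\<mu> \<ge> 0" by (auto simp: q_def \<mu>_def)
  have B1: "real B ^ m = \<mu> * q" by (simp add: \<mu>_def q_def power_divide)
  have B2: "(real B / 4) ^ m = \<mu> / q"
    unfolding \<mu>_def q_def power_divide[symmetric] by simp
  have q4: "(2::real) ^ (4 * m) = q ^ 4" by (simp add: q_def power_mult mult.commute)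
  have n1: "1 \<le> real n" "1 \<le> real L" using assms(1) L1 by auto
  have nq: "real n \<le> q"
  proof -
    have "1 * real n \<le> real n * real n" using n1 by (intro mult_right_mono) auto
    moreover have "(real n * real n) * 1 \<le> (real n * real n) * (80 * real L)" using n1 by (intro mult_left_mono) auto
    moreover have "(real n * real n) * (80 * real L) \<le> q" using L by (simp add: q_def power2_eq_square mult_ac)
    ultimately show ?thesis by linarith
  qed
  have "\<epsilon> * real L * (\<mu> * q) \<le> (real n / q ^ 4) * real L * (\<mu> * q)"
    using e q \<mu> by (intro mult_right_mono) (auto simp: q4)
  also have "\<dots> = real L * \<mu> * (real n / q) / (q * q)" using q by (simp add: field_simps power4_eq_xxxx)
  also have "\<dots> \<le> real L * \<mu> * (1 * 1) / (q * 1)"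
    using nq q \<mu> n1 by (intro frac_le mult_mono mult_left_mono) (auto simp: field_simps)
  finally have t1: "\<epsilon> * real L * (\<mu> * q) \<le> real L * \<mu> / q" by simp
  have "8 * real n * (real n * (\<epsilon> * real L * (\<mu> * q) + 5 * real L * (\<mu> / q)))
      \<le> 8 * real n * (real n * (real L * \<mu> / q + 5 * real L * (\<mu> / q)))"
    using t1 by (intro mult_left_mono add_right_mono) auto
  also have "\<dots> = 48 * (real n)\<^sup>2 * real L / q * \<mu>" by (simp add: power2_eq_square field_simps)
  also have "\<dots> \<le> 1 * \<mu>"
  proof (rule mult_right_mono)
    have "48 * ((real n)\<^sup>2 * real L) \<le> 80 * ((real n)\<^sup>2 * real L)" by (intro mult_right_mono) auto
    also have "\<dots> \<le> q" using L by (simp add: q_def mult_ac)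
    finally show "48 * (real n)\<^sup>2 * real L / q \<le> 1" using q by (simp add: mult_ac)
  qed (rule \<mu>)
  finally show ?thesis by (simp add: B1 B2 \<mu>_def[symmetric])
qed

text \<open>Both time shifts carry the same amplitude \<open>v\<close>, so u1 - u0 w is pure noise,
  at most 2 \<nu>, while |u0| \<ge> \<mu> / 2 \<ge> 4 n \<nu>.\<close>

lemma ratio_error:
  fixes u0 u1 v w :: complex
  assumes "norm (u0 - v) \<le> \<nu>" and "norm (u1 - v * w) \<le> \<nu>" and "norm w = 1"
    and "\<mu> \<le> 2 * norm u0" and "8 * real n * \<nu> \<le> \<mu>" and "n > 0" and "\<mu> > 0"
  shows "2 * real n * norm (u1 / u0 - w) \<le> 1"
proof -
  have u0: "norm u0 > 0" using assms by linarith
  have "norm (u1 - u0 * w) = norm ((u1 - v * w) - (u0 - v) * w)" by (simp add: algebra_simps)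
  also have "\<dots> \<le> \<nu> + \<nu> * 1"
    using norm_triangle_ineq4[of "u1 - v * w" "(u0 - v) * w"] assms(1-3) by (simp add: norm_mult)
  finally have "norm (u1 - u0 * w) \<le> 2 * \<nu>" by simp
  then have "2 * real n * norm (u1 - u0 * w) \<le> 2 * real n * (2 * \<nu>)" by (intro mult_left_mono) auto
  also have "\<dots> \<le> norm u0" using assms by simp
  finally have "2 * real n * norm (u1 - u0 * w) / norm u0 \<le> 1" using u0 by (simp add: divide_le_eq_1)
  moreover have "u1 / u0 - w = (u1 - u0 * w) / u0" using u0 by (simp add: field_simps)
  ultimately show ?thesis by (simp add: norm_divide)
qed

section \<open>Locating a frequency by its phase\<close>

lemma Im_omega_ge:
  assumes "n > 0" and "1 \<le> d" and "4 * d \<le> int n"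
  shows "4 / real n \<le> Im (omega n powi (- d))"
proof -
  let ?x = "2 * pi * of_int d / real n"
  have "real_of_int (4 * d) \<le> real_of_int (int n)" using assms(3) of_int_le_iff by blast
  then have d: "4 * real_of_int d \<le> real n" by simp
  then have "?x \<le> pi / 2" using assms(1) pi_gt_zero by (simp add: field_simps)
  then have "2 * ?x / pi \<le> sin ?x" using assms by (intro Jordan_inequality) auto
  moreover have "4 / real n \<le> 2 * ?x / pi" using assms(1,2) by (simp add: divide_right_mono)
  ultimately show ?thesis by (simp add: omega_powi_cis)
qed

lemma Im_omega_nonneg: "n > 0 \<Longrightarrow> 0 \<le> d \<Longrightarrow> 4 * d \<le> int n \<Longrightarrow> 0 \<le> Im (omega n powi (- d))"
  using Im_omega_ge[of n d] by (cases "d = 0") (auto intro: order_trans[rotated])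

lemma Im_omega_minus: "Im (omega n powi (- d)) = - Im (omega n powi d)"
  by (simp add: omega_powi_cis)

text \<open>The side of \<open>g\<close> on which the true frequency lies is read off the half plane of
  \<open>R \<omega>\<^sup>g\<^sup>-\<^sup>1\<^sup>/\<^sup>2\<close>; the half-integer power is avoided by adding its two neighbours.\<close>

lemma phase_sign:
  assumes "n > 0" and R: "2 * real n * norm (R - omega n powi (- g0)) \<le> 1"
    and d: "4 * (\<bar>g - g0\<bar> + 1) \<le> int n"
  shows "0 \<le> Im (R * (omega n powi (g - 1) + omega n powi g)) \<longleftrightarrow> g \<le> g0"
proof -
  define E where "E = R - omega n powi (- g0)"
  define D where "D = g - g0"
  let ?S = "omega n powi (g - 1) + omega n powi g"
  have eq: "R * ?S = (omega n powi (D - 1) + omega n powi D) + E * ?S"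
    unfolding E_def D_def by (simp add: algebra_simps flip: omega_powi_add)
  \<comment> \<open>The error contributes at most 2 / (2 n) = 1 / n. In the main term the two
    imaginary parts never have opposite signs, and one of them belongs to a nonzero index within a
    quarter turn, hence has modulus at least 4 / n.\<close>
  have "norm ?S \<le> 2" using norm_triangle_ineq[of "omega n powi (g - 1)" "omega n powi g"] by simp
  then have "norm (E * ?S) \<le> norm E * 2" unfolding norm_mult by (intro mult_left_mono) auto
  also have "\<dots> \<le> 1 / real n" using R assms(1) by (simp add: E_def field_simps)
  finally have "\<bar>Im (E * ?S)\<bar> \<le> 1 / real n" using abs_Im_le_cmod order_trans by blast
  moreover have "1 / real n < 4 / real n" using assms(1) by (simp add: divide_strict_right_mono)
  ultimately have ie: "\<bar>Im (E * ?S)\<bar> < 4 / real n" by linarith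
  show ?thesis
  proof (cases "g \<le> g0")
    case True
    have "4 / real n \<le> Im (omega n powi (- (1 - D)))"
      by (rule Im_omega_ge) (use True d assms(1) in \<open>auto simp: D_def\<close>)
    moreover have "0 \<le> Im (omega n powi (- (- D)))"
      by (rule Im_omega_nonneg) (use True d assms(1) in \<open>auto simp: D_def\<close>)
    ultimately show ?thesis using True ie unfolding eq by simp
  next
    case False
    have "4 / real n \<le> Im (omega n powi (- D))"
      by (rule Im_omega_ge) (use False d assms(1) in \<open>auto simp: D_def\<close>)
    moreover have "0 \<le> Im (omega n powi (- (D - 1)))"
      by (rule Im_omega_nonneg) (use False d assms(1) in \<open>auto simp: D_def\<close>)
    ultimately show ?thesis
      using False ie unfolding eq by (simp add: Im_omega_minus del: minus_diff_eq)
  qed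
qed

text \<open>Distinct n-th roots of unity are at least 4 / n apart, while the two hypotheses allow
  only 3 / (2 n). The test of the program is weaker by a factor 2 than what noise permits, so it
  accepts the true position and, in a bucket without collisions, no other.\<close>

lemma phase_check:
  assumes "n > 0" and R: "2 * real n * norm (R - omega n powi (- g0)) \<le> 1"
    and c: "real n * norm (R - omega n powi (- g)) \<le> 1"
  shows "[g = g0] (mod int n)"
proof -
  obtain t where t: "[g - g0 = t] (mod int n)" "2 * \<bar>t\<bar> \<le> int n"
    using balanced_residue[OF assms(1)] by blast
  have "omega n powi (- g0) - omega n powi (- g) = (R - omega n powi (- g)) - (R - omega n powi (- g0))"
    by simp
  then have "norm (omega n powi (- g0) - omega n powi (- g)) \<le>
      norm (R - omega n powi (- g)) + norm (R - omega n powi (- g0))"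
    by (metis norm_triangle_ineq4)
  then have "real n * norm (omega n powi (- g0) - omega n powi (- g)) \<le>
      real n * (norm (R - omega n powi (- g)) + norm (R - omega n powi (- g0)))"
    by (intro mult_left_mono) auto
  also have "\<dots> < 4" using R c by (simp add: distrib_left)
  finally have lt: "real n * norm (omega n powi (- g0) - omega n powi (- g)) < 4" .
  have "omega n powi (- g0) - omega n powi (- g) = - (omega n powi (- g) * (1 - omega n powi (g - g0)))"
    by (simp add: algebra_simps flip: omega_powi_add)
  then have "norm (omega n powi (- g0) - omega n powi (- g)) = norm (1 - omega n powi t)"
    using omega_powi_cong[OF assms(1) t(1)] by (simp add: norm_mult)
  then have "real n * (4 * \<bar>of_int t\<bar> / real n) < 4"
    using lt chord_lower[OF assms(1) t(2)]
    by (metis le_less_trans mult_left_mono of_nat_0_le_iff)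
  then have "t = 0" using assms(1) by simp
  then show ?thesis using t(1) by (simp add: cong_iff_dvd_diff)
qed

section \<open>The program\<close>

abbreviation ILt :: "iexp \<Rightarrow> iexp \<Rightarrow> bexp" where
  "ILt e f \<equiv> ILe (IAdd e (N 1)) f"

abbreviation V :: "name \<Rightarrow> iexp" where "V \<equiv> IVar"

abbreviation norm2 :: "name \<Rightarrow> cexp" where
  "norm2 v \<equiv> CAdd (CMul (CRe (CVar v)) (CRe (CVar v))) (CMul (CIm (CVar v)) (CIm (CVar v)))"

text \<open>
  Roles of the variables: \<open>n = 2\<^sup>e\<close>; \<open>m = 2\<^sup>u\<close> is the filter exponent, also the bound on the bit lengths
  that have to be searched, and \<open>T = 2\<^sup>m\<close>; \<open>S\<close> approximates the square root of \<open>n\<close>; \<open>P > 2 L\<close> is a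
  power of two.  The \<open>q\<close>-th pass uses \<open>B\<close> buckets of width \<open>W = n / B\<close> centred (up to \<open>H\<close>) at the
  multiples of \<open>W\<close>, the dilation \<open>s = 2 d + 1\<close> and its inverse \<open>y\<close> modulo \<open>n\<close>.  The bucket contents for
  time shifts 0 and 1 are kept in \<open>a\<close> and \<open>b\<close> from position \<open>o\<close> on.  The estimate is \<open>z\<close>; \<open>F\<close> lists
  the \<open>c\<close> frequencies at which it was ever set, and \<open>K\<close> flags them.
\<close>

definition prog_kernel :: com where
  "prog_kernel = Seq
    (Cond (ILe (IMod (V ''h'') (V ''n'')) (N 0))
      (CAssign ''D'' (OfInt (V ''B'')))
      (CAssign ''D'' (CDiv (CSub (OfInt (N 1)) (Omega (IMul (V ''B'') (V ''h''))))
                           (CSub (OfInt (N 1)) (Omega (V ''h''))))))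
    (For ''w'' (V ''u'') (CAssign ''D'' (CMul (CVar ''D'') (CVar ''D''))))"

definition prog_phase :: com where
  "prog_phase = Seq (IAssign ''p'' (V ''W''))
    (While (ILt (N 1) (V ''p''))
      (Seq (IAssign ''p'' (IDiv (V ''p'') (N 2)))
        (Cond (ReLe (OfInt (N 0)) (CIm (CMul (CVar ''R'')
                 (CAdd (Omega (ISub (IAdd (V ''g'') (V ''p'')) (N 1)))
                       (Omega (IAdd (V ''g'') (V ''p'')))))))
          (IAssign ''g'' (IAdd (V ''g'') (V ''p''))) Skip)))"

text \<open>The comparison is w \<ge> v + p - 1/2 multiplied by 2, because literals are integers.
  The search runs through the 2^p values from -L on.\<close>

definition prog_round :: com where
  "prog_round = Seq (IAssign ''v'' (ISub (N 0) (V ''L''))) (Seq (IAssign ''p'' (V ''P''))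
    (While (ILt (N 1) (V ''p''))
      (Seq (IAssign ''p'' (IDiv (V ''p'') (N 2)))
        (Cond (ReLe (OfInt (ISub (IMul (N 2) (IAdd (V ''v'') (V ''p''))) (N 1)))
                    (CMul (OfInt (N 2)) (CVar ''w'')))
          (IAssign ''v'' (IAdd (V ''v'') (V ''p''))) Skip))))"

text \<open>The literal \<open>a\<close> is the only trace of the exponent c in L \<le> n^c: it
  scales m so that 2^m exceeds the required power of n.\<close>

definition prog_setup :: "int \<Rightarrow> com" where
  "prog_setup a =
    Seq (IAssign ''p'' (N 1))
   (Seq (While (ILt (V ''p'') (V ''n''))
          (Seq (IAssign ''p'' (IMul (N 2) (V ''p''))) (IAssign ''e'' (IAdd (V ''e'') (N 1)))))
   (Seq (IAssign ''m'' (N 1))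
   (Seq (While (ILt (V ''m'') (IMul (N a) (IAdd (V ''e'') (N 1))))
          (Seq (IAssign ''m'' (IMul (N 2) (V ''m''))) (IAssign ''u'' (IAdd (V ''u'') (N 1)))))
   (Seq (IAssign ''B'' (N 1))
   (Seq (While (BAnd (ILt (V ''B'') (IMul (N 8192) (V ''k''))) (ILt (V ''B'') (V ''n'')))
          (IAssign ''B'' (IMul (N 2) (V ''B''))))
   (Seq (IAssign ''P'' (N 1))
   (Seq (While (ILt (V ''P'') (IAdd (IMul (N 2) (V ''L'')) (N 1)))
          (IAssign ''P'' (IMul (N 2) (V ''P''))))
   (Seq (IAssign ''T'' (N 1))
   (Seq (For ''i'' (V ''m'') (IAssign ''T'' (IMul (N 2) (V ''T''))))
   (Seq (CAssign ''S'' (OfInt (V ''n'')))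
        (For ''i'' (IMul (N 4) (V ''m''))
          (CAssign ''S'' (CDiv (CAdd (CVar ''S'') (CDiv (OfInt (V ''n'')) (CVar ''S''))) (OfInt (N 2)))))
   ))))))))))"

text \<open>
  \<open>V\<close> is the value at \<open>X = B\<^sup>m + 1\<close> of the polynomial \<open>(1 + z + \<dots> + z\<^sup>B\<^sup>-\<^sup>1)\<^sup>m\<close>.  Its coefficients are at most
  \<open>B\<^sup>m\<close>, hence \<open>prog_sample\<close> finds them as the base \<open>X\<close> digits of \<open>V\<close>.
\<close>

definition prog_hash :: com where
  "prog_hash =
    Seq (IAssign ''s'' (IAdd (IMul (N 2) (V ''d'')) (N 1)))
   (Seq (IAssign ''y'' (N 0))
   (Seq (For ''i'' (V ''e'') (IAssign ''y'' (IAdd (N 1) (IMul (ISub (N 1) (V ''s'')) (V ''y'')))))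
   (Seq (IAssign ''M'' (N 1))
   (Seq (For ''i'' (V ''m'') (IAssign ''M'' (IMul (V ''M'') (V ''B''))))
   (Seq (IAssign ''X'' (IAdd (V ''M'') (N 1)))
   (Seq (IAssign ''G'' (N 0))
   (Seq (For ''i'' (V ''B'') (IAssign ''G'' (IAdd (N 1) (IMul (V ''X'') (V ''G'')))))
   (Seq (IAssign ''V'' (N 1))
   (Seq (For ''i'' (V ''m'') (IAssign ''V'' (IMul (V ''V'') (V ''G''))))
   (Seq (IAssign ''W'' (IDiv (V ''n'') (V ''B'')))
        (IAssign ''H'' (IDiv (V ''W'') (N 2)))))))))))))"

text \<open>One digit of \<open>V\<close> is consumed per sample, lowest first. The window
  coefficients thus cost O(1) each, and the products are folded modulo \<open>B\<close> at
  once.\<close>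

definition prog_sample :: com where
  "prog_sample =
    Seq (For ''i'' (V ''B'')
          (Seq (CStore ''a'' (V ''i'') (OfInt (N 0))) (CStore ''b'' (V ''i'') (OfInt (N 0)))))
        (For ''i'' (IMul (V ''m'') (V ''B''))
          (Seq (CStore ''a'' (IMod (V ''i'') (V ''B''))
                 (CAdd (CArr ''a'' (IMod (V ''i'') (V ''B'')))
                   (CMul (OfInt (IMod (V ''V'') (V ''X'')))
                     (CMul (CVar ''S'') (Query (IMul (V ''s'') (V ''i'')))))))
          (Seq (CStore ''b'' (IMod (V ''i'') (V ''B''))
                 (CAdd (CArr ''b'' (IMod (V ''i'') (V ''B'')))
                   (CMul (OfInt (IMod (V ''V'') (V ''X'')))
                     (CMul (CVar ''S'') (Query (IMul (V ''s'') (IAdd (V ''i'') (N 1))))))))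
               (IAssign ''V'' (IDiv (V ''V'') (V ''X''))))))"

definition butterfly :: "name \<Rightarrow> com" where
  "butterfly a = CStore a (IAdd (IAdd (V ''o'') (V ''B'')) (V ''i''))
     (CAdd (CArr a (V ''h''))
       (CMul (Omega (IMul (IDiv (V ''n'') (IMul (N 2) (V ''p''))) (V ''j'')))
             (CArr a (IAdd (V ''h'') (V ''r'')))))"

text \<open>Every level of the transform is written to a fresh segment of length \<open>B\<close>, starting at \<open>o + B\<close>.\<close>

definition prog_fft :: com where
  "prog_fft =
    Seq (IAssign ''o'' (N 0)) (Seq (IAssign ''p'' (N 1)) (Seq (IAssign ''r'' (V ''B''))
      (While (ILt (V ''p'') (V ''B''))
        (Seq (IAssign ''r'' (IDiv (V ''r'') (N 2)))
        (Seq (For ''i'' (V ''B'')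
               (Seq (IAssign ''j'' (IDiv (V ''i'') (V ''r'')))
               (Seq (IAssign ''h'' (IAdd (IAdd (V ''o'') (IMul (IMod (V ''j'') (V ''p'')) (IMul (N 2) (V ''r''))))
                                         (IMod (V ''i'') (V ''r''))))
               (Seq (butterfly ''a'') (butterfly ''b'')))))
        (Seq (IAssign ''p'' (IMul (N 2) (V ''p'')))
             (IAssign ''o'' (IAdd (V ''o'') (V ''B'')))))))))"

text \<open>At most five neighbouring buckets can hear a frequency. For B < 5 the five offsets would
  wrap around and reach a bucket twice, hence the cap \<open>Q\<close>.\<close>

definition prog_subtract :: com where
  "prog_subtract =
    Seq (Cond (ILe (V ''B'') (N 5)) (IAssign ''Q'' (V ''B'')) (IAssign ''Q'' (N 5)))
        (For ''i'' (V ''c'')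
          (Seq (IAssign ''f'' (IArr ''F'' (V ''i'')))
          (Seq (IAssign ''g'' (IMul (V ''s'') (V ''f'')))
               (For ''l'' (V ''Q'')
                 (Seq (IAssign ''j'' (IMod (ISub (IAdd (IDiv (IMod (IAdd (V ''g'') (V ''H'')) (V ''n'')) (V ''W''))
                                                       (V ''l'')) (N 2)) (V ''B'')))
                 (Seq (IAssign ''h'' (ISub (IMul (V ''j'') (V ''W'')) (V ''g'')))
                 (Seq prog_kernel
                 (Seq (CStore ''a'' (IAdd (V ''o'') (V ''j''))
                        (CSub (CArr ''a'' (IAdd (V ''o'') (V ''j'')))
                              (CMul (OfInt (IArr ''z'' (V ''f''))) (CVar ''D''))))
                      (CStore ''b'' (IAdd (V ''o'') (V ''j''))
                        (CSub (CArr ''b'' (IAdd (V ''o'') (V ''j'')))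
                              (CMul (CMul (OfInt (IArr ''z'' (V ''f''))) (Omega (ISub (N 0) (V ''g''))))
                                    (CVar ''D'')))))))))))) "

text \<open>\<open>K\<close> is a membership test in unit time that keeps \<open>F\<close> free of
  repetitions. A frequency stays listed even if its value returns to 0, so the output has to skip
  zeros.\<close>

definition prog_record :: com where
  "prog_record =
    Seq (IStore ''z'' (V ''f'') (V ''v''))
        (Cond (BAnd (ILe (IArr ''K'' (V ''f'')) (N 0)) (ILe (N 0) (IArr ''K'' (V ''f''))))
          (Seq (IStore ''F'' (V ''c'') (V ''f''))
          (Seq (IStore ''K'' (V ''f'') (N 1))
               (IAssign ''c'' (IAdd (V ''c'') (N 1))))) Skip)"

definition prog_value :: com where
  "prog_value =
    Seq (IAssign ''f'' (IAdd (IMod (ISub (IMul (V ''y'') (V ''g'')) (N 1)) (V ''n'')) (N 1)))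
   (Seq (IAssign ''h'' (ISub (IMul (V ''j'') (V ''W'')) (V ''g'')))
   (Seq prog_kernel
   (Seq (CAssign ''w'' (CAdd (OfInt (IArr ''z'' (V ''f''))) (CDiv (CVar ''E'') (CVar ''D''))))
   (Seq prog_round prog_record))))"

text \<open>As T = 2^m and M = B^m, the first test is 2 |E| \<ge> (B/2)^m. The second, n |R -
  \<omega>^(-g)| \<le> 1, is meant to reject signals leaking in from a neighbouring bucket; a
  collision may still pass it. Both are comparisons of squares.\<close>

definition prog_bucket :: com where
  "prog_bucket =
    Seq (CAssign ''E'' (CArr ''a'' (IAdd (V ''o'') (V ''j''))))
   (Seq (CAssign ''w'' (CDiv (CMul (OfInt (IMul (N 2) (V ''T''))) (CVar ''E'')) (OfInt (V ''M''))))
        (Cond (ReLe (OfInt (N 1)) (norm2 ''w''))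
          (Seq (CAssign ''R'' (CDiv (CArr ''b'' (IAdd (V ''o'') (V ''j''))) (CVar ''E'')))
          (Seq (IAssign ''g'' (ISub (IMul (V ''j'') (V ''W'')) (V ''H'')))
          (Seq prog_phase
          (Seq (CAssign ''w'' (CSub (CVar ''R'') (Omega (ISub (N 0) (V ''g'')))))
               (Cond (ReLe (CMul (OfInt (IMul (V ''n'') (V ''n''))) (norm2 ''w'')) (OfInt (N 1)))
                 prog_value Skip)))))
          Skip))"

definition prog_pass :: com where
  "prog_pass =
    Seq prog_hash (Seq prog_sample (Seq prog_fft (Seq prog_subtract (Seq (For ''j'' (V ''B'') prog_bucket)
      (Seq (IAssign ''B'' (IDiv (V ''B'') (N 2))) (IAssign ''q'' (IAdd (V ''q'') (N 1))))))))"

definition prog_emit :: com where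
  "prog_emit =
    For ''i'' (V ''c'')
      (Cond (BAnd (ILe (IArr ''z'' (IArr ''F'' (V ''i''))) (N 0)) (ILe (N 0) (IArr ''z'' (IArr ''F'' (V ''i'')))))
        Skip (Emit (IArr ''F'' (V ''i'')) (OfInt (IArr ''z'' (IArr ''F'' (V ''i''))))))"

definition prog_sfft :: "int \<Rightarrow> com" where
  "prog_sfft a = Seq (prog_setup a)
     (Seq (While (BAnd (ILt (V ''q'') (V ''u'')) (ILe (N 1) (V ''B''))) (Seq (Rand ''d'' (V ''n'')) prog_pass))
          prog_emit)"

section \<open>Correctness and running time of the building blocks\<close>

lemma frameD:
  assumes "frame P s s'"
  shows "v \<notin> imod P \<Longrightarrow> ivar s' v = ivar s v"
    and "v \<notin> cmod P \<Longrightarrow> cvar s' v = cvar s v"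
    and "v \<notin> iamod P \<Longrightarrow> iarr s' v = iarr s v"
    and "v \<notin> camod P \<Longrightarrow> carr s' v = carr s v"
    and "\<not> emits P \<Longrightarrow> out s' = out s"
  using assms by (auto simp: frame_def)

lemma mod_prog_kernel [simp]:
  "imod prog_kernel = {''w''}" "cmod prog_kernel = {''D''}" "iamod prog_kernel = {}"
  "camod prog_kernel = {}" "\<not> emits prog_kernel"
  by (auto simp: prog_kernel_def)

lemma mod_prog_phase [simp]:
  "imod prog_phase = {''p'', ''g''}" "cmod prog_phase = {}" "iamod prog_phase = {}"
  "camod prog_phase = {}" "\<not> emits prog_phase"
  by (auto simp: prog_phase_def)

lemma mod_prog_round [simp]:
  "imod prog_round = {''p'', ''v''}" "cmod prog_round = {}" "iamod prog_round = {}"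
  "camod prog_round = {}" "\<not> emits prog_round"
  by (auto simp: prog_round_def)

lemma wp_kernel:
  assumes "n > 0" "ivar s ''n'' = int n" "ivar s ''B'' = int B" "ivar s ''u'' = int u"
  shows "wp n x prog_kernel (\<lambda>s' t. cvar s' ''D'' = dirichlet n B (ivar s ''h'') ^ (2 ^ u) \<and> t \<le> 40 * (u + 1)) s"
  unfolding prog_kernel_def
proof (rule wp_Seq, rule wp_conseq)
  show "wp n x (Cond (ILe (IMod (V ''h'') (V ''n'')) (N 0)) (CAssign ''D'' (OfInt (V ''B'')))
       (CAssign ''D'' (CDiv (CSub (OfInt (N 1)) (Omega (IMul (V ''B'') (V ''h''))))
         (CSub (OfInt (N 1)) (Omega (V ''h'')))))) (\<lambda>s' t. cvar s' ''D'' = dirichlet n B (ivar s ''h'') \<and> t \<le> 20) s"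
  proof -
    have "0 \<le> ivar s ''h'' mod int n" using assms by simp
    then have "ivar s ''h'' mod int n \<le> 0 \<longleftrightarrow> ivar s ''h'' mod int n = 0" by linarith
    then show ?thesis using assms by (intro wp_Cond wp_CAssign) (auto simp: dirichlet_eq)
  qed
next
  fix s1 :: state and t1 :: nat
  assume f1: "frame (Cond (ILe (IMod (V ''h'') (V ''n'')) (N 0)) (CAssign ''D'' (OfInt (V ''B'')))
       (CAssign ''D'' (CDiv (CSub (OfInt (N 1)) (Omega (IMul (V ''B'') (V ''h''))))
         (CSub (OfInt (N 1)) (Omega (V ''h'')))))) s s1"
    and s1: "cvar s1 ''D'' = dirichlet n B (ivar s ''h'') \<and> t1 \<le> 20"
  have u: "ivar s1 ''u'' = int u" using frameD[OF f1] assms by simp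
  show "wp n x (For ''w'' (V ''u'') (CAssign ''D'' (CMul (CVar ''D'') (CVar ''D''))))
     (\<lambda>s' t. cvar s' ''D'' = dirichlet n B (ivar s ''h'') ^ (2 ^ u) \<and> (t1 + t :: nat) \<le> 40 * (u + 1)) s1"
  proof (rule wp_conseq, rule wp_For[where M = u and T = 4 and
        J = "\<lambda>i s'. cvar s' ''D'' = dirichlet n B (ivar s ''h'') ^ (2 ^ i)"])
    fix i s' assume "frame (For ''w'' (V ''u'') (CAssign ''D'' (CMul (CVar ''D'') (CVar ''D'')))) s1 s'"
    then show "ival (V ''u'') s' = int u" using u by (simp add: frameD)
  next
    fix i and s' :: state assume "cvar s' ''D'' = dirichlet n B (ivar s ''h'') ^ (2 ^ i)"
    then show "wp n x (CAssign ''D'' (CMul (CVar ''D'') (CVar ''D'')))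
        (\<lambda>s'' t. cvar (s''\<lparr>ivar := (ivar s'')(''w'' := int (Suc i))\<rparr>) ''D'' = dirichlet n B (ivar s ''h'') ^ (2 ^ Suc i) \<and> t \<le> 4) s'"
      by (intro wp_CAssign) (simp flip: power_add mult_2)
  qed (use s1 in auto)
qed

text \<open>That the result stays in the bucket is unconditional, so a collision cannot do damage
  elsewhere. Finding \<open>g0\<close> needs tests within a quarter turn, which 8 * 2^w \<le> n
  guarantees; for w = 0 there is nothing to search.\<close>

lemma wp_phase:
  assumes n: "n > 0" and W: "ivar s ''W'' = 2 ^ w"
  shows "wp n x prog_phase (\<lambda>s' t.
      ivar s ''g'' \<le> ivar s' ''g'' \<and> ivar s' ''g'' < ivar s ''g'' + 2 ^ w \<and>
      (\<forall>g0. 2 * real n * norm (cvar s ''R'' - omega n powi (- g0)) \<le> 1 \<longrightarrow>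
         ivar s ''g'' \<le> g0 \<longrightarrow> g0 < ivar s ''g'' + 2 ^ w \<longrightarrow> (w = 0 \<or> 8 * 2 ^ w \<le> int n) \<longrightarrow> ivar s' ''g'' = g0) \<and>
      t \<le> 40 * (w + 1)) s"
proof -
  let ?g = "ivar s ''g''"
  define ok where "ok g0 \<longleftrightarrow> 2 * real n * norm (cvar s ''R'' - omega n powi (- g0)) \<le> 1 \<and> ?g \<le> g0 \<and>
      g0 < ?g + 2 ^ w \<and> (w = 0 \<or> 8 * 2 ^ w \<le> int n)" for g0
  define J where "J i s' \<longleftrightarrow> ivar s' ''p'' = 2 ^ (w - i) \<and> ?g \<le> ivar s' ''g'' \<and>
     ivar s' ''g'' + 2 ^ (w - i) \<le> ?g + 2 ^ w \<and>
     (\<forall>g0. ok g0 \<longrightarrow> ivar s' ''g'' \<le> g0 \<and> g0 < ivar s' ''g'' + 2 ^ (w - i))" for i and s' :: state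
  show ?thesis
    unfolding prog_phase_def
  proof (intro wp_Seq wp_IAssign, rule wp_conseq, rule wp_While[where J = J and M = w and T = 27])
    show "J 0 (s\<lparr>ivar := (ivar s)(''p'' := ival (V ''W'') s)\<rparr>)"
      using W by (auto simp: J_def ok_def)
  next
    fix i s'
    assume i: "i < w" and J: "J i s'"
      and f: "frame (Seq (IAssign ''p'' (IDiv (V ''p'') (N 2)))
        (Cond (ReLe (OfInt (N 0)) (CIm (CMul (CVar ''R'')
                 (CAdd (Omega (ISub (IAdd (V ''g'') (V ''p'')) (N 1)))
                       (Omega (IAdd (V ''g'') (V ''p'')))))))
          (IAssign ''g'' (IAdd (V ''g'') (V ''p''))) Skip)) (s\<lparr>ivar := (ivar s)(''p'' := ival (V ''W'') s)\<rparr>) s'"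
    obtain l where l: "w - i = Suc l" using i by (metis Suc_diff_Suc)
    define E where "E = (2::int) ^ l"
    have pw: "(2::int) ^ (w - i) = 2 * E" "(2::int) ^ (w - Suc i) = E" "E > 0"
      using l by (simp_all add: E_def)
    have R: "cvar s' ''R'' = cvar s ''R''" using frameD[OF f] by simp
    have sgn0: "0 \<le> Im (cvar s ''R'' * (omega n powi (ivar s' ''g'' + E - 1) + omega n powi (ivar s' ''g'' + E)))
        \<longleftrightarrow> ivar s' ''g'' + E \<le> g0" if ok: "ok g0" for g0
    proof (rule phase_sign[OF n])
      show "2 * real n * norm (cvar s ''R'' - omega n powi (- g0)) \<le> 1" using ok by (simp add: ok_def)
      have "2 * E \<le> 2 ^ w" unfolding pw(1)[symmetric] by (intro power_increasing) auto
      moreover note pw(3)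
      moreover have "8 * 2 ^ w \<le> int n" using ok i by (auto simp: ok_def)
      moreover have "ivar s' ''g'' \<le> g0" "g0 < ivar s' ''g'' + 2 * E" using J ok pw by (auto simp: J_def)
      ultimately show "4 * (\<bar>ivar s' ''g'' + E - g0\<bar> + 1) \<le> int n" by (auto simp: abs_if)
    qed
    then have sgn: "\<forall>a. ok a \<longrightarrow> (0 \<le> Im (cvar s ''R'' * (omega n powi (ivar s' ''g'' + E - 1) + omega n powi (ivar s' ''g'' + E)))
        \<longleftrightarrow> ivar s' ''g'' + E \<le> a)" by blast
    show "bval n x (ILt (N 1) (V ''p'')) s' \<and>
       wp n x (Seq (IAssign ''p'' (IDiv (V ''p'') (N 2)))
        (Cond (ReLe (OfInt (N 0)) (CIm (CMul (CVar ''R'')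
                 (CAdd (Omega (ISub (IAdd (V ''g'') (V ''p'')) (N 1)))
                       (Omega (IAdd (V ''g'') (V ''p'')))))))
          (IAssign ''g'' (IAdd (V ''g'') (V ''p''))) Skip)) (\<lambda>s'' t. J (Suc i) s'' \<and> t \<le> 27) s'"
      using J R sgn pw(3)
      by (intro conjI wp_Seq wp_IAssign wp_Cond wp_Skip) (auto simp: J_def pw(1,2))
  next
    fix s' assume "J w s'"
    then show "\<not> bval n x (ILt (N 1) (V ''p'')) s'" by (simp add: J_def)
  next
    fix s' t
    assume "J w s' \<and> t \<le> w * (27 + 1 + bcost (ILt (N 1) (V ''p''))) + (1 + bcost (ILt (N 1) (V ''p'')))"
    then show "?g \<le> ivar s' ''g'' \<and> ivar s' ''g'' < ?g + 2 ^ w \<and>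
      (\<forall>g0. 2 * real n * norm (cvar s ''R'' - omega n powi (- g0)) \<le> 1 \<longrightarrow>
         ?g \<le> g0 \<longrightarrow> g0 < ?g + 2 ^ w \<longrightarrow> (w = 0 \<or> 8 * 2 ^ w \<le> int n) \<longrightarrow> ivar s' ''g'' = g0) \<and>
      1 + icost (V ''W'') + t \<le> 40 * (w + 1)"
      by (force simp: J_def ok_def)
  qed
qed

text \<open>The range holds even if \<open>w\<close> is meaningless. It keeps wrong estimates below
  4 L in modulus, which the noise bound of later passes relies on.\<close>

lemma wp_round:
  assumes P: "ivar s ''P'' = 2 ^ p" and L: "ivar s ''L'' = int L" "2 * int L + 1 \<le> 2 ^ p"
  shows "wp n x prog_round (\<lambda>s' t.
      - int L \<le> ivar s' ''v'' \<and> ivar s' ''v'' < - int L + 2 ^ p \<and>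
      (\<forall>a. \<bar>a\<bar> \<le> int L \<longrightarrow> \<bar>Re (cvar s ''w'') - of_int a\<bar> < 1 / 2 \<longrightarrow> ivar s' ''v'' = a) \<and>
      t \<le> 40 * (p + 1)) s"
proof -
  define ok where "ok a \<longleftrightarrow> \<bar>a\<bar> \<le> int L \<and> \<bar>Re (cvar s ''w'') - of_int a\<bar> < 1 / 2" for a
  define J where "J i s' \<longleftrightarrow> ivar s' ''p'' = 2 ^ (p - i) \<and> - int L \<le> ivar s' ''v'' \<and>
     ivar s' ''v'' + 2 ^ (p - i) \<le> - int L + 2 ^ p \<and>
     (\<forall>a. ok a \<longrightarrow> ivar s' ''v'' \<le> a \<and> a < ivar s' ''v'' + 2 ^ (p - i))" for i and s' :: state
  let ?s1 = "s\<lparr>ivar := (ivar s)(''v'' := ival (ISub (N 0) (V ''L'')) s)\<rparr>"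
  let ?s0 = "?s1\<lparr>ivar := (ivar ?s1)(''p'' := ival (V ''P'') ?s1)\<rparr>"
  show ?thesis
    unfolding prog_round_def
  proof (intro wp_Seq wp_IAssign, rule wp_conseq, rule wp_While[where J = J and M = p and T = 27])
    show "J 0 ?s0"
      using P L by (auto simp: J_def ok_def)
  next
    fix i s'
    assume i: "i < p" and J: "J i s'"
      and f: "frame (Seq (IAssign ''p'' (IDiv (V ''p'') (N 2)))
        (Cond (ReLe (OfInt (ISub (IMul (N 2) (IAdd (V ''v'') (V ''p''))) (N 1)))
                    (CMul (OfInt (N 2)) (CVar ''w'')))
          (IAssign ''v'' (IAdd (V ''v'') (V ''p''))) Skip)) ?s0 s'"
    obtain l where l: "p - i = Suc l" using i by (metis Suc_diff_Suc)
    define E where "E = (2::int) ^ l"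
    have pw: "(2::int) ^ (p - i) = 2 * E" "(2::int) ^ (p - Suc i) = E" "E > 0"
      using l by (simp_all add: E_def)
    have R: "cvar s' ''w'' = cvar s ''w''" using frameD[OF f] by simp
    have sgn0: "2 * (of_int (ivar s' ''v'') + of_int E) - 1 \<le> 2 * Re (cvar s ''w'')
        \<longleftrightarrow> ivar s' ''v'' + E \<le> a" if ok: "ok a" for a
    proof
      assume "2 * (of_int (ivar s' ''v'') + of_int E) - 1 \<le> 2 * Re (cvar s ''w'')"
      then have "of_int (ivar s' ''v'' + E) < real_of_int (a + 1)" using ok by (auto simp: ok_def abs_if split: if_splits)
      then show "ivar s' ''v'' + E \<le> a" using of_int_less_iff[of "ivar s' ''v'' + E" "a + 1"] by linarith
    next
      assume "ivar s' ''v'' + E \<le> a"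
      then have "of_int (ivar s' ''v'' + E) \<le> real_of_int a" by (rule of_int_le_iff[THEN iffD2])
      then show "2 * (of_int (ivar s' ''v'') + of_int E) - 1 \<le> 2 * Re (cvar s ''w'')"
        using ok by (auto simp: ok_def abs_if split: if_splits)
    qed
    then have sgn: "\<forall>a. ok a \<longrightarrow> (2 * (of_int (ivar s' ''v'') + of_int E) - 1 \<le> 2 * Re (cvar s ''w'')
        \<longleftrightarrow> ivar s' ''v'' + E \<le> a)" by blast
    show "bval n x (ILt (N 1) (V ''p'')) s' \<and>
       wp n x (Seq (IAssign ''p'' (IDiv (V ''p'') (N 2)))
        (Cond (ReLe (OfInt (ISub (IMul (N 2) (IAdd (V ''v'') (V ''p''))) (N 1)))
                    (CMul (OfInt (N 2)) (CVar ''w'')))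
          (IAssign ''v'' (IAdd (V ''v'') (V ''p''))) Skip)) (\<lambda>s'' t. J (Suc i) s'' \<and> t \<le> 27) s'"
      using J R sgn pw(3)
      by (intro conjI wp_Seq wp_IAssign wp_Cond wp_Skip) (auto simp: J_def pw(1,2))
  next
    fix s' assume "J p s'"
    then show "\<not> bval n x (ILt (N 1) (V ''p'')) s'" by (simp add: J_def)
  next
    fix s' t
    assume "J p s' \<and> t \<le> p * (27 + 1 + bcost (ILt (N 1) (V ''p''))) + (1 + bcost (ILt (N 1) (V ''p'')))"
    then show "- int L \<le> ivar s' ''v'' \<and> ivar s' ''v'' < - int L + 2 ^ p \<and>
      (\<forall>a. \<bar>a\<bar> \<le> int L \<longrightarrow> \<bar>Re (cvar s ''w'') - of_int a\<bar> < 1 / 2 \<longrightarrow> ivar s' ''v'' = a) \<and>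
      1 + icost (ISub (N 0) (V ''L'')) + (1 + icost (V ''P'') + t) \<le> 40 * (p + 1)"
      by (force simp: J_def ok_def)
  qed
qed

lemma wp_Seq2:
  assumes "wp n x p R s"
    and "\<And>s1 t1. frame p s s1 \<Longrightarrow> R s1 t1 \<Longrightarrow> wp n x q (\<lambda>s2 t2. Q s2 (t1 + t2)) s1"
  shows "wp n x (Seq p q) Q s"
  by (rule wp_Seq) (rule wp_conseq[OF assms(1)], rule assms(2))

text \<open>Reduces a loop around a single assignment to an iterate of a function, which the
  \<open>funpow\<close> lemmas below evaluate.\<close>

lemma wp_For_assign:
  assumes "v \<noteq> y"
    and "\<And>s'. frame (For v e (IAssign y r)) s s' \<Longrightarrow> ival e s' = int M"
    and "\<And>s'. frame (For v e (IAssign y r)) s s' \<Longrightarrow> ival r s' = g (ivar s' y)"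
  shows "wp n x (For v e (IAssign y r)) (\<lambda>s' t. ivar s' y = (g ^^ M) (ivar s y) \<and>
           t \<le> M * (10 + icost r + icost e) + (7 + icost e)) s"
proof (rule wp_conseq, rule wp_For[where M = M and T = "1 + icost r" and J = "\<lambda>i s'. ivar s' y = (g ^^ i) (ivar s y)"])
  fix i and s' :: state
  assume "ivar s' y = (g ^^ i) (ivar s y)" "frame (For v e (IAssign y r)) s s'"
  then show "wp n x (IAssign y r) (\<lambda>s'' t. ivar (s''\<lparr>ivar := (ivar s'')(v := int (Suc i))\<rparr>) y = (g ^^ Suc i) (ivar s y) \<and> t \<le> 1 + icost r) s'"
    using assms by (intro wp_IAssign) auto
qed (use assms in \<open>auto simp: algebra_simps\<close>)

text \<open>Partial sums of the geometric series of 1 / (1 - (1 - s)). For odd s the remainder (1 -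
  s)^k is divisible by 2^k, so e steps produce the inverse of s modulo 2^e without the Euclidean
  algorithm.\<close>

lemma funpow_affine: "s * ((\<lambda>y. 1 + (1 - s) * y) ^^ k) 0 = 1 - (1 - s) ^ k" for s :: int
proof (induction k)
  case (Suc k)
  let ?Y = "((\<lambda>y. 1 + (1 - s) * y) ^^ k) 0"
  have "s * (1 + (1 - s) * ?Y) = s + (1 - s) * (s * ?Y)" by (simp add: algebra_simps)
  also have "\<dots> = 1 - (1 - s) ^ Suc k" unfolding Suc by (simp add: algebra_simps)
  finally show ?case by simp
qed simp

lemma funpow_mult: "((\<lambda>y. y * b) ^^ k) a = a * b ^ k" for a b :: int
  by (induction k) (simp_all add: algebra_simps)

lemma funpow_mult': "((\<lambda>y. b * y) ^^ k) a = a * b ^ k" for a b :: int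
  by (induction k) (simp_all add: algebra_simps)

lemma funpow_horner: "((\<lambda>y. 1 + X * y) ^^ k) 0 = (\<Sum>a<k. X ^ a)" for X :: int
proof (induction k)
  case (Suc k)
  have "(\<Sum>a<Suc k. X ^ a) = 1 + X * (\<Sum>a<k. X ^ a)"
    by (subst sum.lessThan_Suc_shift) (simp add: sum_distrib_left)
  with Suc show ?case by simp
qed simp

lemma mod_prog_hash [simp]:
  "imod prog_hash = {''s'', ''y'', ''i'', ''M'', ''X'', ''G'', ''V'', ''W'', ''H''}" "cmod prog_hash = {}"
  "iamod prog_hash = {}" "camod prog_hash = {}" "\<not> emits prog_hash"
  by (auto simp: prog_hash_def)

lemma wp_hash:
  assumes s: "ivar s ''n'' = int n" "n = 2 ^ e" "ivar s ''e'' = int e" "ivar s ''m'' = int m"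
    "ivar s ''B'' = int B" "ivar s ''d'' = int d"
  shows "wp n x prog_hash (\<lambda>s' t. ivar s' ''s'' = 2 * int d + 1 \<and> [ivar s' ''s'' * ivar s' ''y'' = 1] (mod int n) \<and>
      ivar s' ''M'' = int B ^ m \<and> ivar s' ''X'' = int B ^ m + 1 \<and>
      ivar s' ''V'' = (\<Sum>a<B. (int B ^ m + 1) ^ a) ^ m \<and>
      ivar s' ''W'' = int (n div B) \<and> ivar s' ''H'' = int (n div B div 2) \<and> t \<le> 100 * (e + m + B + 1)) s"
  unfolding prog_hash_def
  apply (intro wp_Seq wp_IAssign)
  apply (rule wp_conseq[OF wp_For_assign[where M = e and g = "\<lambda>y. 1 + (1 - (2 * int d + 1)) * y"]])
     apply simp
    apply (simp add: s frameD)
   apply (simp add: s frameD)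
  apply (intro wp_Seq wp_IAssign)
  apply (rule wp_conseq[OF wp_For_assign[where M = m and g = "\<lambda>y. y * int B"]])
     apply simp
    apply (simp add: s frameD)
   apply (simp add: s frameD)
  apply (intro wp_Seq wp_IAssign)
  apply (rule wp_conseq[OF wp_For_assign[where M = B and g = "\<lambda>y. 1 + (int B ^ m + 1) * y"]])
     apply simp
    apply (simp add: s frameD)
   apply (simp add: s frameD funpow_mult)
  apply (intro wp_Seq wp_IAssign)
  apply (rule wp_conseq[OF wp_For_assign[where M = m and g = "\<lambda>y. y * (\<Sum>a<B. (int B ^ m + 1) ^ a)"]])
     apply simp
    apply (simp add: s frameD)
   apply (simp add: s frameD funpow_horner)
  apply (intro wp_Seq wp_IAssign)
  apply (simp add: s frameD funpow_mult zdiv_int)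
  apply (subgoal_tac "[(2 * int d + 1) * ((\<lambda>y. 1 + (1 - (2 * int d + 1)) * y) ^^ e) 0 = 1] (mod 2 ^ e)")
   apply (simp add: s(2))
  apply (subst funpow_affine)
  apply (simp add: cong_iff_dvd_diff)
  apply (rule dvd_power_same)
  apply simp
  done

section \<open>Sampling and the fast Fourier transform\<close>

lemma mod_prog_sample [simp]:
  "imod prog_sample = {''i'', ''V''}" "cmod prog_sample = {}"
  "iamod prog_sample = {}" "camod prog_sample = {''a'', ''b''}" "\<not> emits prog_sample"
  by (auto simp: prog_sample_def)

lemma sum_residue_Suc:
  fixes f :: "nat \<Rightarrow> complex"
  shows "(\<Sum>t | t < Suc i \<and> t mod B = r. f t) = (\<Sum>t | t < i \<and> t mod B = r. f t) + (if i mod B = r then f i else 0)"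
proof -
  have "{t. t < Suc i \<and> t mod B = r} = (if i mod B = r then insert i {t. t < i \<and> t mod B = r} else {t. t < i \<and> t mod B = r})"
    by (auto simp: less_Suc_eq)
  then show ?thesis by (simp add: add.commute)
qed

lemma wp_sample:
  fixes c :: "nat \<Rightarrow> nat"
  assumes s: "ivar s ''m'' = int m" "ivar s ''B'' = int B" "ivar s ''X'' = int B ^ m + 1"
    "ivar s ''V'' = (\<Sum>t<m * B. int (c t) * (int B ^ m + 1) ^ t)"
    and B: "B > 0" and c: "\<And>t. t < m * B \<Longrightarrow> int (c t) \<le> int B ^ m"
  shows "wp n x prog_sample (\<lambda>s' t.
     (\<forall>r<B. carr s' ''a'' (int r) = (\<Sum>t | t < m * B \<and> t mod B = r. of_nat (c t) * (cvar s ''S'' * x (idx n (ivar s ''s'' * int t))))) \<and>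
     (\<forall>r<B. carr s' ''b'' (int r) = (\<Sum>t | t < m * B \<and> t mod B = r. of_nat (c t) * (cvar s ''S'' * x (idx n (ivar s ''s'' * (int t + 1)))))) \<and>
     t \<le> 100 * (m * B + B + 1)) s"
proof -
  define X where "X = int B ^ m + 1"
  define fa where "fa t = of_nat (c t) * (cvar s ''S'' * x (idx n (ivar s ''s'' * int t)))" for t
  define fb where "fb t = of_nat (c t) * (cvar s ''S'' * x (idx n (ivar s ''s'' * (int t + 1))))" for t
  let ?p1 = "For ''i'' (V ''B'') (Seq (CStore ''a'' (V ''i'') (OfInt (N 0))) (CStore ''b'' (V ''i'') (OfInt (N 0))))"
  have 1: "wp n x ?p1 (\<lambda>s' t. (\<forall>r<B. carr s' ''a'' (int r) = 0 \<and> carr s' ''b'' (int r) = 0) \<and>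
      ivar s' ''i'' = int B \<and> t \<le> B * (8 + 9 + icost (V ''B'')) + (7 + icost (V ''B''))) s"
  proof (rule wp_For)
    fix i and s' :: state
    assume "\<forall>r<i. carr s' ''a'' (int r) = 0 \<and> carr s' ''b'' (int r) = 0" "ivar s' ''i'' = int i"
    then show "wp n x (Seq (CStore ''a'' (V ''i'') (OfInt (N 0))) (CStore ''b'' (V ''i'') (OfInt (N 0))))
      (\<lambda>s'' t. (\<forall>r<Suc i. carr (s''\<lparr>ivar := (ivar s'')(''i'' := int (Suc i))\<rparr>) ''a'' (int r) = 0 \<and>
         carr (s''\<lparr>ivar := (ivar s'')(''i'' := int (Suc i))\<rparr>) ''b'' (int r) = 0) \<and> t \<le> 8) s'"
      by (intro wp_Seq wp_CStore) (auto simp: less_Suc_eq)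
  qed (use s in \<open>auto simp: frameD\<close>)
  show ?thesis
    unfolding prog_sample_def
  proof (rule wp_Seq2[OF 1], goal_cases)
    case (1 s1 t1)
    note f1 = frameD[OF 1(1)] and R1 = 1(2)
    \<comment> \<open>After i samples \<open>V\<close> has lost its i lowest digits, so the
      coefficient i is its remainder modulo X.\<close>
    define J where "J i s' \<longleftrightarrow> ivar s' ''V'' = (\<Sum>t\<in>{i..<m * B}. int (c t) * X ^ (t - i)) \<and>
      (\<forall>r<B. carr s' ''a'' (int r) = (\<Sum>t | t < i \<and> t mod B = r. fa t)) \<and>
      (\<forall>r<B. carr s' ''b'' (int r) = (\<Sum>t | t < i \<and> t mod B = r. fb t))" for i and s' :: state
    show ?case
    proof (rule wp_conseq, rule wp_For[where M = "m * B" and T = 50 and J = J], goal_cases)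
      case 1
      show ?case using R1 f1 s by (simp add: J_def lessThan_atLeast0 X_def)
    next
      case (2 i s')
      then show ?case using f1 s by (simp add: frameD)
    next
      case (3 i s')
      note f3 = frameD[OF 3(4)]
      have v: "ivar s' ''B'' = int B" "ivar s' ''X'' = X" "ivar s' ''s'' = ivar s ''s''" "cvar s' ''S'' = cvar s ''S''"
        using f1 f3 s by (simp_all add: X_def)
      have Vm: "ivar s' ''V'' mod X = int (c i)" "ivar s' ''V'' div X = (\<Sum>t\<in>{Suc i..<m * B}. int (c t) * X ^ (t - Suc i))"
        using 3(1,2) c[of i] base_digits[of i "m * B" "\<lambda>t. int (c t)" X] by (auto simp: J_def X_def)
      have Jab: "\<forall>r<B. carr s' ''a'' (int r) = (\<Sum>t | t < i \<and> t mod B = r. fa t)"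
        "\<forall>r<B. carr s' ''b'' (int r) = (\<Sum>t | t < i \<and> t mod B = r. fb t)"
        using 3(2) by (simp_all add: J_def)
      have mm: "int i mod int B = int (i mod B)" by (simp add: zmod_int)
      have S: "(\<Sum>t | t < Suc i \<and> t mod B = r. fa t) = (\<Sum>t | t < i \<and> t mod B = r. fa t) + (if i mod B = r then fa i else 0)"
        "(\<Sum>t | t < Suc i \<and> t mod B = r. fb t) = (\<Sum>t | t < i \<and> t mod B = r. fb t) + (if i mod B = r then fb i else 0)" for r
        by (rule sum_residue_Suc)+
      show ?case
        using Jab 3(3) B
        by (intro wp_Seq wp_CStore wp_IAssign)
          (auto simp: J_def v Vm mm S fa_def[of i, symmetric] fb_def[of i, symmetric])
    next
      case 4
      then show ?case by simp
    next
      case (5 s' t)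
      have "t1 + t \<le> 100 * (m * B + B + 1)" using 5(2) R1 by simp
      then show ?case using 5(2) by (simp add: J_def fa_def fb_def)
    qed
  qed
qed

text \<open>A position i of level l encodes a residue class i mod 2^(b-l) of the input and a
  frequency i div 2^(b-l). Its entry is the transform of length 2^l of that class at that frequency.
  Level 0 is the input and level b the full transform in natural order, so no bit reversal
  occurs.\<close>

definition fft_level :: "nat \<Rightarrow> nat \<Rightarrow> (nat \<Rightarrow> complex) \<Rightarrow> nat \<Rightarrow> nat \<Rightarrow> complex" where
  "fft_level n b v l i = (\<Sum>r<2 ^ l. omega n powi (int (n div 2 ^ l) * (int r * int (i div 2 ^ (b - l)))) *
      v (i mod 2 ^ (b - l) + 2 ^ (b - l) * r))"

lemma sum_even_odd: "(\<Sum>r<2 * k. g r) = (\<Sum>r<k. g (2 * r)) + (\<Sum>r<k. g (Suc (2 * r)))"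
  for g :: "nat \<Rightarrow> 'a::comm_monoid_add"
  by (induction k) (simp_all add: add_ac)

text \<open>Splitting by the parity of r divides a class modulo q into two classes modulo 2 q, which
  level l stores at \<open>h\<close> and \<open>h + q\<close>. There the frequency matters only
  modulo 2^l, since \<omega>^(n / 2^l) has order 2^l.\<close>

lemma fft_level_Suc:
  fixes i :: nat
  assumes n: "n = 2 ^ e" "b \<le> e" and l: "l < b"
  defines "q \<equiv> 2 ^ (b - Suc l)"
  defines "j \<equiv> i div q"
  defines "h \<equiv> (j mod 2 ^ l) * (2 * q) + i mod q"
  shows "fft_level n b v (Suc l) i =
    fft_level n b v l h + omega n powi (int (n div (2 * 2 ^ l)) * int j) * fft_level n b v l (h + q)"
proof -
  have n0: "n > 0" using n by simp
  have q: "2 ^ (b - l) = 2 * q" using l unfolding q_def by (metis Suc_diff_Suc power_Suc)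
  have q0: "q > 0" by (simp add: q_def)
  then have "i mod q < q" by simp
  then have lq: "i mod q < 2 * q" "i mod q + q < 2 * q" by linarith+
  have h: "h div (2 * q) = j mod 2 ^ l" "h mod (2 * q) = i mod q"
    "(h + q) div (2 * q) = j mod 2 ^ l" "(h + q) mod (2 * q) = i mod q + q"
    using q0 lq unfolding h_def by (simp_all add: add.assoc)
  define N' where "N' = n div 2 ^ Suc l"
  have "l < e" using n l by simp
  then have nN: "n = 2 ^ Suc l * N'" unfolding N'_def n(1)
    by (metis Suc_leI dvd_mult_div_cancel le_imp_power_dvd)
  then have N: "n div 2 ^ l = 2 * N'" by simp
  have ph: "omega n powi (int (2 * N') * (int r * int (j mod 2 ^ l))) = omega n powi (int N' * (int (2 * r) * int j))" for r
  proof (rule omega_powi_cong[OF n0])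
    have "[int (j mod 2 ^ l) = int j] (mod 2 ^ l)" by (simp add: cong_def zmod_int)
    then have "int (2 ^ l) dvd int (j mod 2 ^ l) - int j" by (simp add: cong_iff_dvd_diff)
    then have "int (2 * N') * int (2 ^ l) dvd int (2 * N') * (int r * (int (j mod 2 ^ l) - int j))"
      by (intro mult_dvd_mono) auto
    then have "int n dvd int (2 * N') * (int r * (int (j mod 2 ^ l) - int j))"
      using nN by (simp add: mult_ac)
    then show "[int (2 * N') * (int r * int (j mod 2 ^ l)) = int N' * (int (2 * r) * int j)] (mod int n)"
      by (simp add: cong_iff_dvd_diff algebra_simps)
  qed
  let ?g = "\<lambda>r. omega n powi (int N' * (int r * int j)) * v (i mod q + q * r)"
  have "fft_level n b v (Suc l) i = (\<Sum>r<2 * 2 ^ l. ?g r)"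
    by (simp add: fft_level_def N'_def q_def j_def)
  also have "\<dots> = (\<Sum>r<2 ^ l. ?g (2 * r)) + (\<Sum>r<2 ^ l. ?g (Suc (2 * r)))" by (rule sum_even_odd)
  also have "(\<Sum>r<2 ^ l. ?g (2 * r)) = fft_level n b v l h"
    unfolding fft_level_def q h N by (intro sum.cong refl) (simp only: ph, simp add: mult_ac)
  also have "(\<Sum>r<2 ^ l. ?g (Suc (2 * r))) = omega n powi (int (n div (2 * 2 ^ l)) * int j) * fft_level n b v l (h + q)"
    unfolding fft_level_def q h N sum_distrib_left
  proof (intro sum.cong refl)
    fix r
    have "omega n powi (int N' * (int (Suc (2 * r)) * int j)) =
       omega n powi (int N' * int j) * omega n powi (int N' * (int (2 * r) * int j))"
      by (simp add: algebra_simps flip: omega_powi_add)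
    also have "\<dots> = omega n powi (int (n div (2 * 2 ^ l)) * int j) * omega n powi (int (2 * N') * (int r * int (j mod 2 ^ l)))"
      by (simp only: ph) (simp add: N'_def)
    finally show "?g (Suc (2 * r)) = omega n powi (int (n div (2 * 2 ^ l)) * int j) *
        (omega n powi (int (2 * N') * (int r * int (j mod 2 ^ l))) * v (i mod q + q + 2 * q * r))"
      by (simp add: algebra_simps)
  qed
  finally show ?thesis .
qed

lemma mod_butterfly [simp]:
  "imod (butterfly a) = {}" "cmod (butterfly a) = {}"
  "iamod (butterfly a) = {}" "camod (butterfly a) = {a}" "\<not> emits (butterfly a)"
  by (auto simp: butterfly_def)

lemma mod_prog_fft [simp]:
  "imod prog_fft = {''o'', ''p'', ''r'', ''i'', ''j'', ''h''}" "cmod prog_fft = {}"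
  "iamod prog_fft = {}" "camod prog_fft = {''a'', ''b''}" "\<not> emits prog_fft"
  by (auto simp: prog_fft_def butterfly_def)

lemma wp_fft:
  assumes s: "ivar s ''n'' = int n" "n = 2 ^ e" "b \<le> e" "ivar s ''B'' = 2 ^ b"
  shows "wp n x prog_fft (\<lambda>s' t.
     (\<forall>a\<in>{''a'', ''b''}. \<forall>i<2 ^ b. carr s' a (ivar s' ''o'' + int i) =
        (\<Sum>r<2 ^ b. omega n powi (int (n div 2 ^ b) * (int r * int i)) * carr s a (int r))) \<and>
     t \<le> 100 * ((b + 1) * (2 ^ b + 1))) s"
proof -
  let ?v = "\<lambda>a r. carr s a (int r)"
  define J where "J l s' \<longleftrightarrow> ivar s' ''p'' = 2 ^ l \<and> ivar s' ''r'' = 2 ^ (b - l) \<and> ivar s' ''o'' = int l * 2 ^ b \<and>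
     (\<forall>a\<in>{''a'', ''b''}. \<forall>i<2 ^ b. carr s' a (int l * 2 ^ b + int i) = fft_level n b (?v a) l i)"
    for l and s' :: state
  show ?thesis
    unfolding prog_fft_def
  proof (intro wp_Seq wp_IAssign, rule wp_conseq, rule wp_While[where J = J and M = b and T = "72 * 2 ^ b + 30"], goal_cases)
    case 1
    show ?case using s by (auto simp: J_def fft_level_def)
  next
    case (2 l s')
    note l = 2(1) and J = 2(2)[unfolded J_def] and f = frameD[OF 2(3)]
    define q where "q = (2::nat) ^ (b - Suc l)"
    have q: "(2::int) ^ (b - l) = 2 * int q" using l unfolding q_def by (simp add: Suc_diff_Suc flip: power_Suc)
    have v: "ivar s' ''n'' = int n" "ivar s' ''B'' = int (2 ^ b)" using f s by simp_all
    have "(2::int) ^ l < 2 ^ b" using l by (intro power_strict_increasing) auto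
    then have lt: "(2::int) ^ l + 1 \<le> 2 ^ b" by linarith
    let ?j = "\<lambda>i. i div q" and ?h = "\<lambda>i. (i div q mod 2 ^ l) * (2 * q) + i mod q"
    have hb: "?h i + q < 2 ^ b" if "i < 2 ^ b" for i
    proof -
      have q0: "q > 0" by (simp add: q_def)
      have "?j i mod 2 ^ l + 1 \<le> 2 ^ l" by (simp add: Suc_leI)
      then have "(?j i mod 2 ^ l + 1) * (2 * q) \<le> 2 ^ l * (2 * q)" by (rule mult_le_mono1)
      also have "\<dots> = 2 ^ (l + 1 + (b - Suc l))" by (simp only: q_def power_add) simp
      also have "l + 1 + (b - Suc l) = b" using l by simp
      finally show ?thesis using mod_less_divisor[OF q0, of i] by simp
    qed
    let ?o = "int l * 2 ^ b"
    define K where "K i s'' \<longleftrightarrow> (\<forall>a\<in>{''a'', ''b''}. (\<forall>i'<2 ^ b. carr s'' a (?o + int i') = fft_level n b (?v a) l i') \<and>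
        (\<forall>i'<i. carr s'' a (?o + 2 ^ b + int i') = fft_level n b (?v a) (Suc l) i'))" for i and s'' :: state
    show ?case
    proof (intro conjI, goal_cases)
      case 1
      show ?case using J v lt by simp
    next
      case 2
      show ?case
      proof (intro wp_Seq wp_IAssign, rule wp_conseq,
          rule wp_For[where J = K and M = "2 ^ b" and T = 62], goal_cases)
        case 1
        show ?case using J by (auto simp: K_def)
      next
        case (2 i s2)
        then show ?case using v by (simp add: frameD)
      next
        case (3 i s2)
        note f3 = frameD[OF 3(4)]
        have v3: "ivar s2 ''n'' = int n" "ivar s2 ''B'' = 2 ^ b" "ivar s2 ''o'' = ?o" "ivar s2 ''p'' = 2 ^ l" "ivar s2 ''r'' = int q"
          using f3 v J q by (simp_all add: butterfly_def)
        have e: "?o + int i div int q mod 2 ^ l * (2 * int q) + int i mod int q = ?o + int (?h i)"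
          by (simp add: zdiv_int zmod_int)
        have e': "int n div (2 * 2 ^ l) * (int i div int q) = int (n div (2 * 2 ^ l)) * int (?j i)"
          by (simp add: zdiv_int)
        have st: "fft_level n b (?v a) (Suc l) i = fft_level n b (?v a) l (?h i) +
            omega n powi (int (n div (2 * 2 ^ l)) * int (?j i)) * fft_level n b (?v a) l (?h i + q)" for a
          unfolding q_def by (rule fft_level_Suc[OF s(2,3) l])
        have rd: "carr s2 a (?o + int (?h i)) = fft_level n b (?v a) l (?h i)"
            "carr s2 a (?o + int (?h i) + int q) = fft_level n b (?v a) l (?h i + q)" if "a \<in> {''a'', ''b''}" for a
        proof -
          have *: "carr s2 a (?o + int i') = fft_level n b (?v a) l i'" if "i' < 2 ^ b" for i'
            using 3(2) \<open>a \<in> _\<close> that unfolding K_def by blast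
          have "?h i < 2 ^ b" "?h i + q < 2 ^ b" using hb[OF 3(1)] by linarith+
          from *[OF this(1)] *[OF this(2)] show "carr s2 a (?o + int (?h i)) = fft_level n b (?v a) l (?h i)"
            "carr s2 a (?o + int (?h i) + int q) = fft_level n b (?v a) l (?h i + q)"
            by (simp_all add: add.assoc)
        qed
        note rda = rd[of "''a''", simplified] and rdb = rd[of "''b''", simplified]
        \<comment> \<open>The cell to be written lies beyond the segment that is still being
          read.\<close>
        have lt1: "int i' \<noteq> 2 ^ b + int i" if "i' < 2 ^ b" for i'
        proof -
          have "int i' < 2 ^ b" using that by (metis of_nat_less_iff of_nat_numeral of_nat_power)
          then show ?thesis by linarith
        qed
        define h where "h = ?o + int (?h i)"
        define w where "w = omega n powi (int (n div (2 * 2 ^ l)) * int (?j i))"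
        have rda': "carr s2 ''a'' h = fft_level n b (?v ''a'') l (?h i)" "carr s2 ''a'' (h + int q) = fft_level n b (?v ''a'') l (?h i + q)"
          and rdb': "carr s2 ''b'' h = fft_level n b (?v ''b'') l (?h i)" "carr s2 ''b'' (h + int q) = fft_level n b (?v ''b'') l (?h i + q)"
          using rd unfolding h_def by blast+
        have val: "carr s2 ''a'' h + w * carr s2 ''a'' (h + int q) = fft_level n b (?v ''a'') (Suc l) i"
            "carr s2 ''b'' h + w * carr s2 ''b'' (h + int q) = fft_level n b (?v ''b'') (Suc l) i"
          unfolding st rda' rdb' w_def by simp_all
        show ?case
          unfolding butterfly_def
        proof (intro wp_Seq wp_IAssign wp_CStore, simp add: v3 3(3) e e' h_def[symmetric] w_def[symmetric] val del: of_nat_add of_nat_mult, goal_cases)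
          case 1
          show ?case
            using 3(2) lt1 unfolding K_def by (auto simp: less_Suc_eq)
        qed
      next
        case 4
        then show ?case by (simp add: butterfly_def)
      next
        case (5 s2 t)
        note f5 = frameD[OF 5(1)]
        have v5: "ivar s2 ''B'' = 2 ^ b" "ivar s2 ''o'' = ?o" "ivar s2 ''p'' = 2 ^ l" "ivar s2 ''r'' = int q"
          using f5 v J q by (simp_all add: butterfly_def)
        show ?case
          using 5(2) unfolding K_def
          by (intro wp_Seq wp_IAssign) (auto simp: J_def v5 q_def algebra_simps)
      qed
    qed
  next
    case (3 s')
    have "ivar s' ''B'' = 2 ^ b" using s frameD[OF 3(2)] by simp
    then show ?case using 3(1) by (simp add: J_def)
  next
    case (4 s' t)
    have "t \<le> b * (72 * 2 ^ b + 30 + 1 + 5) + 6" using 4(2) by simp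
    then have "2 + (2 + (2 + t)) \<le> 100 * ((b + 1) * (2 ^ b + 1))" by (simp add: algebra_simps)
    then show ?case using 4(2) by (simp add: J_def fft_level_def)
  qed
qed

section \<open>Subtracting and decoding in one pass\<close>

lemma mod_prog_subtract [simp]:
  "imod prog_subtract = {''Q'', ''i'', ''f'', ''g'', ''l'', ''j'', ''h'', ''w''}" "cmod prog_subtract = {''D''}"
  "iamod prog_subtract = {}" "camod prog_subtract = {''a'', ''b''}" "\<not> emits prog_subtract"
  by (auto simp: prog_subtract_def)

text \<open>The buckets that \<open>prog_subtract\<close> visits for the position \<open>g\<close>.
  They include every bucket in which it is audible; any others are far, which
  \<open>residual_noise\<close> tolerates.\<close>

definition nearby :: "nat \<Rightarrow> nat \<Rightarrow> nat \<Rightarrow> int \<Rightarrow> nat \<Rightarrow> bool" where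
  "nearby n B W g j \<longleftrightarrow> (\<exists>l<min B 5. int j = (bucket n W g + int l - 2) mod int B)"

lemma nearby_if_not_far:
  assumes n: "n = B * W" "B > 0" "W > 0" and j: "j < B" and nf: "\<not> far n B (int j * int W - g)"
  shows "nearby n B W g j"
proof -
  obtain q where q: "q \<in> {-2..2}" "int j = (bucket n W g + q) mod int B"
    using not_far_bucket[OF assms] by blast
  define l where "l = nat ((q + 2) mod int B)"
  have l: "int l = (q + 2) mod int B" using n(2) by (simp add: l_def)
  have "(bucket n W g + int l - 2) mod int B = (bucket n W g + q) mod int B"
  proof -
    have "[bucket n W g + (q + 2) mod int B - 2 = bucket n W g + (q + 2) - 2] (mod int B)"
      by (intro cong_diff cong_add cong_refl) (simp add: cong_def)
    then show ?thesis unfolding l by (simp add: cong_def)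
  qed
  moreover have "int l < int B" using l n(2) by simp
  moreover have "int l < 5"
  proof -
    have "(q + 2) mod int B \<le> q + 2" using q(1) by (intro zmod_le_nonneg_dividend) auto
    then show ?thesis using q(1) l by auto
  qed
  ultimately show ?thesis unfolding nearby_def using q(2) by (intro exI[of _ l]) auto
qed

text \<open>Different offsets below \<open>B\<close> reach different buckets, hence nothing is
  subtracted twice.\<close>

lemma cong_small_imp_eq:
  fixes l l' :: nat
  assumes "(a + int l - 2) mod int B = (a + int l' - 2) mod int B" and "l < B" and "l' < B"
  shows "l = l'"
proof -
  have "[a + int l - 2 = a + int l' - 2] (mod int B)" using assms(1) by (simp add: cong_def)
  then have "[(a + int l - 2) - (a - 2) = (a + int l' - 2) - (a - 2)] (mod int B)"
    by (rule cong_diff[OF _ cong_refl])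
  moreover have "(a + int l - 2) - (a - 2) = int l" "(a + int l' - 2) - (a - 2) = int l'" by simp_all
  ultimately have "[int l = int l'] (mod int B)" by (simp only:)
  then show ?thesis using assms(2,3) by (auto simp: cong_def)
qed

lemma wp_subtract:
  assumes n: "n = B * W" "B > 0" "W > 0"
    and s: "ivar s ''n'' = int n" "ivar s ''B'' = int B" "ivar s ''W'' = int W" "ivar s ''H'' = int (W div 2)"
      "ivar s ''u'' = int u" "ivar s ''c'' = int c"
  defines "\<sigma> \<equiv> ivar s ''s''"
  defines "F \<equiv> \<lambda>i. iarr s ''F'' (int i)"
  defines "z \<equiv> iarr s ''z''"
  shows "wp n x prog_subtract (\<lambda>s' t.
      (\<forall>j<B. carr s' ''a'' (ivar s ''o'' + int j) = carr s ''a'' (ivar s ''o'' + int j) -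
         (\<Sum>i | i < c \<and> nearby n B W (\<sigma> * F i) j. of_int (z (F i)) * dirichlet n B (int j * int W - \<sigma> * F i) ^ 2 ^ u)) \<and>
      (\<forall>j<B. carr s' ''b'' (ivar s ''o'' + int j) = carr s ''b'' (ivar s ''o'' + int j) -
         (\<Sum>i | i < c \<and> nearby n B W (\<sigma> * F i) j.
            of_int (z (F i)) * omega n powi (- (\<sigma> * F i)) * dirichlet n B (int j * int W - \<sigma> * F i) ^ 2 ^ u)) \<and>
      t \<le> 1000 * (c * (u + 1) + 1)) s"
proof -
  define off where "off = ivar s ''o''"
  define ta where "ta f j = of_int (z f) * dirichlet n B (int j * int W - \<sigma> * f) ^ 2 ^ u" for f j
  define tb where "tb f j = of_int (z f) * omega n powi (- (\<sigma> * f)) * dirichlet n B (int j * int W - \<sigma> * f) ^ 2 ^ u" for f j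
  have n0: "n > 0" using n by simp
  define Q where "Q = min B 5"
  let ?q = "Cond (ILe (V ''B'') (N 5)) (IAssign ''Q'' (V ''B'')) (IAssign ''Q'' (N 5))"
  have 1: "wp n x ?q (\<lambda>s' t. ivar s' ''Q'' = int Q \<and> t \<le> 7) s"
    using s by (intro wp_Cond wp_IAssign) (auto simp: Q_def)
  have sumSuc: "(\<Sum>i | i < Suc k \<and> P i. f i) = (\<Sum>i | i < k \<and> P i. f i) + (if P k then f k else 0)"
    for P and f :: "nat \<Rightarrow> complex" and k
  proof -
    have "{i. i < Suc k \<and> P i} = (if P k then insert k {i. i < k \<and> P i} else {i. i < k \<and> P i})"
      by (auto simp: less_Suc_eq)
    then show ?thesis by (simp add: add.commute)
  qed
  define J where "J i s' \<longleftrightarrow>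
      (\<forall>j<B. carr s' ''a'' (off + int j) = carr s ''a'' (off + int j) - (\<Sum>i' | i' < i \<and> nearby n B W (\<sigma> * F i') j. ta (F i') j)) \<and>
      (\<forall>j<B. carr s' ''b'' (off + int j) = carr s ''b'' (off + int j) - (\<Sum>i' | i' < i \<and> nearby n B W (\<sigma> * F i') j. tb (F i') j))"
    for i and s' :: state
  show ?thesis
    unfolding prog_subtract_def
  proof (rule wp_Seq2[OF 1], goal_cases)
    case (1 s1 t1)
    note f1 = frameD[OF 1(1), simplified] and R1 = 1(2)
    show ?case
    proof (rule wp_conseq, rule wp_For[where J = J and M = c and T = "40 * 5 * (u + 1) + 5 * 90 + 30"], goal_cases)
      case 1
      show ?case using f1 by (simp add: J_def off_def)
    next
      case (2 i s2)
      then show ?case using f1 s by (simp add: frameD)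
    next
      case (3 i s2)
      note f2 = frameD[OF 3(4), simplified]
      let ?f = "F i"
      let ?b = "bucket n W (\<sigma> * ?f)"
      have v2: "ivar s2 ''i'' = int i" "iarr s2 ''F'' = iarr s ''F''" "ivar s2 ''s'' = \<sigma>" "ivar s2 ''Q'' = int Q"
        "ivar s2 ''n'' = int n" "ivar s2 ''B'' = int B" "ivar s2 ''W'' = int W" "ivar s2 ''H'' = int (W div 2)"
        "ivar s2 ''u'' = int u" "ivar s2 ''o'' = off" "iarr s2 ''z'' = z"
        using f1 f2 3(3) R1 s by (simp_all add: \<sigma>_def z_def off_def)
      define K where "K l s' \<longleftrightarrow>
          (\<forall>j<B. carr s' ''a'' (off + int j) = carr s2 ''a'' (off + int j) -
             (if \<exists>l'<l. int j = (?b + int l' - 2) mod int B then ta ?f j else 0)) \<and>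
          (\<forall>j<B. carr s' ''b'' (off + int j) = carr s2 ''b'' (off + int j) -
             (if \<exists>l'<l. int j = (?b + int l' - 2) mod int B then tb ?f j else 0))" for l and s' :: state
      show ?case
      proof (intro wp_Seq wp_IAssign, rule wp_conseq,
          rule wp_For[where J = K and M = Q and T = "40 * (u + 1) + 70"], goal_cases)
        case 1
        show ?case by (simp add: K_def)
      next
        case (2 l s3)
        then show ?case using v2 by (simp add: frameD)
      next
        case (3 l s3)
        note f3 = frameD[OF 3(4), simplified]
        have v3: "ivar s3 ''l'' = int l" "ivar s3 ''f'' = ?f" "ivar s3 ''g'' = \<sigma> * ?f"
          "ivar s3 ''n'' = int n" "ivar s3 ''B'' = int B" "ivar s3 ''W'' = int W" "ivar s3 ''H'' = int (W div 2)"
          "ivar s3 ''u'' = int u" "ivar s3 ''o'' = off" "iarr s3 ''z'' = z"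
          using f3 v2 3(3) by (simp_all add: F_def)
        define jl where "jl = nat ((?b + int l - 2) mod int B)"
        have jl: "(?b + int l - 2) mod int B = int jl" "jl < B"
          using n(2) by (auto simp: jl_def nat_less_iff)
        have bk: "(\<sigma> * ?f + int (W div 2)) mod int n div int W = ?b" by (simp add: bucket_def)
        have new: "\<not> (\<exists>l'<l. int jl = (?b + int l' - 2) mod int B)"
        proof
          assume "\<exists>l'<l. int jl = (?b + int l' - 2) mod int B"
          then obtain l' where "l' < l" "(?b + int l - 2) mod int B = (?b + int l' - 2) mod int B" using jl by auto
          then show False using cong_small_imp_eq[of ?b l B l'] 3(1) by (auto simp: Q_def)
        qed
        have ex: "(\<exists>l'<Suc l. int j = (?b + int l' - 2) mod int B) \<longleftrightarrow>
            (\<exists>l'<l. int j = (?b + int l' - 2) mod int B) \<or> j = jl" for j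
          using jl by (auto simp: less_Suc_eq)
        let ?s4 = "s3\<lparr>ivar := (ivar s3)(''j'' := int jl, ''h'' := int jl * int W - \<sigma> * ?f)\<rparr>"
        show ?case
        proof (intro wp_Seq wp_IAssign, rule wp_conseq[OF wp_kernel[where B = B and u = u]], goal_cases)
          case (5 s5 t5)
          note f5 = frameD[OF 5(1), simplified]
          have v5: "ivar s5 ''j'' = int jl" "ivar s5 ''o'' = off" "ivar s5 ''f'' = ?f" "ivar s5 ''g'' = \<sigma> * ?f" "iarr s5 ''z'' = z"
            "carr s5 = carr s3"
            using f5 v3 bk jl by (auto simp del: of_nat_diff)
          have D: "cvar s5 ''D'' = dirichlet n B (int jl * int W - \<sigma> * ?f) ^ 2 ^ u" "t5 \<le> 40 * (u + 1)"
            using 5(2) v3 bk jl by simp_all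
          have TA: "of_int (z ?f) * dirichlet n B (int jl * int W - \<sigma> * ?f) ^ 2 ^ u = ta ?f jl"
            "of_int (z ?f) * omega n powi (- (\<sigma> * ?f)) * dirichlet n B (int jl * int W - \<sigma> * ?f) ^ 2 ^ u = tb ?f jl"
            by (simp_all add: ta_def tb_def)
          show ?case
            using 3(2) new D(2)
            by (intro wp_Seq wp_CStore) (simp add: v5 D(1) TA K_def ex, blast)
        qed (use v3 n0 in auto)
      next
        case 4
        show ?case by simp
      next
        case (5 s3 t3)
        have nb: "(\<exists>l'<Q. int j = (?b + int l' - 2) mod int B) \<longleftrightarrow> nearby n B W (\<sigma> * ?f) j" for j
          by (simp add: nearby_def Q_def)
        have "Q \<le> 5" by (simp add: Q_def)
        then have "Q * (40 * (u + 1) + 70 + 10) \<le> 5 * (40 * (u + 1) + 70 + 10)" by (rule mult_le_mono1)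
        then have "t3 \<le> 40 * 5 * (u + 1) + 5 * 80 + 10" using 5(2) by (simp add: algebra_simps)
        then show ?case
          using 5(2) 3(2) by (simp add: J_def K_def nb sumSuc)
      qed
    next
      case 4
      show ?case by simp
    next
      case (5 s2 t2)
      have "t2 \<le> c * (40 * 5 * (u + 1) + 5 * 90 + 30 + 10) + 8" using 5(2) by simp
      also have "\<dots> \<le> 900 * (c * (u + 1)) + 8" by (simp add: algebra_simps)
      finally have "t1 + t2 \<le> 1000 * (c * (u + 1) + 1)" using R1 by simp
      then show ?case using 5(2) by (simp add: J_def ta_def tb_def off_def)
    qed
  qed
qed

text \<open>\<open>F\<close> enumerates, without repetition, a finite set containing the support of
  \<open>z\<close>. The bound on \<open>z\<close> covers incorrect entries as well.\<close>

definition table_ok :: "nat \<Rightarrow> nat \<Rightarrow> state \<Rightarrow> bool" where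
  "table_ok n L s \<longleftrightarrow> (\<exists>c. ivar s ''c'' = int c \<and> inj_on (\<lambda>i. iarr s ''F'' (int i)) {..<c} \<and>
     (\<lambda>i. iarr s ''F'' (int i)) ` {..<c} \<subseteq> {1..int n} \<and>
     (\<forall>f. iarr s ''K'' f \<noteq> 0 \<longleftrightarrow> f \<in> (\<lambda>i. iarr s ''F'' (int i)) ` {..<c}) \<and>
     (\<forall>f. iarr s ''z'' f \<noteq> 0 \<longrightarrow> f \<in> (\<lambda>i. iarr s ''F'' (int i)) ` {..<c}) \<and>
     (\<forall>f. \<bar>iarr s ''z'' f\<bar> \<le> 4 * int L))"

lemma table_ok_cong:
  assumes "table_ok n L s" and "ivar s' ''c'' = ivar s ''c''" and "iarr s' = iarr s"
  shows "table_ok n L s'"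
  using assms unfolding table_ok_def by simp

lemma mod_prog_record [simp]:
  "imod prog_record = {''c''}" "cmod prog_record = {}"
  "iamod prog_record = {''z'', ''F'', ''K''}" "camod prog_record = {}" "\<not> emits prog_record"
  by (auto simp: prog_record_def)

lemma wp_record:
  assumes ok: "table_ok n L s" and f: "ivar s ''f'' \<in> {1..int n}" and v: "\<bar>ivar s ''v''\<bar> \<le> 4 * int L"
  shows "wp n x prog_record (\<lambda>s' t. table_ok n L s' \<and> iarr s' ''z'' = (iarr s ''z'')(ivar s ''f'' := ivar s ''v'') \<and>
     ivar s' ''c'' \<le> ivar s ''c'' + 1 \<and> t \<le> 40) s"
proof -
  obtain c where c: "ivar s ''c'' = int c" "inj_on (\<lambda>i. iarr s ''F'' (int i)) {..<c}"
     "(\<lambda>i. iarr s ''F'' (int i)) ` {..<c} \<subseteq> {1..int n}"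
     "\<forall>f. iarr s ''K'' f \<noteq> 0 \<longleftrightarrow> f \<in> (\<lambda>i. iarr s ''F'' (int i)) ` {..<c}"
     "\<forall>f. iarr s ''z'' f \<noteq> 0 \<longrightarrow> f \<in> (\<lambda>i. iarr s ''F'' (int i)) ` {..<c}"
     "\<forall>f. \<bar>iarr s ''z'' f\<bar> \<le> 4 * int L"
    using ok unfolding table_ok_def by blast
  let ?f = "ivar s ''f''" and ?v = "ivar s ''v''"
  let ?z = "(iarr s ''z'')(?f := ?v)"
  show ?thesis
  proof (cases "iarr s ''K'' ?f = 0")
    case False
    then have fF: "?f \<in> (\<lambda>i. iarr s ''F'' (int i)) ` {..<c}" using c(4) by blast
    have "table_ok n L (s\<lparr>iarr := (iarr s)(''z'' := ?z)\<rparr>)"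
      unfolding table_ok_def using c fF v by (intro exI[of _ c]) auto
    then show ?thesis
      unfolding prog_record_def
      by (intro wp_Seq wp_IStore wp_Cond wp_IAssign wp_Skip) (use False in auto)
  next
    case True
    then have fF: "?f \<notin> (\<lambda>i. iarr s ''F'' (int i)) ` {..<c}" using c(4) by blast
    let ?F = "\<lambda>i. ((iarr s ''F'')(int c := ?f)) (int i)"
    have img: "?F ` {..<c} = (\<lambda>i. iarr s ''F'' (int i)) ` {..<c}" by (intro image_cong) auto
    have img2: "?F ` {..<Suc c} = insert ?f ((\<lambda>i. iarr s ''F'' (int i)) ` {..<c})"
      unfolding lessThan_Suc image_insert img by simp
    have "inj_on ?F {..<c}" using c(2) by (auto simp: inj_on_def)
    then have inj: "inj_on ?F {..<Suc c}"
      unfolding lessThan_Suc using fF img by (auto simp: inj_on_insert)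
    have "table_ok n L (s\<lparr>iarr := (iarr s)(''z'' := ?z, ''F'' := (iarr s ''F'')(int c := ?f), ''K'' := (iarr s ''K'')(?f := 1)),
        ivar := (ivar s)(''c'' := int c + 1)\<rparr>)"
      unfolding table_ok_def
    proof (intro exI[of _ "Suc c"] conjI, goal_cases)
      case 2
      show ?case using inj by simp
    next
      case 3
      show ?case using img2 c(3) f by simp
    next
      case 4
      show ?case using img2 c(4) by simp
    next
      case 5
      show ?case using img2 c(5) by simp
    next
      case 6
      show ?case using c(6) v by simp
    qed simp
    then show ?thesis
      unfolding prog_record_def
      by (intro wp_Seq wp_IStore wp_Cond wp_IAssign wp_Skip) (use True c(1) in \<open>auto simp: fun_upd_twist\<close>)
  qed
qed

section \<open>Decoding the residual signal of one bucket\<close>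

lemma bucket_cong: "[g = g'] (mod int n) \<Longrightarrow> bucket n W g = bucket n W g'"
  unfolding bucket_def cong_def by (metis mod_add_cong)

lemma bucket_of_range:
  assumes "n = B * W" and "j < B" and "int j * int W - int (W div 2) \<le> g" and "g < int j * int W - int (W div 2) + int W"
  shows "bucket n W g = int j"
proof -
  define r where "r = g + int (W div 2) - int j * int W"
  have r: "0 \<le> r" "r < int W" using assms by (auto simp: r_def)
  have eq: "g + int (W div 2) = int j * int W + r" by (simp add: r_def)
  have "(int j + 1) * int W \<le> int B * int W" using assms(2) by (intro mult_right_mono) auto
  then have "int j * int W + r < int n" using r assms(1) by (simp add: algebra_simps)
  moreover have "0 \<le> int j * int W + r" using r by simp
  ultimately have "(g + int (W div 2)) mod int n = int j * int W + r" unfolding eq by (rule mod_pos_pos_trivial[rotated])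
  then show ?thesis using r by (simp add: bucket_def)
qed

lemma mod_prog_value [simp]:
  "imod prog_value = {''f'', ''h'', ''w'', ''p'', ''v'', ''c''}" "cmod prog_value = {''D'', ''w''}"
  "iamod prog_value = {''z'', ''F'', ''K''}" "camod prog_value = {}" "\<not> emits prog_value"
  by (auto simp: prog_value_def)

lemma mod_prog_bucket [simp]:
  "imod prog_bucket = {''g'', ''p'', ''f'', ''h'', ''w'', ''v'', ''c''}" "cmod prog_bucket = {''E'', ''w'', ''R'', ''D''}"
  "iamod prog_bucket = {''z'', ''F'', ''K''}" "camod prog_bucket = {}" "\<not> emits prog_bucket"
  by (auto simp: prog_bucket_def)

text \<open>The interface between the numerical and the combinatorial part. \<open>u0\<close> and
  \<open>u1\<close> are the bucket contents for the two time shifts after subtraction; up to \<nu>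
  they are the sums over the audible residual frequencies. \<open>z0\<close> is the estimate at the
  start of the pass and stays fixed while buckets are updated.\<close>

locale decoding =
  fixes n B W w u p L :: nat and xh z0 :: "int \<Rightarrow> int" and \<sigma> y :: int
    and u0 u1 :: "nat \<Rightarrow> complex" and \<nu> :: real
  assumes n: "n = B * W" and B: "B > 0" and W: "W = 2 ^ w"
    and xh: "\<And>f. f \<in> {1..int n} \<Longrightarrow> \<bar>xh f\<bar> \<le> int L"
    and inv: "[\<sigma> * y = 1] (mod int n)"
    and p: "2 * int L + 1 \<le> 2 ^ p" "2 ^ p \<le> 4 * int L + 2" "L \<ge> 1"
    and noise: "8 * real n * \<nu> \<le> (real B / 2) ^ 2 ^ u"
    and u0: "\<And>j. j < B \<Longrightarrow> norm (u0 j - (\<Sum>f | f \<in> {1..int n} \<and> xh f \<noteq> z0 f \<and> \<not> far n B (int j * int W - \<sigma> * f).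
        of_int (xh f - z0 f) * 1 * dirichlet n B (int j * int W - \<sigma> * f) ^ 2 ^ u)) \<le> \<nu>"
    and u1: "\<And>j. j < B \<Longrightarrow> norm (u1 j - (\<Sum>f | f \<in> {1..int n} \<and> xh f \<noteq> z0 f \<and> \<not> far n B (int j * int W - \<sigma> * f).
        of_int (xh f - z0 f) * omega n powi (- (\<sigma> * f)) * dirichlet n B (int j * int W - \<sigma> * f) ^ 2 ^ u)) \<le> \<nu>"
begin

abbreviation "S0 \<equiv> {f \<in> {1..int n}. xh f \<noteq> z0 f}"
abbreviation "D j f \<equiv> dirichlet n B (int j * int W - \<sigma> * f) ^ 2 ^ u"
abbreviation "Z j \<equiv> {f. f \<in> {1..int n} \<and> xh f \<noteq> z0 f \<and> \<not> far n B (int j * int W - \<sigma> * f)}"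
abbreviation "\<mu> \<equiv> (real B / 2) ^ 2 ^ u"

lemma n0: "n > 0" and W0: "W > 0" and \<mu>0: "\<mu> > 0" and WW: "even W \<or> W = 1"
  using n B W by (cases w; simp)+

lemma lone:
  assumes "bad_pairs n B \<sigma> S0 j = {}" and "f \<in> Z j"
  shows "Z j = {f}"
proof -
  have "n div B = W" using n B by simp
  then have "f' = f" if "f' \<in> Z j" for f'
    using assms that unfolding bad_pairs_def by blast
  then show ?thesis using assms(2) by blast
qed

lemma \<nu>_le: "\<nu> \<le> \<mu> / 8" if "\<nu> \<ge> 0"
proof -
  have "1 * (8 * \<nu>) \<le> real n * (8 * \<nu>)" using that n0 by (intro mult_right_mono) auto
  then show ?thesis using noise by simp
qed

lemma \<nu>0: "j < B \<Longrightarrow> \<nu> \<ge> 0"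
  using u0[of j] norm_ge_zero order_trans by blast

text \<open>The residual value is a nonzero integer, so the signal is at least \<mu> while the noise
  is at most \<mu> / 8. This clears the threshold \<mu> / 2 and leaves an error of at most 1/8 for
  rounding.\<close>

lemma in_bucket_detected:
  assumes j: "j < B" and good: "bad_pairs n B \<sigma> S0 j = {}" and f: "f \<in> S0" "bucket n W (\<sigma> * f) = int j"
  shows "\<mu> \<le> 2 * norm (u0 j)" and "f \<in> Z j"
    and "[g = \<sigma> * f] (mod int n) \<Longrightarrow>
      \<bar>Re (u0 j / dirichlet n B (int j * int W - g) ^ 2 ^ u) - of_int (xh f - z0 f)\<bar> < 1 / 2"
proof -
  have core: "real B / 2 \<le> norm (dirichlet n B (int j * int W - \<sigma> * f))"
    using bucket_core[OF n B W0 WW, of "\<sigma> * f"] f(2) by simp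
  then show fZ: "f \<in> Z j" using f B by (auto simp: far_def)
  have Z: "Z j = {f}" by (rule lone[OF good fZ])
  have D: "\<mu> \<le> norm (D j f)" using core by (simp add: norm_power power_mono)
  let ?a = "of_int (xh f - z0 f) :: complex"
  have "xh f - z0 f \<noteq> 0" using f(1) by simp
  then have "1 \<le> \<bar>xh f - z0 f\<bar>" by arith
  then have "1 \<le> real_of_int \<bar>xh f - z0 f\<bar>" by linarith
  then have a: "1 \<le> norm ?a" by (simp only: norm_of_int of_int_abs)
  have v: "norm (u0 j - ?a * D j f) \<le> \<nu>" using u0[OF j] unfolding Z by simp
  have "1 * norm (D j f) \<le> norm ?a * norm (D j f)" using a by (intro mult_right_mono) auto
  then have "\<mu> \<le> norm (?a * D j f)" using D by (simp add: norm_mult)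
  moreover have "norm (?a * D j f) \<le> norm (u0 j) + norm (u0 j - ?a * D j f)"
    using norm_triangle_ineq4[of "u0 j" "u0 j - ?a * D j f"] by simp
  ultimately show "\<mu> \<le> 2 * norm (u0 j)" using v \<nu>_le[OF \<nu>0[OF j]] \<mu>0 by linarith
  assume "[g = \<sigma> * f] (mod int n)"
  then have "[int j * int W - g = int j * int W - \<sigma> * f] (mod int n)" by (rule cong_diff[OF cong_refl])
  then have eq: "dirichlet n B (int j * int W - g) ^ 2 ^ u = D j f" using dirichlet_cong[OF n0] by metis
  have D0: "0 < norm (D j f)" using D \<mu>0 by linarith
  have "u0 j / D j f - ?a = (u0 j - ?a * D j f) / D j f" using D0 by (simp add: field_simps)
  then have "norm (u0 j / D j f - ?a) = norm (u0 j - ?a * D j f) / norm (D j f)" by (simp add: norm_divide)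
  also have "\<dots> \<le> \<nu> / \<mu>" using v D \<mu>0 \<nu>0[OF j] by (intro frac_le) auto
  also have "\<dots> \<le> 1 / 8" using \<nu>_le[OF \<nu>0[OF j]] \<mu>0 by (simp add: divide_le_eq)
  finally have "norm (u0 j / D j f - ?a) \<le> 1 / 8" .
  then have "\<bar>Re (u0 j / D j f - ?a)\<bar> \<le> 1 / 8" using abs_Re_le_cmod order_trans by blast
  then show "\<bar>Re (u0 j / dirichlet n B (int j * int W - g) ^ 2 ^ u) - of_int (xh f - z0 f)\<bar> < 1 / 2"
    unfolding eq by simp
qed

text \<open>The frequency need only be audible, not lie in the bucket: passing the threshold already
  makes the noise small compared with the content.\<close>

lemma detected_phase:
  assumes j: "j < B" and good: "bad_pairs n B \<sigma> S0 j = {}" and t: "\<mu> \<le> 2 * norm (u0 j)" and f: "f \<in> Z j"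
  shows "2 * real n * norm (u1 j / u0 j - omega n powi (- (\<sigma> * f))) \<le> 1"
proof (rule ratio_error)
  have Z: "Z j = {f}" by (rule lone[OF good f])
  show "norm (u0 j - of_int (xh f - z0 f) * D j f) \<le> \<nu>" using u0[OF j] unfolding Z by simp
  show "norm (u1 j - of_int (xh f - z0 f) * D j f * omega n powi (- (\<sigma> * f))) \<le> \<nu>"
    using u1[OF j] unfolding Z by (simp add: mult_ac)
qed (use t noise n0 \<mu>0 in auto)

text \<open>If nothing is audible, the content is noise of size at most \<mu> / 8, below the
  threshold.\<close>

lemma detected_exists:
  assumes j: "j < B" and t: "\<mu> \<le> 2 * norm (u0 j)"
  shows "Z j \<noteq> {}"
proof
  assume "Z j = {}"
  then have "norm (u0 j) \<le> \<nu>" using u0[OF j] by (simp only: sum.empty) simp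
  then show False using t \<nu>_le[OF \<nu>0[OF j]] \<mu>0 by linarith
qed

text \<open>For any g, good or not, only the entry of the one frequency dilated to g is overwritten.
  Noise matters only for the value that is stored.\<close>

lemma wp_value:
  assumes s: "ivar s ''n'' = int n" "ivar s ''B'' = int B" "ivar s ''u'' = int u" "ivar s ''W'' = int W"
      "ivar s ''y'' = y" "ivar s ''j'' = int j" "ivar s ''P'' = 2 ^ p" "ivar s ''L'' = int L" "cvar s ''E'' = u0 j"
    and ok: "table_ok n L s" and g: "ivar s ''g'' = g"
  shows "wp n x prog_value (\<lambda>s' t. table_ok n L s' \<and> ivar s' ''c'' \<le> ivar s ''c'' + 1 \<and>
     (\<exists>f\<in>{1..int n}. \<exists>v. [\<sigma> * f = g] (mod int n) \<and> iarr s' ''z'' = (iarr s ''z'')(f := v) \<and>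
       (\<forall>a. \<bar>a\<bar> \<le> int L \<longrightarrow>
          \<bar>Re (u0 j / dirichlet n B (int j * int W - g) ^ 2 ^ u) - of_int (a - iarr s ''z'' f)\<bar> < 1 / 2 \<longrightarrow> v = a)) \<and>
     t \<le> 200 * (u + p + 1)) s"
proof -
  define f where "f = (y * g - 1) mod int n + 1"
  have "0 \<le> (y * g - 1) mod int n" "(y * g - 1) mod int n < int n" using n0 by simp_all
  then have f: "f \<in> {1..int n}" unfolding f_def by simp
  have "[f = y * g] (mod int n)"
    using idx_cong[OF n0, of "y * g"] by (simp add: f_def idx_def)
  then have "[\<sigma> * f = \<sigma> * (y * g)] (mod int n)" by (rule cong_scalar_left)
  moreover have "[\<sigma> * y * g = 1 * g] (mod int n)" by (rule cong_scalar_right[OF inv])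
  ultimately have fg: "[\<sigma> * f = g] (mod int n)" by (simp add: mult.assoc cong_def)
  show ?thesis
    unfolding prog_value_def
  proof (intro wp_Seq wp_IAssign, rule wp_conseq[OF wp_kernel[where B = B and u = u]], goal_cases)
    case (5 s1 t1)
    note f1 = frameD[OF 5(1), simplified]
    have v1: "ivar s1 ''f'' = f" "iarr s1 = iarr s" "cvar s1 ''E'' = u0 j" "ivar s1 ''P'' = 2 ^ p" "ivar s1 ''L'' = int L"
      "ivar s1 ''c'' = ivar s ''c''"
      using f1 s g by (auto simp: f_def)
    have D1: "cvar s1 ''D'' = dirichlet n B (int j * int W - g) ^ 2 ^ u" "t1 \<le> 40 * (u + 1)"
      using 5(2) s g by simp_all
    let ?r = "of_int (iarr s ''z'' f) + u0 j / dirichlet n B (int j * int W - g) ^ 2 ^ u"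
    show ?case
    proof (intro wp_Seq wp_CAssign, rule wp_conseq[OF wp_round[where p = p and L = L]], goal_cases)
      case (4 s2 t2)
      note f2 = frameD[OF 4(1), simplified]
      have v2: "ivar s2 ''f'' = f" "iarr s2 = iarr s" "ivar s2 ''c'' = ivar s ''c''"
        using f2 v1 by auto
      have r2: "- int L \<le> ivar s2 ''v''" "ivar s2 ''v'' < - int L + 2 ^ p"
        "\<forall>a. \<bar>a\<bar> \<le> int L \<longrightarrow> \<bar>Re ?r - of_int a\<bar> < 1 / 2 \<longrightarrow> ivar s2 ''v'' = a" "t2 \<le> 40 * (p + 1)"
        using 4(2) by (simp_all add: v1 D1)
      show ?case
      proof (rule wp_conseq[OF wp_record[where n = n and L = L]], goal_cases)
        case 1
        show ?case by (rule table_ok_cong[OF ok]) (use v2 in auto)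
      next
        case 2
        show ?case using f v2 by simp
      next
        case 3
        show ?case using r2(1,2) p by (simp add: abs_le_iff)
      next
        case (4 s3 t3)
        have "\<forall>a. \<bar>a\<bar> \<le> int L \<longrightarrow>
          \<bar>Re (u0 j / dirichlet n B (int j * int W - g) ^ 2 ^ u) - of_int (a - iarr s ''z'' f)\<bar> < 1 / 2 \<longrightarrow> ivar s2 ''v'' = a"
          using r2(3) by (simp add: algebra_simps)
        then show ?case
          using 4(2) v2 f fg r2(4) D1(2) by auto
      qed
    qed (use v1 p in auto)
  qed (use s n0 in auto)
qed

text \<open>Two kinds of guarantee. Always, at most one entry changes, and only within bucket j;
  this limits the damage of a collision. Without collisions, all entries of the bucket become
  correct. For B \<ge> 8 the phase search is reliable, for B = n the width is 1 and no search takes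
  place, and for empty \<open>S0\<close> nothing can be missed.\<close>

lemma wp_bucket:
  assumes j: "j < B"
    and s: "ivar s ''n'' = int n" "ivar s ''B'' = int B" "ivar s ''u'' = int u" "ivar s ''W'' = int W"
      "ivar s ''H'' = int (W div 2)" "ivar s ''M'' = int B ^ 2 ^ u" "ivar s ''T'' = 2 ^ 2 ^ u"
      "ivar s ''y'' = y" "ivar s ''j'' = int j" "ivar s ''P'' = 2 ^ p" "ivar s ''L'' = int L"
      "carr s ''a'' (ivar s ''o'' + int j) = u0 j" "carr s ''b'' (ivar s ''o'' + int j) = u1 j"
    and ok: "table_ok n L s"
    and z: "\<And>f. f \<in> {1..int n} \<Longrightarrow> bucket n W (\<sigma> * f) = int j \<Longrightarrow> iarr s ''z'' f = z0 f"
  shows "wp n x prog_bucket (\<lambda>s' t. table_ok n L s' \<and> ivar s' ''c'' \<le> ivar s ''c'' + 1 \<and>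
     (\<exists>f0. \<forall>f. f \<noteq> f0 \<longrightarrow> iarr s' ''z'' f = iarr s ''z'' f) \<and>
     (\<forall>f\<in>{1..int n}. bucket n W (\<sigma> * f) \<noteq> int j \<longrightarrow> iarr s' ''z'' f = iarr s ''z'' f) \<and>
     (bad_pairs n B \<sigma> S0 j = {} \<longrightarrow> (8 \<le> B \<or> B = n \<or> S0 = {}) \<longrightarrow>
        (\<forall>f\<in>{1..int n}. bucket n W (\<sigma> * f) = int j \<longrightarrow> iarr s' ''z'' f = xh f)) \<and>
     t \<le> 500 * (w + u + p + 1)) s"
proof -
  let ?Q = "\<lambda>s' t. table_ok n L s' \<and> ivar s' ''c'' \<le> ivar s ''c'' + 1 \<and>
     (\<exists>f0. \<forall>f. f \<noteq> f0 \<longrightarrow> iarr s' ''z'' f = iarr s ''z'' f) \<and>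
     (\<forall>f\<in>{1..int n}. bucket n W (\<sigma> * f) \<noteq> int j \<longrightarrow> iarr s' ''z'' f = iarr s ''z'' f) \<and>
     (bad_pairs n B \<sigma> S0 j = {} \<longrightarrow> (8 \<le> B \<or> B = n \<or> S0 = {}) \<longrightarrow>
        (\<forall>f\<in>{1..int n}. bucket n W (\<sigma> * f) = int j \<longrightarrow> iarr s' ''z'' f = xh f)) \<and>
     t \<le> 500 * (w + u + p + 1)"
  have skip: "?Q s' t"
    if "\<And>f. bad_pairs n B \<sigma> S0 j = {} \<Longrightarrow> 8 \<le> B \<or> B = n \<or> S0 = {} \<Longrightarrow> f \<in> S0 \<Longrightarrow> bucket n W (\<sigma> * f) = int j \<Longrightarrow> False"
      "iarr s' = iarr s" "ivar s' ''c'' = ivar s ''c''" "t \<le> 500 * (w + u + p + 1)" for s' t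
  proof (intro conjI)
    show "table_ok n L s'" by (rule table_ok_cong[OF ok]) (use that in auto)
    show "bad_pairs n B \<sigma> S0 j = {} \<longrightarrow> 8 \<le> B \<or> B = n \<or> S0 = {} \<longrightarrow>
        (\<forall>f\<in>{1..int n}. bucket n W (\<sigma> * f) = int j \<longrightarrow> iarr s' ''z'' f = xh f)"
    proof (intro impI ballI)
      fix f assume g: "bad_pairs n B \<sigma> S0 j = {}" "8 \<le> B \<or> B = n \<or> S0 = {}"
        and f: "f \<in> {1..int n}" "bucket n W (\<sigma> * f) = int j"
      have "xh f = z0 f"
      proof (rule ccontr)
        assume "xh f \<noteq> z0 f"
        then show False using that(1)[OF g _ f(2)] f(1) by simp
      qed
      then show "iarr s' ''z'' f = xh f" using z f that(2) by simp
    qed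
  qed (use that in auto)
  let ?s1 = "s\<lparr>cvar := (cvar s)(''E'' := u0 j, ''w'' := of_int (2 * 2 ^ 2 ^ u) * u0 j / of_int (int B ^ 2 ^ u))\<rparr>"
  have thr: "bval n x (ReLe (OfInt (N 1)) (norm2 ''w'')) ?s1 \<longleftrightarrow> \<mu> \<le> 2 * norm (u0 j)"
  proof -
    let ?c = "of_int (2 * 2 ^ 2 ^ u) * u0 j / of_int (int B ^ 2 ^ u)"
    have "bval n x (ReLe (OfInt (N 1)) (norm2 ''w'')) ?s1 \<longleftrightarrow> 1 \<le> (norm ?c)\<^sup>2"
      unfolding cmod_power2 by (simp add: power2_eq_square del: of_int_mult of_int_power)
    also have "\<dots> \<longleftrightarrow> 1 \<le> norm ?c" by (metis one_le_power power2_nonneg_ge_1_iff norm_ge_zero)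
    also have "norm ?c = 2 * norm (u0 j) / \<mu>"
      using B by (simp add: norm_mult norm_divide norm_power power_divide field_simps)
    also have "1 \<le> 2 * norm (u0 j) / \<mu> \<longleftrightarrow> \<mu> \<le> 2 * norm (u0 j)" using \<mu>0 by (simp add: le_divide_eq)
    finally show ?thesis .
  qed
  let ?g0 = "int j * int W - int (W div 2)"
  let ?R = "u1 j / u0 j"
  show ?thesis
    unfolding prog_bucket_def
  proof (intro wp_Seq wp_CAssign wp_Cond, goal_cases)
    case 1
    then have t: "\<mu> \<le> 2 * norm (u0 j)" using thr s by simp
    show ?case
    proof (intro wp_Seq wp_CAssign wp_IAssign, rule wp_conseq[OF wp_phase[OF n0, where w = w]], goal_cases)
      case 1
      show ?case using s W by simp
    next
      case (2 s2 t2)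
      note f2 = frameD[OF 2(1), simplified]
      define g where "g = ivar s2 ''g''"
      have e8: "8 * 2 ^ w \<le> int n \<longleftrightarrow> 8 * W \<le> n"
        unfolding W by (metis of_nat_le_iff of_nat_mult of_nat_numeral of_nat_power)
      have g: "?g0 \<le> g" "g < ?g0 + int W" "t2 \<le> 40 * (w + 1)"
        and H: "\<forall>g'. 2 * real n * norm (?R - omega n powi (- g')) \<le> 1 \<longrightarrow> ?g0 \<le> g' \<longrightarrow> g' < ?g0 + 2 ^ w \<longrightarrow>
           w = 0 \<or> 8 * 2 ^ w \<le> int n \<longrightarrow> g = g'"
        using 2(2) s W by (simp_all add: g_def) blast
      have gu: "g = g'" if "2 * real n * norm (?R - omega n powi (- g')) \<le> 1" "?g0 \<le> g'" "g' < ?g0 + int W"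
           "w = 0 \<or> 8 * W \<le> n" for g'
      proof -
        have "w = 0 \<or> 8 * 2 ^ w \<le> int n" using that(4) e8 by blast
        moreover have "g' < ?g0 + 2 ^ w" using that(3) W by simp
        ultimately show ?thesis using H that(1,2) by blast
      qed
      have v2: "cvar s2 ''R'' = ?R" "cvar s2 ''E'' = u0 j" "iarr s2 = iarr s" "ivar s2 ''c'' = ivar s ''c''"
        "ivar s2 ''n'' = int n" "ivar s2 ''B'' = int B" "ivar s2 ''u'' = int u" "ivar s2 ''W'' = int W"
        "ivar s2 ''y'' = y" "ivar s2 ''j'' = int j" "ivar s2 ''P'' = 2 ^ p" "ivar s2 ''L'' = int L"
        using f2 s by auto
      have small: "w = 0 \<or> 8 * W \<le> n" if "8 \<le> B \<or> B = n"
      proof (cases "8 \<le> B")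
        case True
        then show ?thesis using n by simp
      next
        case False
        then have "W = 1" using that n n0 by simp
        then show ?thesis using W by (cases w) auto
      qed
      let ?s3 = "s2\<lparr>cvar := (cvar s2)(''w'' := ?R - omega n powi (- g))\<rparr>"
      have chk: "bval n x (ReLe (CMul (OfInt (IMul (V ''n'') (V ''n''))) (norm2 ''w'')) (OfInt (N 1))) ?s3
          \<longleftrightarrow> real n * norm (?R - omega n powi (- g)) \<le> 1"
      proof -
        let ?c = "?R - omega n powi (- g)"
        have "bval n x (ReLe (CMul (OfInt (IMul (V ''n'') (V ''n''))) (norm2 ''w'')) (OfInt (N 1))) ?s3 \<longleftrightarrow>
            real n * real n * (norm ?c)\<^sup>2 \<le> 1"
          unfolding cmod_power2 using v2 by (simp add: power2_eq_square)
        also have "real n * real n * (norm ?c)\<^sup>2 = (real n * norm ?c)\<^sup>2" by (simp add: power2_eq_square)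
        also have "\<dots> \<le> 1 \<longleftrightarrow> real n * norm ?c \<le> 1"
          using power2_le_iff_abs_le[of 1 "real n * norm ?c"] by simp
        finally show ?thesis .
      qed
      have bg: "bucket n W g = int j" by (rule bucket_of_range[OF n j g(1,2)])
      show ?case
      proof (intro wp_Seq wp_CAssign wp_Cond, goal_cases)
        case 1
        then have c: "real n * norm (?R - omega n powi (- g)) \<le> 1" using chk v2 by (simp add: g_def)
        show ?case
        proof (rule wp_conseq[OF wp_value[where j = j and g = g]], goal_cases)
          case (12 s4 t4)
          then obtain f v where fv: "f \<in> {1..int n}" "[\<sigma> * f = g] (mod int n)" "iarr s4 ''z'' = (iarr s ''z'')(f := v)"
            "\<And>a. \<bar>a\<bar> \<le> int L \<Longrightarrow>
              \<bar>Re (u0 j / dirichlet n B (int j * int W - g) ^ 2 ^ u) - of_int (a - iarr s ''z'' f)\<bar> < 1 / 2 \<Longrightarrow> v = a"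
            using v2 by auto
          have bf: "bucket n W (\<sigma> * f) = int j" using bucket_cong[OF fv(2)] bg by simp
          have fin: "iarr s4 ''z'' f' = xh f'"
            if good: "bad_pairs n B \<sigma> S0 j = {}" and f': "f' \<in> {1..int n}" "bucket n W (\<sigma> * f') = int j" for f'
          proof -
            \<comment> \<open>A priori \<open>f1\<close> is only audible and may belong to a
              neighbouring bucket. The phase check identifies its position with g, which lies in
              bucket j.\<close>
            obtain f1 where f1: "f1 \<in> Z j" using detected_exists[OF j t] by blast
            have "[g = \<sigma> * f1] (mod int n)"
              by (rule phase_check[OF n0 detected_phase[OF j good t f1] c])
            then have "[\<sigma> * f = \<sigma> * f1] (mod int n)" using fv(2) cong_trans by blast
            then have "[y * (\<sigma> * f) = y * (\<sigma> * f1)] (mod int n)" by (rule cong_scalar_left)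
            moreover have "[\<sigma> * y * f = 1 * f] (mod int n)" "[\<sigma> * y * f1 = 1 * f1] (mod int n)"
              by (rule cong_scalar_right[OF inv])+
            ultimately have "[f = f1] (mod int n)" by (simp add: cong_def mult_ac)
            moreover have "[idx n f = f] (mod int n)" by (rule idx_cong[OF n0])
            ultimately have "f = f1"
            proof -
              assume c: "[f = f1] (mod int n)"
              have "f mod int n = f1 mod int n" using c by (simp add: cong_def)
              then have "int n dvd f - f1" by (simp add: mod_eq_dvd_iff)
              moreover have "\<bar>f - f1\<bar> < int n" using f1 fv(1) by (auto simp: abs_less_iff)
              ultimately show ?thesis using zdvd_imp_le[of "int n" "\<bar>f - f1\<bar>"] by fastforce
            qed
            then have fS: "f \<in> S0" "f \<in> Z j" using f1 by auto
            have "v = xh f"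
            proof (rule fv(4))
              show "\<bar>xh f\<bar> \<le> int L" by (rule xh[OF fv(1)])
              show "\<bar>Re (u0 j / dirichlet n B (int j * int W - g) ^ 2 ^ u) - of_int (xh f - iarr s ''z'' f)\<bar> < 1 / 2"
                using in_bucket_detected(3)[OF j good fS(1) bf cong_sym[OF fv(2)]] z[OF fv(1) bf] by simp
            qed
            moreover have "xh f' = z0 f'" if "f' \<noteq> f"
            proof (rule ccontr)
              assume "xh f' \<noteq> z0 f'"
              then have "f' \<in> Z j" using in_bucket_detected(2)[OF j good _ f'(2)] f'(1) by simp
              then show False using lone[OF good fS(2)] that by blast
            qed
            ultimately show ?thesis using z[OF f'] fv(3) by (cases "f' = f") auto
          qed
          have "iarr s4 ''z'' f' = iarr s ''z'' f'" if "bucket n W (\<sigma> * f') \<noteq> int j" for f'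
            using that bf fv(3) by auto
          moreover have "\<forall>f'. f' \<noteq> f \<longrightarrow> iarr s4 ''z'' f' = iarr s ''z'' f'" using fv(3) by simp
          ultimately show ?case using 12(2) fin v2 g(3) by auto
        qed (use v2 g_def in \<open>auto intro: table_ok_cong[OF ok]\<close>)
      next
        case 2
        then have c: "\<not> real n * norm (?R - omega n powi (- g)) \<le> 1" using chk v2 by (simp add: g_def)
        \<comment> \<open>A residual frequency of this bucket has a representative in the searched
          interval, so the search would have ended there and the check would have succeeded.\<close>
        have no: False if good: "bad_pairs n B \<sigma> S0 j = {}" "8 \<le> B \<or> B = n \<or> S0 = {}"
          and f: "f \<in> S0" "bucket n W (\<sigma> * f) = int j" for f
        proof -
          have ph: "2 * real n * norm (?R - omega n powi (- (\<sigma> * f))) \<le> 1"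
            by (rule detected_phase[OF j good(1) t in_bucket_detected(2)[OF j good(1) f]])
          obtain r where r: "[\<sigma> * f = bucket n W (\<sigma> * f) * int W + r - int (W div 2)] (mod int n)" "0 \<le> r" "r < int W"
            using bucket_decomp[OF n B W0] by blast
          let ?g' = "?g0 + r"
          have "[\<sigma> * f = ?g'] (mod int n)" using r(1) f(2) by (simp add: algebra_simps)
          then have "[0 - \<sigma> * f = 0 - ?g'] (mod int n)" by (rule cong_diff[OF cong_refl])
          then have "[- (\<sigma> * f) = - ?g'] (mod int n)" by (simp only: diff_0)
          then have eq: "omega n powi (- (\<sigma> * f)) = omega n powi (- ?g')" by (rule omega_powi_cong[OF n0])
          have "g = ?g'"
            by (rule gu) (use ph eq r small good f in auto)
          then have "real n * norm (?R - omega n powi (- g)) \<le> 1"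
            using ph eq mult_nonneg_nonneg[of "real n" "norm (?R - omega n powi (- g))"] by simp
          then show False using c by simp
        qed
        show ?case
          using v2 g(3) by (intro wp_Skip skip[OF no]) auto
      qed
    qed
  next
    case 2
    then have t: "\<not> \<mu> \<le> 2 * norm (u0 j)" using thr s by simp
    show ?case
      by (intro wp_Skip skip) (use t in_bucket_detected(1)[OF j] in auto)
  qed
qed

end

section \<open>One complete pass\<close>

definition static :: "nat \<Rightarrow> nat \<Rightarrow> nat \<Rightarrow> nat \<Rightarrow> nat \<Rightarrow> state \<Rightarrow> bool" where
  "static n e u p L s \<longleftrightarrow> ivar s ''n'' = int n \<and> ivar s ''e'' = int e \<and> ivar s ''m'' = int (2 ^ u) \<and>
     ivar s ''u'' = int u \<and> ivar s ''P'' = 2 ^ p \<and> ivar s ''L'' = int L \<and> ivar s ''T'' = 2 ^ 2 ^ u \<and>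
     cvar s ''S'' = of_real (newton_sqrt n (4 * 2 ^ u))"

lemma newton_ratio:
  assumes "n > 0"
  shows "norm (of_real (newton_sqrt n i) / of_real (sqrt (real n)) - 1 :: complex) \<le> real n / 2 ^ i"
proof -
  let ?r = "sqrt (real n)" and ?s = "newton_sqrt n i"
  have b: "?r \<le> ?s" "?s - ?r \<le> real n / 2 ^ i" using newton_sqrt_bounds[OF assms] by blast+
  have r: "1 \<le> ?r" using assms by simp
  have "norm (of_real ?s / of_real ?r - 1 :: complex) = norm (complex_of_real (?s / ?r - 1))" by simp
  also have "\<dots> = \<bar>?s / ?r - 1\<bar>" by (rule norm_of_real)
  also have "\<bar>?s / ?r - 1\<bar> = (?s - ?r) / ?r" using b r by (simp add: diff_divide_distrib)
  also have "\<dots> \<le> (?s - ?r) / 1" using b r by (intro divide_left_mono) auto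
  finally show ?thesis using b by simp
qed

lemma cost_bound:
  fixes e m B b c u w p :: nat
  assumes "e \<le> m" "b \<le> m" "u \<le> m" "w \<le> m" "p \<le> m" "1 \<le> m" "1 \<le> B"
    and "t1 \<le> 100 * (e + m + B + 1)" "t2 \<le> 100 * (m * B + B + 1)" "t3 \<le> 100 * ((b + 1) * (B + 1))"
    and "t4 \<le> 1000 * (c * (u + 1) + 1)" "t5 \<le> B * (500 * (w + u + p + 1) + 10) + 8"
  shows "t1 + (t2 + (t3 + (t4 + (t5 + 8)))) \<le> 5000 * (m * B) + 1000 * (c * (u + 1))"
proof -
  define X where "X = m * B"
  have "m * 1 \<le> X" "1 * B \<le> X" "1 * 1 \<le> X" unfolding X_def using assms(6,7) by (intro mult_le_mono; simp)+
  then have mB: "m \<le> X" "B \<le> X" "1 \<le> X" by simp_all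
  have "(b + 1) * (B + 1) \<le> (2 * m) * (2 * B)" using assms(2,6,7) by (intro mult_le_mono) auto
  then have t3: "t3 \<le> 400 * X" using assms(10) by (simp add: X_def)
  have "500 * (w + u + p + 1) + 10 = 500 * w + 500 * u + 500 * p + 510" by simp
  then have "500 * (w + u + p + 1) + 10 \<le> 2010 * m" using assms(3-6) by linarith
  then have "B * (500 * (w + u + p + 1) + 10) \<le> B * (2010 * m)" by (rule mult_le_mono2)
  also have "\<dots> = 2010 * X" by (simp add: X_def)
  finally have "B * (500 * (w + u + p + 1) + 10) + 8 \<le> 2010 * X + 8" by (rule add_right_mono)
  with assms(12) have t5: "t5 \<le> 2010 * X + 8" by (rule order_trans)
  have t1: "t1 \<le> 400 * X" using assms(1,8) mB by (simp only: distrib_left; linarith)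
  have t2: "t2 \<le> 300 * X" using assms(9) mB unfolding X_def[symmetric] by (simp only: distrib_left; linarith)
  have "t4 \<le> 1000 * (c * (u + 1)) + 1000" using assms(11) by simp
  then show ?thesis using t1 t2 t3 t5 mB unfolding X_def[symmetric] by linarith
qed

text \<open>The time has two parts of different nature: the one proportional to m B shrinks as B is
  halved, while subtracting the c known coefficients at O(u) each recurs in every pass. The table
  gains at most one entry per bucket.\<close>

lemma wp_pass:
  assumes n: "n = 2 ^ e" and b: "b \<le> e"
    and xh: "\<And>f. f \<in> {1..int n} \<Longrightarrow> dft n x f = of_int (xh f)" "\<And>f. f \<in> {1..int n} \<Longrightarrow> \<bar>xh f\<bar> \<le> int L"
    and L: "L \<ge> 1" "80 * (real n)\<^sup>2 * real L \<le> 2 ^ 2 ^ u"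
    and p: "2 * int L + 1 \<le> 2 ^ p" "2 ^ p \<le> 4 * int L + 2" "p \<le> 2 ^ u" and eu: "e \<le> 2 ^ u"
    and st: "static n e u p L s" and ok: "table_ok n L s"
    and s: "ivar s ''B'' = 2 ^ b" "ivar s ''d'' = int d" "ivar s ''c'' = int c"
  shows "wp n x prog_pass (\<lambda>s' t. static n e u p L s' \<and> table_ok n L s' \<and> ivar s' ''c'' \<le> int c + 2 ^ b \<and>
     ivar s' ''B'' = 2 ^ b div 2 \<and> ivar s' ''q'' = ivar s ''q'' + 1 \<and> out s' = out s \<and>
     (8 \<le> (2::nat) ^ b \<or> b = e \<or> {f \<in> {1..int n}. xh f \<noteq> iarr s ''z'' f} = {} \<longrightarrow>
        card {f \<in> {1..int n}. xh f \<noteq> iarr s' ''z'' f} \<le>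
          2 * (\<Sum>j<2 ^ b. card (bad_pairs n (2 ^ b) (2 * int d + 1) {f \<in> {1..int n}. xh f \<noteq> iarr s ''z'' f} j))) \<and>
     t \<le> 5000 * (2 ^ u * 2 ^ b) + 1000 * (c * (u + 1))) s"
proof -
  define B where "B = (2::nat) ^ b"
  define w where "w = e - b"
  define W where "W = (2::nat) ^ w"
  define m where "m = (2::nat) ^ u"
  define \<sigma> where "\<sigma> = 2 * int d + 1"
  define z0 where "z0 = iarr s ''z''"
  define F where "F i = iarr s ''F'' (int i)" for i
  have nBW: "n = B * W" using b n by (simp add: B_def W_def w_def flip: power_add)
  have B0: "B > 0" and W0: "W > 0" and m0: "m > 0" and n0: "n > 0" by (simp_all add: B_def W_def m_def n)
  have nB: "n div B = W" using nBW B0 by simp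
  have ww: "W = 1 \<or> even W" by (cases w) (auto simp: W_def)
  have Bn: "b = e \<longleftrightarrow> B = n" using n by (auto simp: B_def)
  note st' = st[unfolded static_def]
  have sB: "ivar s ''B'' = int B" using s by (simp add: B_def)
  obtain cf :: "nat \<Rightarrow> nat" where cf: "\<And>z::complex. (\<Sum>t<m * B. of_nat (cf t) * z ^ t) = (\<Sum>a<B. z ^ a) ^ m"
    using boxcar_power_coeffs[OF m0 B0] by blast
  obtain c' where c': "ivar s ''c'' = int c'" "inj_on F {..<c'}" "F ` {..<c'} \<subseteq> {1..int n}"
     "\<forall>f. z0 f \<noteq> 0 \<longrightarrow> f \<in> F ` {..<c'}" "\<forall>f. \<bar>z0 f\<bar> \<le> 4 * int L"
    using ok unfolding table_ok_def F_def z0_def by blast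
  then have "c' = c" using s by simp
  note c' = c'[unfolded this]
  show ?thesis
    unfolding prog_pass_def
  proof (rule wp_Seq2[OF wp_hash[where e = e and m = m and B = B and d = d]], goal_cases)
    case (7 s1 t1)
    note f1 = frameD[OF 7(1), simplified] and r1 = 7(2)
    show ?case
    proof (rule wp_Seq2[OF wp_sample[where B = B and m = m and c = cf]], goal_cases)
      case 1
      show ?case using f1 st' by (simp add: m_def)
    next
      case 2
      show ?case using f1 sB by simp
    next
      case 3
      show ?case using r1 by simp
    next
      case 4
      show ?case using r1 boxcar_power_int[OF cf, of "int B ^ m + 1"] by simp
    next
      case 5
      show ?case by (rule B0)
    next
      case (6 t)
      show ?case by (rule boxcar_coeff_le[OF cf 6])
    next
      case (7 s2 t2)
      note f2 = frameD[OF 7(1), simplified] and r2 = 7(2)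
      have bB: "(2::nat) ^ b = B" by (simp add: B_def)
      show ?case
      proof (rule wp_Seq2[OF wp_fft[where e = e and b = b, unfolded bB nB]], goal_cases)
        case 1
        show ?case using f1 f2 st' by simp
      next
        case 2
        show ?case by (rule n)
      next
        case 3
        show ?case by (rule b)
      next
        case 4
        show ?case using f1 f2 s by simp
      next
        case (5 s3 t3)
        note f3 = frameD[OF 5(1), simplified] and r3 = 5(2)
        have v3: "ivar s3 ''n'' = int n" "ivar s3 ''B'' = int B" "ivar s3 ''W'' = int W" "ivar s3 ''H'' = int (W div 2)"
          "ivar s3 ''u'' = int u" "ivar s3 ''c'' = int c" "ivar s3 ''s'' = \<sigma>" "iarr s3 ''z'' = z0"
          "iarr s3 ''F'' (int i) = F i" for i
          using f1 f2 f3 r1 st' sB s nB by (simp_all add: \<sigma>_def z0_def F_def)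
        define off where "off = ivar s3 ''o''"
        show ?case
        proof (rule wp_Seq2[OF wp_subtract[where B = B and W = W and u = u and c = c]], goal_cases)
          case (10 s4 t4)
          note f4 = frameD[OF 10(1), simplified] and r4 = 10(2)[unfolded v3, folded off_def]
          define y where "y = ivar s4 ''y''"
          define \<nu> where "\<nu> = real n * (real n / 2 ^ (4 * m) * real L * real B ^ m + 5 * real L * (real B / 4) ^ m)"
          let ?S = "of_real (newton_sqrt n (4 * m)) :: complex"
          let ?\<rho> = "?S / of_real (sqrt (real n))"
          have S1: "cvar s1 ''S'' = ?S" "ivar s1 ''s'' = \<sigma>" using f1 r1 st' by (simp_all add: m_def \<sigma>_def)
          let ?D = "\<lambda>j f. dirichlet n B (int j * int W - \<sigma> * f) ^ m"
          \<comment> \<open>One estimate for both time shifts: the weight is 1 for \<open>a\<close>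
            and \<omega>^(-\<sigma> f) for \<open>b\<close>.\<close>
          have spec: "norm (?\<rho> * (\<Sum>f\<in>{1..int n}. of_int (xh f) * wt f * ?D j f)
              - (\<Sum>i | i < c \<and> nearby n B W (\<sigma> * F i) j. of_int (z0 (F i)) * wt (F i) * ?D j (F i))
              - (\<Sum>f | f \<in> {1..int n} \<and> xh f \<noteq> z0 f \<and> \<not> far n B (int j * int W - \<sigma> * f). of_int (xh f - z0 f) * wt f * ?D j f)) \<le> \<nu>"
            if j: "j < B" and wt: "\<And>f. norm (wt f) = 1" for j and wt :: "int \<Rightarrow> complex"
          proof -
            have fin: "finite {i. i < c \<and> nearby n B W (\<sigma> * F i) j}" by simp
            have inj: "inj_on F {i. i < c \<and> nearby n B W (\<sigma> * F i) j}"
              by (rule inj_on_subset[OF c'(2)]) auto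
            have img: "F ` {i. i < c \<and> nearby n B W (\<sigma> * F i) j} = {f. f \<in> F ` {..<c} \<and> nearby n B W (\<sigma> * f) j}" by auto
            have re: "(\<Sum>i | i < c \<and> nearby n B W (\<sigma> * F i) j. of_int (z0 (F i)) * wt (F i) * ?D j (F i)) =
                (\<Sum>f | f \<in> F ` {..<c} \<and> nearby n B W (\<sigma> * f) j. of_int (z0 f) * wt f * ?D j f)"
              unfolding img[symmetric] by (subst sum.reindex[OF inj]) (simp add: o_def)
            show ?thesis
              unfolding re \<nu>_def
            proof (rule residual_noise[OF n0])
              show "norm (?\<rho> - 1) \<le> real n / 2 ^ (4 * m)" by (rule newton_ratio[OF n0])
              show "nearby n B W (\<sigma> * f) j" if "\<not> far n B (int j * int W - \<sigma> * f)" for f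
                by (rule nearby_if_not_far[OF nBW B0 W0 j that])
            qed (use xh(2) c' wt in auto)
          qed
          have a3: "carr s3 ''a'' (off + int j) = ?\<rho> * (\<Sum>f\<in>{1..int n}. of_int (xh f) * 1 * ?D j f)" if j: "j < B" for j
          proof -
            have "carr s3 ''a'' (off + int j) = (\<Sum>r<B. omega n powi (int W * (int r * int j)) * carr s2 ''a'' (int r))"
              using r3 j by (simp add: off_def nB)
            also have "\<dots> = (\<Sum>r<B. omega n powi (int W * (int r * int j)) *
                (\<Sum>t | t < m * B \<and> t mod B = r. of_nat (cf t) * (?S * x (idx n (\<sigma> * (int t + 0))))))"
              using r2 by (intro sum.cong refl) (simp add: S1)
            also have "\<dots> = ?\<rho> * (\<Sum>f\<in>{1..int n}. dft n x f * omega n powi (- (\<sigma> * f * 0)) * ?D j f)"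
              by (rule bucket_transform[OF nBW B0 W0 cf])
            also have "\<dots> = ?\<rho> * (\<Sum>f\<in>{1..int n}. of_int (xh f) * 1 * ?D j f)"
              using xh(1) by simp
            finally show ?thesis .
          qed
          have b3: "carr s3 ''b'' (off + int j) = ?\<rho> * (\<Sum>f\<in>{1..int n}. of_int (xh f) * omega n powi (- (\<sigma> * f)) * ?D j f)" if j: "j < B" for j
          proof -
            have "carr s3 ''b'' (off + int j) = (\<Sum>r<B. omega n powi (int W * (int r * int j)) * carr s2 ''b'' (int r))"
              using r3 j by (simp add: off_def nB)
            also have "\<dots> = (\<Sum>r<B. omega n powi (int W * (int r * int j)) *
                (\<Sum>t | t < m * B \<and> t mod B = r. of_nat (cf t) * (?S * x (idx n (\<sigma> * (int t + 1))))))"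
              using r2 by (intro sum.cong refl) (simp add: S1)
            also have "\<dots> = ?\<rho> * (\<Sum>f\<in>{1..int n}. dft n x f * omega n powi (- (\<sigma> * f * 1)) * ?D j f)"
              by (rule bucket_transform[OF nBW B0 W0 cf])
            also have "\<dots> = ?\<rho> * (\<Sum>f\<in>{1..int n}. of_int (xh f) * omega n powi (- (\<sigma> * f)) * ?D j f)"
              using xh(1) by simp
            finally show ?thesis .
          qed
          have v4: "ivar s4 ''n'' = int n" "ivar s4 ''B'' = int B" "ivar s4 ''W'' = int W" "ivar s4 ''H'' = int (W div 2)"
            "ivar s4 ''u'' = int u" "ivar s4 ''c'' = int c" "ivar s4 ''M'' = int B ^ m" "ivar s4 ''T'' = 2 ^ m" "ivar s4 ''y'' = y"
            "ivar s4 ''P'' = 2 ^ p" "ivar s4 ''L'' = int L" "ivar s4 ''o'' = off" "\<And>v. iarr s4 v = iarr s v"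
            using f1 f2 f3 f4 r1 v3 st' by (simp_all add: y_def off_def m_def)
          then have v4': "iarr s4 = iarr s" by blast
          note v4 = v4 v4'
          have inv: "[\<sigma> * y = 1] (mod int n)"
          proof -
            have "ivar s1 ''y'' = y" using f2 f3 f4 by (simp add: y_def)
            then show ?thesis using r1 S1(2) by metis
          qed
          interpret dec: decoding n B W w u p L xh z0 \<sigma> y "\<lambda>j. carr s4 ''a'' (off + int j)" "\<lambda>j. carr s4 ''b'' (off + int j)" \<nu>
          proof
            show "n = B * W" "B > 0" "W = 2 ^ w" using nBW B0 by (simp_all add: W_def)
            show "8 * real n * \<nu> \<le> (real B / 2) ^ 2 ^ u"
              unfolding \<nu>_def m_def using L by (intro noise_bound n0) auto
            fix j assume j: "j < B"
            show "norm (carr s4 ''a'' (off + int j) - (\<Sum>f | f \<in> {1..int n} \<and> xh f \<noteq> z0 f \<and> \<not> far n B (int j * int W - \<sigma> * f).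
              of_int (xh f - z0 f) * 1 * dirichlet n B (int j * int W - \<sigma> * f) ^ 2 ^ u)) \<le> \<nu>"
              using spec[OF j, of "\<lambda>_. 1"] r4 j by (simp add: a3 m_def)
            show "norm (carr s4 ''b'' (off + int j) - (\<Sum>f | f \<in> {1..int n} \<and> xh f \<noteq> z0 f \<and> \<not> far n B (int j * int W - \<sigma> * f).
              of_int (xh f - z0 f) * omega n powi (- (\<sigma> * f)) * dirichlet n B (int j * int W - \<sigma> * f) ^ 2 ^ u)) \<le> \<nu>"
              using spec[OF j, of "\<lambda>f. omega n powi (- (\<sigma> * f))"] r4 j by (simp add: b3 m_def)
          qed (use xh(2) p L inv in auto)
          define G where "G = (8 \<le> B \<or> B = n \<or> dec.S0 = {})"
          \<comment> \<open>Frequencies of buckets not yet processed still have the value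
            \<open>z0\<close>, which the decoding of bucket i presupposes; for the processed ones
            the guarantees of \<open>wp_bucket\<close> are retained.\<close>
          define J where "J i s' \<longleftrightarrow> table_ok n L s' \<and> ivar s' ''c'' \<le> int c + int i \<and>
            (\<forall>f\<in>{1..int n}. int i \<le> bucket n W (\<sigma> * f) \<longrightarrow> iarr s' ''z'' f = z0 f) \<and>
            (\<forall>j<i. (bad_pairs n B \<sigma> dec.S0 j = {} \<longrightarrow> G \<longrightarrow>
                (\<forall>f\<in>{1..int n}. bucket n W (\<sigma> * f) = int j \<longrightarrow> iarr s' ''z'' f = xh f)) \<and>
               (\<exists>f0. \<forall>f\<in>{1..int n}. bucket n W (\<sigma> * f) = int j \<longrightarrow> f \<noteq> f0 \<longrightarrow> iarr s' ''z'' f = z0 f))" for i and s' :: state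
          show ?case
          proof (rule wp_Seq2[OF wp_For[where J = J and M = B and T = "500 * (w + u + p + 1)"]], goal_cases)
            case 1
            have "table_ok n L (s4\<lparr>ivar := (ivar s4)(''j'' := 0)\<rparr>)"
              by (rule table_ok_cong[OF ok]) (use v4 s in simp_all)
            then show ?case using v4 by (simp add: J_def z0_def)
          next
            case (2 i s5)
            then show ?case using v4 by (simp add: frameD)
          next
            case (3 i s5)
            note f5 = frameD[OF 3(4), simplified]
            note J5 = 3(2)[unfolded J_def]
            show ?case
            proof (rule wp_conseq[OF dec.wp_bucket[OF 3(1)]], goal_cases)
              case (15 f)
              then show ?case using J5 by simp
            next
              case (16 s6 t6)
              have zz: "iarr s6 ''z'' f = iarr s5 ''z'' f" if "f \<in> {1..int n}" "bucket n W (\<sigma> * f) \<noteq> int i" for f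
                using 16(2) that by blast
              have "table_ok n L (s6\<lparr>ivar := (ivar s6)(''j'' := int (Suc i))\<rparr>)"
                by (rule table_ok_cong[of n L s6]) (use 16(2) in auto)
              moreover have "\<exists>f0. \<forall>f\<in>{1..int n}. bucket n W (\<sigma> * f) = int i \<longrightarrow> f \<noteq> f0 \<longrightarrow> iarr s6 ''z'' f = z0 f"
              proof -
                obtain f0 where "\<forall>f. f \<noteq> f0 \<longrightarrow> iarr s6 ''z'' f = iarr s5 ''z'' f" using 16(2) by blast
                then show ?thesis using J5 by (intro exI[of _ f0]) simp
              qed
              moreover have "iarr s6 ''z'' f = z0 f" if "f \<in> {1..int n}" "int (Suc i) \<le> bucket n W (\<sigma> * f)" for f
                using zz[OF that(1)] that J5 by simp
              moreover have "(bad_pairs n B \<sigma> dec.S0 j = {} \<longrightarrow> G \<longrightarrow>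
                (\<forall>f\<in>{1..int n}. bucket n W (\<sigma> * f) = int j \<longrightarrow> iarr s6 ''z'' f = xh f)) \<and>
               (\<exists>f0. \<forall>f\<in>{1..int n}. bucket n W (\<sigma> * f) = int j \<longrightarrow> f \<noteq> f0 \<longrightarrow> iarr s6 ''z'' f = z0 f)" if "j < i" for j
              proof -
                have eq: "iarr s6 ''z'' f = iarr s5 ''z'' f" if "f \<in> {1..int n}" "bucket n W (\<sigma> * f) = int j" for f
                  using zz[OF that(1)] that(2) \<open>j < i\<close> by simp
                have "(bad_pairs n B \<sigma> dec.S0 j = {} \<longrightarrow> G \<longrightarrow>
                    (\<forall>f\<in>{1..int n}. bucket n W (\<sigma> * f) = int j \<longrightarrow> iarr s5 ''z'' f = xh f))"
                  "\<exists>f0. \<forall>f\<in>{1..int n}. bucket n W (\<sigma> * f) = int j \<longrightarrow> f \<noteq> f0 \<longrightarrow> iarr s5 ''z'' f = z0 f"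
                  using J5 that by blast+
                then show ?thesis using eq by auto
              qed
              moreover have "bad_pairs n B \<sigma> dec.S0 i = {} \<longrightarrow> G \<longrightarrow>
                (\<forall>f\<in>{1..int n}. bucket n W (\<sigma> * f) = int i \<longrightarrow> iarr s6 ''z'' f = xh f)"
                using 16(2) unfolding G_def by blast
              moreover have "ivar s6 ''c'' \<le> int c + int (Suc i)" using 16(2) J5 by simp
              ultimately have "J (Suc i) (s6\<lparr>ivar := (ivar s6)(''j'' := int (Suc i))\<rparr>)"
                unfolding J_def less_Suc_eq by (intro conjI) simp_all
              then show ?case using 16(2) by blast
            next
              case 14
              show ?case using J5 by (rule conjunct1)
            qed (use f5 v4 3(3) in \<open>simp_all add: m_def\<close>)
          next
            case 4
            show ?case by simp
          next
            case (5 s5 t5)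
            note f5 = frameD[OF 5(1), simplified]
            note J5 = 5(2)[unfolded J_def]
            define S' where "S' = {f \<in> {1..int n}. xh f \<noteq> iarr s5 ''z'' f}"
            have card: "card S' \<le> 2 * (\<Sum>j<B. card (bad_pairs n B \<sigma> dec.S0 j))" if G
            proof (rule card_residual_le[OF nBW B0 W0])
              fix j f assume "j < B" "bad_pairs n B \<sigma> dec.S0 j = {}" "f \<in> S'"
              then show "bucket n W (\<sigma> * f) \<noteq> int j" using J5 that by (auto simp: S'_def)
            next
              fix j assume "j < B"
              then obtain f0 where "\<forall>f\<in>{1..int n}. bucket n W (\<sigma> * f) = int j \<longrightarrow> f \<noteq> f0 \<longrightarrow> iarr s5 ''z'' f = z0 f"
                using J5 by blast
              then show "\<exists>f0. {f \<in> S'. bucket n W (\<sigma> * f) = int j} \<subseteq> insert f0 {f \<in> dec.S0. bucket n W (\<sigma> * f) = int j}"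
                by (intro exI[of _ f0]) (auto simp: S'_def)
            qed (use ww in \<open>auto simp: S'_def\<close>)
            have T: "t1 + (t2 + (t3 + (t4 + (t5 + 8)))) \<le> 5000 * (m * B) + 1000 * (c * (u + 1))"
            proof (rule cost_bound[where e = e and b = b and w = w and p = p])
              show "t5 \<le> B * (500 * (w + u + p + 1) + 10) + 8" using 5(2) by simp
              show "u \<le> m" unfolding m_def by (rule less_imp_le) (rule less_exp)
              show "e \<le> m" "b \<le> m" "w \<le> m" "p \<le> m" using eu b p by (simp_all add: m_def w_def)
            qed (use r1 r2 r3 r4 m0 B0 in auto)
            have v5: "ivar s5 ''B'' = int B" "ivar s5 ''q'' = ivar s ''q''" "out s5 = out s"
              using f1 f2 f3 f4 f5 sB by simp_all
            have "static n e u p L s5"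
              using f1 f2 f3 f4 f5 st' unfolding static_def by simp
            then have "static n e u p L (s5\<lparr>ivar := (ivar s5)(''B'' := int B div 2, ''q'' := ivar s ''q'' + 1)\<rparr>)"
              by (simp add: static_def)
            moreover have "table_ok n L (s5\<lparr>ivar := (ivar s5)(''B'' := int B div 2, ''q'' := ivar s ''q'' + 1)\<rparr>)"
              by (rule table_ok_cong[of n L s5]) (use J5 in auto)
            ultimately show ?case
              using J5[THEN conjunct1, THEN conjunct2, THEN conjunct1] T card v5 unfolding G_def Bn
              by (intro wp_Seq wp_IAssign) (simp add: B_def m_def z0_def \<sigma>_def S'_def)
          qed
        qed (use v3 nBW B0 W0 in auto)
      qed
    qed
  qed (use st' n s sB in \<open>auto simp: m_def\<close>)
qed

section \<open>Running time and failure probability\<close>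

lemma wp_double:
  assumes "ivar s v = 1"
    and "\<And>i s'. i \<le> M \<Longrightarrow> ivar s' v = 2 ^ i \<Longrightarrow> frame (IAssign v (IMul (N 2) (V v))) s s' \<Longrightarrow> bval n x b s' \<longleftrightarrow> i < M"
  shows "wp n x (While b (IAssign v (IMul (N 2) (V v)))) (\<lambda>s' t. ivar s' v = 2 ^ M \<and>
      t \<le> M * (5 + bcost b) + (1 + bcost b)) s"
proof (rule wp_conseq, rule wp_While[where M = M and T = 4 and J = "\<lambda>i s'. i \<le> M \<and> ivar s' v = 2 ^ i"])
  fix i s'
  assume *: "i < M" "i \<le> M \<and> ivar s' v = 2 ^ i" "frame (IAssign v (IMul (N 2) (V v))) s s'"
  show "bval n x b s' \<and> wp n x (IAssign v (IMul (N 2) (V v))) (\<lambda>s'' t. (Suc i \<le> M \<and> ivar s'' v = 2 ^ Suc i) \<and> t \<le> 4) s'"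
  proof
    show "bval n x b s'" using assms(2)[of i s'] * by simp
    show "wp n x (IAssign v (IMul (N 2) (V v))) (\<lambda>s'' t. (Suc i \<le> M \<and> ivar s'' v = 2 ^ Suc i) \<and> t \<le> 4) s'"
      using * by (intro wp_IAssign) simp
  qed
next
  fix s' assume "M \<le> M \<and> ivar s' v = 2 ^ M" "frame (IAssign v (IMul (N 2) (V v))) s s'"
  then show "\<not> bval n x b s'" using assms(2)[of M s'] by simp
qed (use assms(1) in auto)

lemma wp_double_count:
  assumes "ivar s v = 1" and "ivar s w = 0" and "v \<noteq> w"
    and "\<And>i s'. i \<le> M \<Longrightarrow> ivar s' v = 2 ^ i \<Longrightarrow>
        frame (Seq (IAssign v (IMul (N 2) (V v))) (IAssign w (IAdd (V w) (N 1)))) s s' \<Longrightarrow> bval n x b s' \<longleftrightarrow> i < M"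
  shows "wp n x (While b (Seq (IAssign v (IMul (N 2) (V v))) (IAssign w (IAdd (V w) (N 1)))))
     (\<lambda>s' t. ivar s' v = 2 ^ M \<and> ivar s' w = int M \<and> t \<le> M * (9 + bcost b) + (1 + bcost b)) s"
proof (rule wp_conseq, rule wp_While[where M = M and T = 8 and J = "\<lambda>i s'. i \<le> M \<and> ivar s' v = 2 ^ i \<and> ivar s' w = int i"])
  fix i s'
  let ?p = "Seq (IAssign v (IMul (N 2) (V v))) (IAssign w (IAdd (V w) (N 1)))"
  assume *: "i < M" "i \<le> M \<and> ivar s' v = 2 ^ i \<and> ivar s' w = int i" "frame ?p s s'"
  show "bval n x b s' \<and> wp n x ?p (\<lambda>s'' t. (Suc i \<le> M \<and> ivar s'' v = 2 ^ Suc i \<and> ivar s'' w = int (Suc i)) \<and> t \<le> 8) s'"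
  proof
    show "bval n x b s'" using assms(4)[of i s'] * by simp
    show "wp n x ?p (\<lambda>s'' t. (Suc i \<le> M \<and> ivar s'' v = 2 ^ Suc i \<and> ivar s'' w = int (Suc i)) \<and> t \<le> 8) s'"
      using * assms(3) by (intro wp_Seq wp_IAssign) auto
  qed
next
  fix s' assume "M \<le> M \<and> ivar s' v = 2 ^ M \<and> ivar s' w = int M"
    "frame (Seq (IAssign v (IMul (N 2) (V v))) (IAssign w (IAdd (V w) (N 1)))) s s'"
  then show "\<not> bval n x b s'" using assms(4)[of M s'] by simp
qed (use assms(1,2) in auto)

text \<open>The least such exponent is where a loop doubling from 1 stops, and it overshoots
  \<open>M\<close> by at most a factor 2.\<close>

lemma pow2_cover:
  assumes "M \<ge> (1::nat)"
  obtains j where "M \<le> 2 ^ j" and "\<And>i. i < j \<Longrightarrow> 2 ^ i < M" and "2 ^ j \<le> 2 * M"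
proof -
  define j where "j = (LEAST j. M \<le> 2 ^ j)"
  have ex: "M \<le> 2 ^ M" by (rule less_imp_le) (rule less_exp)
  have 1: "M \<le> 2 ^ j" unfolding j_def by (rule LeastI[of "\<lambda>j. M \<le> 2 ^ j", OF ex])
  have 2: "2 ^ i < M" if "i < j" for i
    using not_less_Least[of i "\<lambda>j. M \<le> 2 ^ j"] that unfolding j_def by simp
  have 3: "2 ^ j \<le> 2 * M"
    using 2[of "j - 1"] assms by (cases j) auto
  show ?thesis by (rule that[OF 1 2 3])
qed

lemma pow2_less_iff:
  assumes "M \<le> 2 ^ j" and "\<And>i. i < j \<Longrightarrow> 2 ^ i < M"
  shows "(2::int) ^ i + 1 \<le> int M \<longleftrightarrow> i < j"
proof (cases "i < j")
  case True
  then have "2 ^ i + 1 \<le> M" using assms(2)[of i] by simp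
  then have "int (2 ^ i + 1) \<le> int M" by (simp only: of_nat_le_iff)
  then show ?thesis using True by simp
next
  case False
  then have "(2::nat) ^ j \<le> 2 ^ i" by (intro power_increasing) auto
  then have "M \<le> 2 ^ i" using assms(1) by linarith
  then have "int M \<le> int (2 ^ i)" by (simp only: of_nat_le_iff)
  also have "int (2 ^ i) = 2 ^ i" by simp
  finally have "\<not> (2::int) ^ i + 1 \<le> int M" by linarith
  then show ?thesis using False by blast
qed

lemma wp_setup:
  assumes n: "n = 2 ^ e"
    and u: "a * (e + 1) \<le> 2 ^ u" "\<And>i. i < u \<Longrightarrow> 2 ^ i < a * (e + 1)"
    and b: "8192 * k \<le> 2 ^ b'" "\<And>i. i < b' \<Longrightarrow> 2 ^ i < 8192 * k" "b = min b' e"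
    and p: "2 * L + 1 \<le> 2 ^ p" "\<And>i. i < p \<Longrightarrow> 2 ^ i < 2 * L + 1"
    and s: "s = initial_state n k L"
  shows "wp n x (prog_setup (int a)) (\<lambda>s' t. static n e u p L s' \<and> ivar s' ''B'' = 2 ^ b \<and> ivar s' ''c'' = 0 \<and>
     ivar s' ''q'' = 0 \<and> iarr s' = (\<lambda>_ _. 0) \<and> out s' = [] \<and> t \<le> 200 * (e + u + b + p + 2 ^ u + 1)) s"
proof -
  have si: "ivar s ''n'' = int n" "ivar s ''k'' = int k" "ivar s ''L'' = int L" "ivar s ''e'' = 0" "ivar s ''u'' = 0"
    "ivar s ''c'' = 0" "ivar s ''q'' = 0" "iarr s = (\<lambda>_ _. 0)" "out s = []"
    by (simp_all add: s initial_state_def)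
  have ce: "(2::int) ^ i + 1 \<le> int n \<longleftrightarrow> i < e" for i
    using pow2_less_iff[of n e i] by (simp add: n)
  have cu: "(2::int) ^ i + 1 \<le> int a * (int e + 1) \<longleftrightarrow> i < u" for i
    using pow2_less_iff[of "a * (e + 1)" u i, OF u] by (simp add: algebra_simps)
  have cb: "(2::int) ^ i + 1 \<le> 8192 * int k \<and> (2::int) ^ i + 1 \<le> int n \<longleftrightarrow> i < b" for i
    using pow2_less_iff[of "8192 * k" b' i, OF b(1,2)] ce[of i] b(3) by simp
  have cp: "(2::int) ^ i + 1 \<le> 2 * int L + 1 \<longleftrightarrow> i < p" for i
    using pow2_less_iff[of "2 * L + 1" p i, OF p] by simp
  show ?thesis
    unfolding prog_setup_def
  proof (intro wp_Seq wp_IAssign, rule wp_conseq[OF wp_double_count[where M = e]], goal_cases)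
    case (4 i s')
    then show ?case using si ce[of i] frameD[OF 4(3)] by simp
  next
    case (5 s1 t1)
    note f1 = frameD[OF 5(1), simplified] and r1 = 5(2)
    have i1: "ivar s1 ''n'' = int n" "ivar s1 ''k'' = int k" "ivar s1 ''L'' = int L" "ivar s1 ''e'' = int e" "ivar s1 ''u'' = 0"
      "ivar s1 ''c'' = 0" "ivar s1 ''q'' = 0" "\<And>v. iarr s1 v = (\<lambda>_. 0)" "out s1 = []" "t1 \<le> 20 * e + 20"
      using f1 r1 si by simp_all
    show ?case
    proof (intro wp_Seq wp_IAssign, rule wp_conseq[OF wp_double_count[where M = u]], goal_cases)
      case (4 i s')
      then show ?case using i1 cu[of i] frameD[OF 4(3)] by simp
    next
      case (5 s2 t2)
      note f2 = frameD[OF 5(1), simplified] and r2 = 5(2)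
      have i2: "ivar s2 ''n'' = int n" "ivar s2 ''k'' = int k" "ivar s2 ''L'' = int L" "ivar s2 ''e'' = int e" "ivar s2 ''u'' = int u"
        "ivar s2 ''m'' = 2 ^ u"
        "ivar s2 ''c'' = 0" "ivar s2 ''q'' = 0" "\<And>v. iarr s2 v = (\<lambda>_. 0)" "out s2 = []" "t2 \<le> 20 * u + 20"
        using f2 r2 i1 by simp_all
      show ?case
      proof (intro wp_Seq wp_IAssign, rule wp_conseq[OF wp_double[where M = b]], goal_cases)
        case (2 i s')
        then show ?case using i2 cb[of i] frameD[OF 2(3)] by simp
      next
        case (3 s3 t3)
        note f3 = frameD[OF 3(1), simplified] and r3 = 3(2)
        have i3: "ivar s3 ''n'' = int n" "ivar s3 ''L'' = int L" "ivar s3 ''e'' = int e" "ivar s3 ''u'' = int u"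
          "ivar s3 ''m'' = 2 ^ u" "ivar s3 ''B'' = 2 ^ b"
          "ivar s3 ''c'' = 0" "ivar s3 ''q'' = 0" "\<And>v. iarr s3 v = (\<lambda>_. 0)" "out s3 = []" "t3 \<le> 20 * b + 20"
          using f3 r3 i2 by simp_all
        show ?case
        proof (intro wp_Seq wp_IAssign, rule wp_conseq[OF wp_double[where M = p]], goal_cases)
          case (2 i s')
          then show ?case using i3 cp[of i] frameD[OF 2(3)] by simp
        next
          case (3 s4 t4)
          note f4 = frameD[OF 3(1), simplified] and r4 = 3(2)
          have i4: "ivar s4 ''n'' = int n" "ivar s4 ''L'' = int L" "ivar s4 ''e'' = int e" "ivar s4 ''u'' = int u"
            "ivar s4 ''m'' = 2 ^ u" "ivar s4 ''B'' = 2 ^ b" "ivar s4 ''P'' = 2 ^ p"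
            "ivar s4 ''c'' = 0" "ivar s4 ''q'' = 0" "\<And>v. iarr s4 v = (\<lambda>_. 0)" "out s4 = []" "t4 \<le> 20 * p + 20"
            using f4 r4 i3 by simp_all
          show ?case
          proof (intro wp_Seq wp_IAssign, rule wp_conseq[OF wp_For_assign[where M = "2 ^ u" and g = "\<lambda>y. 2 * y"]], goal_cases)
            case (2 s')
            then show ?case using i4 frameD[OF 2] by simp
          next
            case (4 s5 t5)
            note f5 = frameD[OF 4(1), simplified] and r5 = 4(2)
            have i5: "ivar s5 ''n'' = int n" "ivar s5 ''L'' = int L" "ivar s5 ''e'' = int e" "ivar s5 ''u'' = int u"
              "ivar s5 ''m'' = 2 ^ u" "ivar s5 ''B'' = 2 ^ b" "ivar s5 ''P'' = 2 ^ p" "ivar s5 ''T'' = 2 ^ 2 ^ u"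
              "ivar s5 ''c'' = 0" "ivar s5 ''q'' = 0" "\<And>v. iarr s5 v = (\<lambda>_. 0)" "out s5 = []" "t5 \<le> 20 * 2 ^ u + 20"
              using f5 r5 i4 by (simp_all add: funpow_mult')
            show ?case
            proof (intro wp_Seq wp_CAssign, rule wp_conseq[OF wp_For[where M = "4 * 2 ^ u" and T = 12 and
                  J = "\<lambda>i s'. cvar s' ''S'' = of_real (newton_sqrt n i)"]], goal_cases)
              case 1
              show ?case using i5 by simp
            next
              case (2 i s')
              then show ?case using i5 frameD[OF 2(2)] by simp
            next
              case (3 i s')
              then show ?case using i5 frameD[OF 3(4)] by (intro wp_CAssign) simp
            next
              case (5 s6 t6)
              note f6 = frameD[OF 5(1), simplified]
              have "iarr s6 = (\<lambda>_ _. 0)" using f6 i5 by auto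
              then show ?case
                using f6 i5 5(2) i1(10) i2(11) i3(11) i4(12) by (simp add: static_def)
            qed simp
          qed simp_all
        qed simp
      qed simp
    qed (use i1 in simp_all)
  qed (use si in simp_all)
qed

lemma mod_prog_emit [simp]:
  "imod prog_emit = {''i''}" "cmod prog_emit = {}" "iamod prog_emit = {}" "camod prog_emit = {}"
  by (auto simp: prog_emit_def)

lemma wp_emit:
  assumes ok: "table_ok n L s" and o: "out s = []" and c: "ivar s ''c'' = int c"
  shows "wp n x prog_emit (\<lambda>s' t. ((\<forall>f\<in>{1..int n}. dft n x f = of_int (iarr s ''z'' f)) \<longrightarrow> outputs_dft n x s') \<and>
     t \<le> 50 * (c + 1)) s"
proof -
  define F where "F i = iarr s ''F'' (int i)" for i
  define z where "z = iarr s ''z''"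
  have "\<exists>c'. ivar s ''c'' = int c' \<and> inj_on F {..<c'} \<and> F ` {..<c'} \<subseteq> {1..int n} \<and> (\<forall>f. z f \<noteq> 0 \<longrightarrow> f \<in> F ` {..<c'})"
    using ok unfolding table_ok_def F_def z_def by blast
  then have t: "inj_on F {..<c}" "F ` {..<c} \<subseteq> {1..int n}" "\<And>f. z f \<noteq> 0 \<Longrightarrow> f \<in> F ` {..<c}"
    using c by auto
  define out' where "out' i = map (\<lambda>f. (f, of_int (z f) :: complex)) (filter (\<lambda>f. z f \<noteq> 0) (map F [0..<i]))" for i
  have fin: "outputs_dft n x s'" if d: "\<forall>f\<in>{1..int n}. dft n x f = of_int (z f)" and s': "out s' = out' c" for s'
  proof -
    have "distinct (map F [0..<c])" using t(1) by (simp add: distinct_map atLeast0LessThan)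
    then have "distinct (out' c)"
      unfolding out'_def by (subst distinct_map) (auto simp: inj_on_def)
    moreover have "set (out' c) = (\<lambda>f. (f, of_int (z f))) ` {f \<in> F ` {..<c}. z f \<noteq> 0}"
      by (simp add: out'_def atLeast0LessThan)
    moreover have "{f \<in> F ` {..<c}. z f \<noteq> 0} = dft_support n x"
    proof (intro equalityI subsetI)
      fix f assume "f \<in> {f \<in> F ` {..<c}. z f \<noteq> 0}"
      then show "f \<in> dft_support n x" using d t(2) by (auto simp: dft_support_def)
    next
      fix f assume "f \<in> dft_support n x"
      then have "f \<in> {1..int n}" "z f \<noteq> 0" using d by (auto simp: dft_support_def)
      then show "f \<in> {f \<in> F ` {..<c}. z f \<noteq> 0}" using t(3) by simp
    qed
    moreover have "(\<lambda>f. (f, of_int (z f))) ` dft_support n x = (\<lambda>i. (i, dft n x i)) ` dft_support n x"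
      using d by (intro image_cong refl) (auto simp: dft_support_def)
    ultimately show ?thesis using s' by (simp add: outputs_dft_def)
  qed
  show ?thesis
    unfolding prog_emit_def
  proof (rule wp_conseq, rule wp_For[where M = c and T = 25 and J = "\<lambda>i s'. out s' = out' i"], goal_cases)
    case 1
    show ?case using o by (simp add: out'_def)
  next
    case (2 i s')
    then show ?case using c by (simp add: frameD)
  next
    case (3 i s')
    note f3 = frameD[OF 3(4)]
    have v: "iarr s' ''z'' = z" "iarr s' ''F'' (int i) = F i" using f3 by (simp_all add: z_def F_def)
    show ?case
      using 3(2,3) by (intro wp_Cond wp_Skip wp_Emit) (auto simp: v out'_def)
  next
    case 4
    show ?case by simp
  next
    case (5 s' t)
    then show ?case using fin by (auto simp: z_def)
  qed
qed

section \<open>Expectation over the random passes\<close>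

lemma ewp_loop:
  "ewp (loop b c body s) \<phi> =
    (if b s then ewp (body s) (\<lambda>s1 t1. ewp (loop b c body s1) (\<lambda>s2 t2. \<phi> s2 (c + (t1 + t2)))) else \<phi> s c)"
  by (subst loop.simps) (simp add: ewp_tick ewp_seq_run ewp_return)

lemma ewp_Seq: "ewp (exec n x (Seq p q) s) \<phi> = ewp (exec n x p s) (\<lambda>s1 t1. ewp (exec n x q s1) (\<lambda>s2 t2. \<phi> s2 (t1 + t2)))"
  by (simp add: ewp_seq_run)

abbreviation guard :: bexp where "guard \<equiv> BAnd (ILt (V ''q'') (V ''u'')) (ILe (N 1) (V ''B''))"

text \<open>\<open>cap\<close> tells how the search for \<open>B\<close> ended: with enough buckets
  for the probabilistic argument, or with all n of them, where the first pass is exact.\<close>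

locale sfft_run =
  fixes n e u b p L k :: nat and x :: "int \<Rightarrow> complex" and xh :: "int \<Rightarrow> int"
  assumes n: "n = 2 ^ e"
    and xh: "\<And>f. f \<in> {1..int n} \<Longrightarrow> dft n x f = of_int (xh f)" "\<And>f. f \<in> {1..int n} \<Longrightarrow> \<bar>xh f\<bar> \<le> int L"
    and L: "L \<ge> 1" "80 * (real n)\<^sup>2 * real L \<le> 2 ^ 2 ^ u"
    and p: "2 * int L + 1 \<le> 2 ^ p" "2 ^ p \<le> 4 * int L + 2" "p \<le> 2 ^ u"
    and eu: "e < 2 ^ u" and b: "b \<le> e" and k: "k \<ge> 1" and cap: "8192 * k \<le> 2 ^ b \<or> b = e" and u: "u \<ge> 1"
begin

definition S :: "state \<Rightarrow> int set" where
  "S s = {f \<in> {1..int n}. xh f \<noteq> iarr s ''z'' f}"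

text \<open>The last conjunct is a potential argument for the table size: a pass adds at most B
  entries and halves B, so c + 2 B never increases and c stays below twice the initial B.\<close>

definition Inv :: "nat \<Rightarrow> state \<Rightarrow> bool" where
  "Inv r s \<longleftrightarrow> static n e u p L s \<and> table_ok n L s \<and> ivar s ''q'' = int r \<and> r \<le> u \<and> out s = [] \<and>
     ivar s ''B'' = int (2 ^ b div 2 ^ r) \<and>
     (\<exists>c. ivar s ''c'' = int c \<and> c + 2 * (2 ^ b div 2 ^ r) \<le> 2 * 2 ^ b)"

abbreviation "main \<equiv> loop (bval n x guard) 10 (exec n x (Seq (Rand ''d'' (V ''n'')) prog_pass))"

definition pairs :: "nat \<Rightarrow> state \<Rightarrow> nat \<Rightarrow> nat" where
  "pairs r s d = 2 * (\<Sum>j<2 ^ (b - r). card (bad_pairs n (2 ^ (b - r)) (2 * int d + 1) (S s) j))"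

definition cost :: "nat \<Rightarrow> nat" where
  "cost r = 5000 * (2 ^ u * (2 ^ b div 2 ^ r)) + 1000 * (2 * 2 ^ b * (u + 1))"

lemma guard_iff: "Inv r s \<Longrightarrow> bval n x guard s \<longleftrightarrow> r < u \<and> r \<le> b"
proof -
  assume I: "Inv r s"
  have "1 \<le> (2::nat) ^ b div 2 ^ r \<longleftrightarrow> r \<le> b"
  proof (cases "r \<le> b")
    case True
    then have "(2::nat) ^ b div 2 ^ r = 2 ^ (b - r)" by (simp add: power_diff)
    then show ?thesis using True by simp
  next
    case False
    then have "(2::nat) ^ b < 2 ^ r" by simp
    then show ?thesis using False by simp
  qed
  then have "1 \<le> int (2 ^ b div 2 ^ r) \<longleftrightarrow> r \<le> b" by linarith
  then show ?thesis using I unfolding Inv_def static_def by auto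
qed

lemma main_exit: "Inv r s \<Longrightarrow> \<not> (r < u \<and> r \<le> b) \<Longrightarrow> ewp (main s) \<phi> = \<phi> s 10"
  using guard_iff[of r s] by (subst ewp_loop) (simp only: if_False)

lemma div_pow_Suc: "(2::nat) ^ b div 2 ^ Suc r = 2 ^ b div 2 ^ r div 2"
  unfolding power_Suc2 div_mult2_eq ..

lemma pass_post:
  assumes I: "Inv r s" and r: "r < u" "r \<le> b"
  shows "wp n x prog_pass (\<lambda>s' t. Inv (Suc r) s' \<and> t \<le> cost r \<and>
     (8 \<le> (2::nat) ^ (b - r) \<or> b - r = e \<or> S s = {} \<longrightarrow> card (S s') \<le> pairs r s d))
     (s\<lparr>ivar := (ivar s)(''d'' := int d)\<rparr>)"
proof -
  obtain c where c: "ivar s ''c'' = int c" "c + 2 * (2 ^ b div 2 ^ r) \<le> 2 * 2 ^ b"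
    using I unfolding Inv_def by blast
  note I' = I[unfolded Inv_def]
  have Br: "(2::nat) ^ b div 2 ^ r = 2 ^ (b - r)" using r by (simp add: power_diff)
  have Bs: "int (2 ^ b div 2 ^ r) = 2 ^ (b - r)" unfolding Br by simp
  have Br1: "(2::nat) ^ b div 2 ^ Suc r = 2 ^ (b - r) div 2"
    unfolding Br[symmetric] by (rule div_pow_Suc)
  let ?s = "s\<lparr>ivar := (ivar s)(''d'' := int d)\<rparr>"
  show ?thesis
  proof (rule wp_conseq[OF wp_pass[OF n _ xh L p, where b = "b - r" and d = d and c = c]], goal_cases)
    case (10 s' t)
    have "table_ok n L s'" using 10(2) by blast
    then obtain c' where c': "ivar s' ''c'' = int c'" unfolding table_ok_def by blast
    have "int c' \<le> int c + 2 ^ (b - r)" using 10(2) c' by simp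
    then have "int c' \<le> int (c + 2 ^ (b - r))" by simp
    then have "c' \<le> c + 2 ^ (b - r)" by (simp only: of_nat_le_iff)
    then have cc: "c' + 2 * (2 ^ b div 2 ^ Suc r) \<le> 2 * 2 ^ b" using c(2) unfolding Br1 Br by linarith
    have "(2::int) ^ (b - r) div 2 = int (2 ^ b div 2 ^ Suc r)" unfolding Br1 by (simp add: zdiv_int)
    then have "Inv (Suc r) s'" unfolding Inv_def using 10(2) c' cc I' r by simp
    moreover have "t \<le> cost r"
    proof -
      have "c * (u + 1) \<le> 2 * 2 ^ b * (u + 1)" using c(2) by (intro mult_le_mono1) linarith
      moreover have "t \<le> 5000 * (2 ^ u * 2 ^ (b - r)) + 1000 * (c * (u + 1))" using 10(2) by blast
      ultimately show ?thesis unfolding cost_def Br by linarith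
    qed
    ultimately show ?case using 10(2) by (simp add: S_def pairs_def)
  next
    case 5
    show ?case using I' by (simp add: static_def)
  next
    case 6
    show ?case by (rule table_ok_cong[of n L s]) (use I' in auto)
  qed (use I' b eu c Bs in auto)
qed

text \<open>One unrolling of the loop, with cost 10 for the guard and 2 for the draw. The bound
  \<open>v d\<close> may depend on the draw, so that collisions can be averaged.\<close>

lemma main_step:
  assumes I: "Inv r s" and r: "r < u" "r \<le> b"
    and v: "\<And>d s2 t2. d < n \<Longrightarrow> Inv (Suc r) s2 \<Longrightarrow> t2 \<le> cost r \<Longrightarrow>
        (8 \<le> (2::nat) ^ (b - r) \<or> b - r = e \<or> S s = {} \<Longrightarrow> card (S s2) \<le> pairs r s d) \<Longrightarrow>
        ewp (main s2) (\<lambda>s3 t3. \<phi> s3 (12 + t2 + t3)) \<le> ennreal (v d)"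
    and v0: "\<And>d. 0 \<le> v d"
  shows "ewp (main s) \<phi> \<le> ennreal ((\<Sum>d<n. v d) / real n)"
proof -
  have n0: "n > 0" by (simp add: n)
  have nv: "ival (V ''n'') s = int n" using I by (simp add: Inv_def static_def)
  have "ewp (main s) \<phi> = ewp (exec n x (Seq (Rand ''d'' (V ''n'')) prog_pass) s)
      (\<lambda>s1 t1. ewp (main s1) (\<lambda>s2 t2. \<phi> s2 (10 + (t1 + t2))))"
    using guard_iff[OF I] r by (subst ewp_loop) simp
  also have "\<dots> = (\<Sum>d<n. ewp (exec n x prog_pass (s\<lparr>ivar := (ivar s)(''d'' := int d)\<rparr>))
      (\<lambda>s1 t1. ewp (main s1) (\<lambda>s2 t2. \<phi> s2 (10 + (2 + t1 + t2))))) / of_nat n"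
    unfolding ewp_Seq ewp_Rand[OF nv n0] by (simp add: numeral_2_eq_2)
  also have "\<dots> \<le> (\<Sum>d<n. ennreal (v d)) / of_nat n"
  proof (intro divide_right_mono_ennreal sum_mono)
    fix d assume "d \<in> {..<n}"
    show "ewp (exec n x prog_pass (s\<lparr>ivar := (ivar s)(''d'' := int d)\<rparr>))
      (\<lambda>s1 t1. ewp (main s1) (\<lambda>s2 t2. \<phi> s2 (10 + (2 + t1 + t2)))) \<le> ennreal (v d)"
    proof (rule ewp_wp[OF pass_post[OF I r, where d = d]])
      fix s' t
      assume "Inv (Suc r) s' \<and> t \<le> cost r \<and>
        (8 \<le> (2::nat) ^ (b - r) \<or> b - r = e \<or> S s = {} \<longrightarrow> card (S s') \<le> pairs r s d)"
      then have "ewp (main s') (\<lambda>s3 t3. \<phi> s3 (12 + t + t3)) \<le> ennreal (v d)"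
        using v[of d s' t] \<open>d \<in> {..<n}\<close> by blast
      moreover have "10 + (2 + t + t3) = 12 + t + t3" for t3 by simp
      ultimately show "ewp (main s') (\<lambda>s2 t2. \<phi> s2 (10 + (2 + t + t2))) \<le> ennreal (v d)" by (simp only:)
    qed
  qed
  also have "\<dots> = ennreal ((\<Sum>d<n. v d) / real n)"
    using n0 v0 by (simp add: sum_nonneg divide_ennreal ennreal_of_nat_eq_real_of_nat)
  finally show ?thesis .
qed

text \<open>The 10 is the final guard. The coefficient 10000 is twice the 5000 of
  \<open>cost\<close>, as the terms proportional to B form a geometric series with ratio at most
  1/2; the subtractions are charged in full for each of the \<open>u - r\<close> passes.\<close>

definition remaining :: "nat \<Rightarrow> nat" where
  "remaining r = 10 + (u - r) * (12 + 2000 * (2 ^ b * (u + 1))) + 10000 * (2 ^ u * (2 ^ b div 2 ^ r))"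

text \<open>The bound holds for every draw, so a constant is averaged. The offset \<open>E\<close>
  accumulates the time already spent and is what makes the induction go through.\<close>

lemma main_time:
  assumes "Inv r s"
    and "\<And>r' s' t. Inv r' s' \<Longrightarrow> \<phi> s' t \<le> ennreal (real t + E)" and "0 \<le> E"
  shows "ewp (main s) \<phi> \<le> ennreal (real (remaining r) + E)"
  using assms
proof (induction "u - r" arbitrary: r s \<phi> E rule: less_induct)
  case (less r s \<phi> E)
  show ?case
  proof (cases "r < u \<and> r \<le> b")
    case False
    have "\<phi> s 10 \<le> ennreal (real 10 + E)" using less.prems by blast
    also have "\<dots> \<le> ennreal (real (remaining r) + E)"
      by (intro ennreal_leI add_right_mono) (simp add: remaining_def)
    finally show ?thesis using main_exit[OF less.prems(1) False] by simp
  next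
    case True
    have n0: "n > 0" by (simp add: n)
    have half: "2 * ((2::nat) ^ b div 2 ^ Suc r) \<le> 2 ^ b div 2 ^ r"
      unfolding div_pow_Suc by simp
    have ur: "u - r = Suc (u - Suc r)" using True Suc_diff_Suc[of r u] by simp
    have "2 ^ u * (2 * ((2::nat) ^ b div 2 ^ Suc r)) \<le> 2 ^ u * (2 ^ b div 2 ^ r)"
      using half by (rule mult_le_mono2)
    then have rem: "remaining (Suc r) + (12 + cost r) \<le> remaining r"
      unfolding remaining_def cost_def ur by simp
    have "ewp (main s) \<phi> \<le> ennreal ((\<Sum>d<n. real (remaining r) + E) / real n)"
    proof (rule main_step[OF less.prems(1)])
      fix d s2 t2
      assume I2: "Inv (Suc r) s2" and t2: "t2 \<le> cost r"
      have "ewp (main s2) (\<lambda>s3 t3. \<phi> s3 (12 + t2 + t3)) \<le> ennreal (real (remaining (Suc r)) + (E + 12 + real t2))"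
      proof (rule less.hyps[OF _ I2])
        fix r' s' t assume "Inv r' s'"
        then have "\<phi> s' (12 + t2 + t) \<le> ennreal (real (12 + t2 + t) + E)" by (rule less.prems(2))
        then show "\<phi> s' (12 + t2 + t) \<le> ennreal (real t + (E + 12 + real t2))" by (simp add: algebra_simps)
      qed (use True less.prems(3) in auto)
      also have "\<dots> \<le> ennreal (real (remaining r) + E)"
      proof (rule ennreal_leI)
        have "remaining (Suc r) + (12 + t2) \<le> remaining r" using rem t2 by linarith
        then have "real (remaining (Suc r) + (12 + t2)) \<le> real (remaining r)" by (simp only: of_nat_le_iff)
        then show "real (remaining (Suc r)) + (E + 12 + real t2) \<le> real (remaining r) + E" by simp
      qed
      finally show "ewp (main s2) (\<lambda>s3 t3. \<phi> s3 (12 + t2 + t3)) \<le> ennreal (real (remaining r) + E)" .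
    qed (use True less.prems(3) in auto)
    then show ?thesis using n0 by simp
  qed
qed

text \<open>
  The bound on the residual that the \<open>r\<close>-th pass may rely on.  It decreases doubly exponentially, so
  that \<open>u = log\<^sub>2 m\<close> passes suffice, while \<open>B\<close> is only halved; the additional \<open>2 r\<close> in the exponent makes
  the failure probabilities of the passes a geometric series.
\<close>

definition sparsity :: "nat \<Rightarrow> real" where
  "sparsity r = real k / 2 ^ (2 ^ r - 1 + 2 * r)"

text \<open>A potential that does not increase in expectation over a pass. A nonempty residual above
  its \<open>sparsity\<close> bound is given up; 5/16 / 2^r is the tail from r on of the series 5/32
  / 2^r.\<close>

definition failure :: "nat \<Rightarrow> nat \<Rightarrow> real" where
  "failure r c = (if c = 0 then 0 else if real c \<le> sparsity r then 5 / 16 / 2 ^ r else 1)"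

lemma failure_le_1: "failure r c \<le> 1"
proof -
  have "(1::real) \<le> 2 ^ r" by simp
  then have "5 / 16 \<le> 1 * (2::real) ^ r" by linarith
  then have "5 / 16 / 2 ^ r \<le> (1::real)" by (simp add: divide_le_eq)
  then show ?thesis by (simp add: failure_def)
qed

lemma failure_nonneg: "0 \<le> failure r c"
  by (simp add: failure_def)

lemma sparsity_pos: "0 < sparsity r"
  using k by (simp add: sparsity_def)

text \<open>If the loop ends after u passes, then 2^u > e makes the denominator at least 2^e > k. If
  it ends because no bucket is left, then r > b makes it at least 2^r \<ge> 2^b > k. A residual
  bound below 1 means that the residual is empty.\<close>

lemma sparsity_small: "sparsity r < 1" if "8192 * k \<le> 2 ^ b" "\<not> (r < u \<and> r \<le> b)" "r \<le> u"
proof -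
  have "k < 2 ^ (2 ^ r - 1 + 2 * r)"
  proof (cases "r = u")
    case True
    have "8192 * k \<le> 2 ^ e" using that(1) power_increasing[OF b, of "2::nat"] by linarith
    then have "k < 2 ^ e" using k by linarith
    also have "(2::nat) ^ e \<le> 2 ^ (2 ^ r - 1 + 2 * r)" using eu True by (intro power_increasing) auto
    finally show ?thesis .
  next
    case False
    then have "(2::nat) ^ b \<le> 2 ^ r" using that by (intro power_increasing) auto
    then have "k < 2 ^ r" using that(1) k by linarith
    also have "(2::nat) ^ r \<le> 2 ^ (2 ^ r - 1 + 2 * r)" by (intro power_increasing) auto
    finally show ?thesis .
  qed
  then have "real k < real (2 ^ (2 ^ r - 1 + 2 * r))" by (simp only: of_nat_less_iff)
  then show ?thesis by (simp add: sparsity_def)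
qed

text \<open>Twice the exponent for r plus 3 equals the exponent for r + 1 plus 2 r, so the quotient
  is 8 * 160 / 8192 / 2^r. The series sums to 5/16; half of 8192 would give 5/8, which is more than
  1/3.\<close>

lemma sparsity_step: "160 * (sparsity r)\<^sup>2 * 2 ^ r / (8192 * real k * sparsity (Suc r)) = 5 / 32 / 2 ^ r"
proof -
  define a where "a = (2::nat) ^ r - 1 + 2 * r"
  obtain t where "(2::nat) ^ r = Suc t" using not0_implies_Suc[of "2 ^ r"] by auto
  then have "2 ^ Suc r - 1 + 2 * Suc r + 2 * r = 2 * a + 3" by (simp add: a_def)
  then have "(2::real) ^ (2 ^ Suc r - 1 + 2 * Suc r) * 2 ^ (2 * r) = 2 ^ (2 * a + 3)" by (simp only: flip: power_add)
  also have "\<dots> = 8 * ((2::real) ^ a)\<^sup>2" by (simp add: power_add power_mult power2_eq_square flip: power_mult_distrib)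
  finally have E: "(2::real) ^ (2 ^ Suc r - 1 + 2 * Suc r) * (2 ^ r)\<^sup>2 = 8 * (2 ^ a)\<^sup>2"
    by (simp add: power_mult power2_eq_square power_mult_distrib mult.commute)
  define A where "A = (2::real) ^ a"
  define R where "R = (2::real) ^ r"
  define C where "C = (2::real) ^ (2 ^ Suc r - 1 + 2 * Suc r)"
  have pos: "A > 0" "R > 0" "C > 0" "real k > 0" using k by (auto simp: A_def R_def C_def)
  have E': "C * R\<^sup>2 = 8 * A\<^sup>2" using E by (simp only: A_def R_def C_def)
  have "160 * (real k / A)\<^sup>2 * R / (8192 * real k * (real k / C)) = 5 / 256 * (C * R\<^sup>2) / (A\<^sup>2 * R)"
    using pos by (simp add: field_simps power2_eq_square)
  also have "\<dots> = 5 / 32 / R" unfolding E' using pos by (simp add: field_simps)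
  finally show ?thesis by (simp only: sparsity_def a_def A_def R_def C_def)
qed

text \<open>Twice the bound 80 W of \<open>sum_bad_pairs\<close>, divided by n = B W, with B = 2^b /
  2^r.\<close>

lemma sum_pairs:
  assumes "r \<le> b"
  shows "(\<Sum>d<n. real (pairs r s d)) / real n \<le> 160 * (real (card (S s)))\<^sup>2 * 2 ^ r / 2 ^ b"
proof -
  define B where "B = (2::nat) ^ (b - r)"
  define W where "W = (2::nat) ^ (e - (b - r))"
  have nBW: "n = B * W" using b by (simp add: B_def W_def n flip: power_add)
  have BW: "B > 0" "W > 0" by (simp_all add: B_def W_def)
  have "(\<Sum>d<n. pairs r s d) = 2 * (\<Sum>d<n. \<Sum>j<B. card (bad_pairs n B (2 * int d + 1) (S s) j))"
    by (simp add: pairs_def B_def sum_distrib_left)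
  also have "\<dots> \<le> 2 * (80 * W * (card (S s))\<^sup>2)"
    by (intro mult_le_mono2 sum_bad_pairs[OF nBW BW n]) (auto simp: S_def)
  finally have "real (\<Sum>d<n. pairs r s d) \<le> real (2 * (80 * W * (card (S s))\<^sup>2))" by (simp only: of_nat_le_iff)
  then have "(\<Sum>d<n. real (pairs r s d)) \<le> 160 * real W * (real (card (S s)))\<^sup>2" by simp
  then have "(\<Sum>d<n. real (pairs r s d)) / real n \<le> 160 * real W * (real (card (S s)))\<^sup>2 / real n"
    by (intro divide_right_mono) auto
  also have "\<dots> = 160 * (real (card (S s)))\<^sup>2 / real B" using nBW BW by (simp add: field_simps)
  also have "real B = 2 ^ (b - r)" by (simp add: B_def)
  also have "\<dots> = 2 ^ b / 2 ^ r" using assms by (simp add: power_diff)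
  finally show ?thesis by simp
qed

text \<open>Markov's inequality within an induction over the remaining passes. The second premise
  expresses that a run which had to take B = n for lack of size has no residual after its first
  pass.\<close>

lemma main_failure:
  assumes "Inv r s" and "b = e \<longrightarrow> r = 0 \<or> S s = {} \<or> 8192 * k \<le> 2 ^ b"
    and "\<And>r' s' t. Inv r' s' \<Longrightarrow> \<phi> s' t \<le> ennreal (if S s' = {} then 0 else 1)"
    and "r = 0 \<longrightarrow> card (S s) \<le> k"
  shows "ewp (main s) \<phi> \<le> ennreal (failure r (card (S s)))"
  using assms
proof (induction "u - r" arbitrary: r s \<phi> rule: less_induct)
  case (less r s \<phi>)
  note I = less.prems(1)
  have fin: "finite (S s)" for s by (rule finite_subset[of _ "{1..int n}"]) (auto simp: S_def)
  have S0: "S s = {} \<longleftrightarrow> card (S s) = 0" for s using fin by simp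
  have n0: "n > 0" by (simp add: n)
  show ?case
  proof (cases "r < u \<and> r \<le> b")
    case False
    have "(if S s = {} then 0 else 1) \<le> failure r (card (S s))"
    proof (cases "S s = {}")
      case ne: False
      have ru: "r \<le> u" using I by (simp add: Inv_def)
      have "8192 * k \<le> 2 ^ b"
        using less.prems(2) cap ne False u by auto
      then have "sparsity r < 1" using sparsity_small[OF _ False ru] by simp
      moreover have "1 \<le> real (card (S s))" using ne S0[of s] by simp
      ultimately show ?thesis using ne S0[of s] by (simp add: failure_def)
    qed (simp add: failure_nonneg)
    then have "\<phi> s 10 \<le> ennreal (failure r (card (S s)))"
      using less.prems(3)[OF I] ennreal_leI order_trans by blast
    then show ?thesis using main_exit[OF I False] by simp
  next
    case True
    then have r: "r < u" "r \<le> b" by auto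
    have IH: "ewp (main s2) (\<lambda>s3 t3. \<phi> s3 (12 + t2 + t3)) \<le> ennreal (failure (Suc r) (card (S s2)))"
      if "Inv (Suc r) s2" "S s2 = {} \<or> 8192 * k \<le> 2 ^ b" for s2 t2
      by (rule less.hyps) (use that r less.prems(3) in auto)
    have avg: "(\<Sum>d<n. c) / real n = c" for c :: real using n0 by simp
    consider (empty) "S s = {}" | (full) "S s \<noteq> {}" "\<not> 8192 * k \<le> 2 ^ b"
      | (sparse) "S s \<noteq> {}" "8192 * k \<le> 2 ^ b" "real (card (S s)) \<le> sparsity r"
      | (dense) "S s \<noteq> {}" "8192 * k \<le> 2 ^ b" "\<not> real (card (S s)) \<le> sparsity r" by blast
    then show ?thesis
    proof cases
      case empty
      have "ewp (main s) \<phi> \<le> ennreal ((\<Sum>d<n. 0) / real n)"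
      proof (rule main_step[OF I r])
        fix d s2 t2
        assume I2: "Inv (Suc r) s2" and c: "8 \<le> (2::nat) ^ (b - r) \<or> b - r = e \<or> S s = {} \<Longrightarrow> card (S s2) \<le> pairs r s d"
        have "pairs r s d = 0" by (simp add: pairs_def empty bad_pairs_def)
        then have "S s2 = {}" using c empty S0 by simp
        then show "ewp (main s2) (\<lambda>s3 t3. \<phi> s3 (12 + t2 + t3)) \<le> ennreal 0"
          using IH[OF I2] by (simp add: failure_def)
      qed simp
      then show ?thesis using empty by (simp add: failure_def)
    next
      case full
      then have be: "b = e" "r = 0" using cap less.prems(2) by auto
      have "ewp (main s) \<phi> \<le> ennreal ((\<Sum>d<n. 0) / real n)"
      proof (rule main_step[OF I r])
        fix d s2 t2
        assume I2: "Inv (Suc r) s2" and c: "8 \<le> (2::nat) ^ (b - r) \<or> b - r = e \<or> S s = {} \<Longrightarrow> card (S s2) \<le> pairs r s d"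
        have "coprime (2 * int d + 1) (int n)" by (simp add: n)
        then have "bad_pairs n n (2 * int d + 1) (S s) j = {}" for j
          by (intro bad_pairs_full n0) (auto simp: S_def)
        moreover have "(2::nat) ^ (b - r) = n" by (simp add: be n)
        ultimately have "pairs r s d = 0" by (simp add: pairs_def)
        then have "S s2 = {}" using c be S0 by simp
        then show "ewp (main s2) (\<lambda>s3 t3. \<phi> s3 (12 + t2 + t3)) \<le> ennreal 0"
          using IH[OF I2] by (simp add: failure_def)
      qed simp
      then show ?thesis by (rule order_trans) (simp add: failure_nonneg)
    next
      case dense
      have "ewp (main s) \<phi> \<le> ennreal ((\<Sum>d<n. 1) / real n)"
      proof (rule main_step[OF I r])
        fix d s2 t2 assume "Inv (Suc r) s2"
        then show "ewp (main s2) (\<lambda>s3 t3. \<phi> s3 (12 + t2 + t3)) \<le> ennreal 1"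
          using IH[of s2 t2] dense failure_le_1 ennreal_leI order_trans by blast
      qed simp
      then show ?thesis using dense S0[of s] n0 by (simp add: failure_def)
    next
      case sparse
      have c1: "1 \<le> real (card (S s))" using sparse S0[of s] by simp
      \<comment> \<open>A nonempty residual within its bound forces 2^r \<le> k, so B = 2^b / 2^r
        has not yet dropped below 8192 and the phase search is still reliable.\<close>
      have B8: "8 \<le> (2::nat) ^ (b - r)"
      proof -
        have "1 \<le> sparsity r" using c1 sparse(3) by linarith
        then have "real (2 ^ (2 ^ r - 1 + 2 * r)) \<le> real k" by (simp add: sparsity_def)
        then have "2 ^ (2 ^ r - 1 + 2 * r) \<le> k" by (simp only: of_nat_le_iff)
        moreover have "(2::nat) ^ r \<le> 2 ^ (2 ^ r - 1 + 2 * r)" by (intro power_increasing) auto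
        ultimately have "8 * 2 ^ r \<le> (2::nat) ^ b" using sparse(2) by linarith
        also have "(2::nat) ^ b = 2 ^ (b - r) * 2 ^ r" using r by (simp flip: power_add)
        finally show ?thesis by simp
      qed
      \<comment> \<open>If the new residual exceeds its bound, the first summand is at least 1,
        which is Markov's inequality; otherwise the second one is the failure bound for the later
        passes.\<close>
      let ?v = "\<lambda>d. real (pairs r s d) / sparsity (Suc r) + 5 / 16 / 2 ^ Suc r"
      have "ewp (main s) \<phi> \<le> ennreal ((\<Sum>d<n. ?v d) / real n)"
      proof (rule main_step[OF I r])
        fix d s2 t2
        assume I2: "Inv (Suc r) s2" and c: "8 \<le> (2::nat) ^ (b - r) \<or> b - r = e \<or> S s = {} \<Longrightarrow> card (S s2) \<le> pairs r s d"
        have "failure (Suc r) (card (S s2)) \<le> ?v d"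
        proof (cases "card (S s2) = 0 \<or> real (card (S s2)) \<le> sparsity (Suc r)")
          case True
          then have "failure (Suc r) (card (S s2)) \<le> 5 / 16 / 2 ^ Suc r" by (auto simp: failure_def)
          then show ?thesis using sparsity_pos[of "Suc r"] by (smt (verit) divide_nonneg_pos of_nat_0_le_iff)
        next
          case False
          have "1 \<le> real (card (S s2)) / sparsity (Suc r)" using False sparsity_pos[of "Suc r"] by (simp add: le_divide_eq)
          also have "\<dots> \<le> real (pairs r s d) / sparsity (Suc r)"
            using c B8 sparsity_pos[of "Suc r"] by (intro divide_right_mono) auto
          also have "\<dots> \<le> ?v d" by simp
          finally show ?thesis using failure_le_1 order_trans by blast
        qed
        then show "ewp (main s2) (\<lambda>s3 t3. \<phi> s3 (12 + t2 + t3)) \<le> ennreal (?v d)"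
          using IH[OF I2, of t2] sparse ennreal_leI order_trans by blast
      qed (use sparsity_pos[of "Suc r"] in simp)
      also have "(\<Sum>d<n. ?v d) / real n = (\<Sum>d<n. real (pairs r s d)) / real n / sparsity (Suc r) + 5 / 16 / 2 ^ Suc r"
        using n0 by (simp add: sum.distrib add_divide_distrib sum_divide_distrib mult.commute)
      also have "\<dots> \<le> failure r (card (S s))"
      proof -
        have "(\<Sum>d<n. real (pairs r s d)) / real n \<le> 160 * (real (card (S s)))\<^sup>2 * 2 ^ r / 2 ^ b"
          by (rule sum_pairs[OF r(2)])
        also have "\<dots> \<le> 160 * (sparsity r)\<^sup>2 * 2 ^ r / (8192 * real k)"
        proof (rule frac_le)
          show "160 * (real (card (S s)))\<^sup>2 * 2 ^ r \<le> 160 * (sparsity r)\<^sup>2 * 2 ^ r"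
            using sparse(3) by (intro mult_right_mono mult_left_mono power_mono) auto
          have "real (8192 * k) \<le> real (2 ^ b)" using sparse(2) by (simp only: of_nat_le_iff)
          then show "8192 * real k \<le> 2 ^ b" by simp
        qed (use k sparsity_pos[of r] in auto)
        finally have "(\<Sum>d<n. real (pairs r s d)) / real n / sparsity (Suc r) \<le>
            160 * (sparsity r)\<^sup>2 * 2 ^ r / (8192 * real k) / sparsity (Suc r)"
          using sparsity_pos[of "Suc r"] by (intro divide_right_mono) auto
        also have "\<dots> = 5 / 32 / 2 ^ r" using sparsity_step[of r] by simp
        finally show ?thesis using sparse S0[of s] by (simp add: failure_def)
      qed
      finally show ?thesis by (meson ennreal_leI order_trans order_refl)
    qed
  qed
qed

end

section \<open>Total running time and conclusion\<close>

text \<open>Absorbs u passes with O(u) work per known coefficient into m = 2^u per initial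
  bucket.\<close>

lemma quadratic_le_exp: "u * (u + 1) \<le> 8 * (2::nat) ^ u"
proof (induction u)
  case (Suc u)
  have "u + 1 \<le> 2 ^ u" using less_exp[of u] by linarith
  moreover have "Suc u * (Suc u + 1) = u * (u + 1) + 2 * (u + 1)" by simp
  ultimately show ?case using Suc by simp
qed simp

lemma total_cost:
  fixes t e u b p X :: nat
  assumes X: "X = 2 ^ u * 2 ^ b" and t: "t \<le> 200 * (e + u + b + p + 2 ^ u + 1)"
    and le: "e < 2 ^ u" "b \<le> e" "p \<le> 2 ^ u"
  shows "t + (10 + u * (12 + 2000 * (2 ^ b * (u + 1))) + 10000 * X) + 50 * (2 * 2 ^ b + 1) \<le> 30000 * X"
proof -
  have "2 ^ u * 1 \<le> X" "1 * 2 ^ b \<le> X" unfolding X by (intro mult_le_mono; simp)+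
  then have UX: "2 ^ u \<le> X" and BX: "2 ^ b \<le> X" by simp_all
  have uX: "u \<le> X" using less_exp[of u] UX by linarith
  have one: "1 \<le> X" using UX le(1) by linarith
  have "t \<le> 200 * (6 * X)"
    using t UX uX le one by (elim order_trans) (intro mult_le_mono2, linarith)
  moreover have "u * (u + 1) * 2 ^ b \<le> 8 * 2 ^ u * 2 ^ b" by (intro mult_le_mono1 quadratic_le_exp)
  moreover have "u * (2000 * (2 ^ b * (u + 1))) = 2000 * (u * (u + 1) * 2 ^ b)" by (simp only: mult_ac)
  moreover have "16000 * X = 2000 * (8 * 2 ^ u * 2 ^ b)" by (simp add: X)
  ultimately have "t \<le> 200 * (6 * X)" and "u * (2000 * (2 ^ b * (u + 1))) \<le> 16000 * X"
    by (simp_all only: mult_le_mono2)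
  moreover from this(2) have "u * (12 + 2000 * (2 ^ b * (u + 1))) \<le> 12 * X + 16000 * X"
    unfolding distrib_left[of u] using uX by (intro add_mono) auto
  moreover define Y where "Y = u * (12 + 2000 * (2 ^ b * (u + 1)))"
  moreover have "50 * (2 * 2 ^ b + 1) = 100 * 2 ^ b + (50 :: nat)" by simp
  ultimately have "t \<le> 1200 * X" "Y \<le> 16012 * X" "50 * (2 * 2 ^ b + 1) \<le> 150 * X" using BX one by simp_all
  then show ?thesis using one unfolding Y_def[symmetric] by linarith
qed

text \<open>The choice of \<open>a\<close> gives m \<ge> (c + 10) (e + 1), which covers 7 + 2 e + c
  e, so that 80 n^2 L \<le> 2^m, and 3 + c e for the bit length p. The factor 65536 is 2 * 16384 *
  2: m \<le> 2 a (e + 1), at most 16384 k initial buckets, and e + 1 \<le> 2 max(1, e).\<close>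

lemma sfft_correct:
  fixes c :: real
  assumes n: "n = 2 ^ e" and a: "c + 10 \<le> real a" "0 < c" and k: "k \<ge> 1" and L: "L \<ge> 1" "real L \<le> real n powr c"
    and card: "card (dft_support n x) \<le> k" and val: "\<forall>i\<in>{1..int n}. dft n x i \<in> of_int ` {- int L..int L}"
  shows "expected_time (run (prog_sfft (int a)) n k L x) \<le>
      ennreal (30000 * 65536 * real a * real k * max 1 (log 2 (real n))) \<and>
    success_probability n x (run (prog_sfft (int a)) n k L x) \<ge> 2 / 3"
proof -
  have a10: "a \<ge> 10" using a by linarith
  obtain u where hu: "a * (e + 1) \<le> 2 ^ u" "\<And>i. i < u \<Longrightarrow> 2 ^ i < a * (e + 1)" "2 ^ u \<le> 2 * (a * (e + 1))"
    using pow2_cover[of "a * (e + 1)"] a10 by auto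
  obtain b' where b': "8192 * k \<le> 2 ^ b'" "\<And>i. i < b' \<Longrightarrow> 2 ^ i < 8192 * k" "2 ^ b' \<le> 2 * (8192 * k)"
    using pow2_cover[of "8192 * k"] k by auto
  obtain p where hp: "2 * L + 1 \<le> 2 ^ p" "\<And>i. i < p \<Longrightarrow> 2 ^ i < 2 * L + 1" "2 ^ p \<le> 2 * (2 * L + 1)"
    using pow2_cover[of "2 * L + 1"] by auto
  define b where "b = min b' e"
  obtain xh :: "int \<Rightarrow> int" where xh: "\<And>f. f \<in> {1..int n} \<Longrightarrow> dft n x f = of_int (xh f) \<and> \<bar>xh f\<bar> \<le> int L"
  proof -
    have "\<forall>f\<in>{1..int n}. \<exists>v. dft n x f = of_int v \<and> \<bar>v\<bar> \<le> int L"
    proof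
      fix f assume "f \<in> {1..int n}"
      then obtain v where "v \<in> {- int L..int L}" "dft n x f = of_int v" using val by blast
      then show "\<exists>v. dft n x f = of_int v \<and> \<bar>v\<bar> \<le> int L" by (intro exI[of _ v]) auto
    qed
    from bchoice[OF this] show ?thesis using that by blast
  qed
  have au: "real a * (real e + 1) \<le> 2 ^ u"
  proof -
    have "real (a * (e + 1)) \<le> real (2 ^ u)" using hu(1) by (simp only: of_nat_le_iff)
    then show ?thesis by (simp add: algebra_simps)
  qed
  have npow: "real n powr c = 2 powr (real e * c)"
    by (simp add: n powr_powr flip: powr_realpow)
  have ac: "(c + 10) * (real e + 1) \<le> 2 ^ u"
    by (rule order_trans[OF mult_right_mono[OF a(1)] au]) simp
  have ce: "0 \<le> c * real e" using a by simp
  interpret sfft_run n e u b p L k x xh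
  proof
    show "80 * (real n)\<^sup>2 * real L \<le> 2 ^ 2 ^ u"
    proof -
      have "80 * (real n)\<^sup>2 * real L \<le> 2 powr 7 * 2 powr (2 * real e) * 2 powr (real e * c)"
      proof (intro mult_mono)
        show "(80::real) \<le> 2 powr 7" by simp
        show "(real n)\<^sup>2 \<le> 2 powr (2 * real e)"
          by (simp add: n powr_realpow[symmetric] powr_powr mult.commute)
        show "real L \<le> 2 powr (real e * c)" using L(2) npow by simp
      qed auto
      also have "\<dots> = 2 powr (7 + 2 * real e + real e * c)" by (simp add: powr_add)
      also have "\<dots> \<le> 2 powr (2 ^ u)"
        using ac ce a(2) by (intro powr_mono) (auto simp: algebra_simps)
      also have "\<dots> = 2 powr real (2 ^ u)" by simp
      also have "\<dots> = 2 ^ 2 ^ u" by (rule powr_realpow) simp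
      finally show ?thesis .
    qed
    have "int (2 * L + 1) \<le> int (2 ^ p)" "int (2 ^ p) \<le> int (2 * (2 * L + 1))"
      using hp by (simp_all only: of_nat_le_iff)
    then show "2 * int L + 1 \<le> 2 ^ p" "2 ^ p \<le> 4 * int L + 2" by simp_all
    show "p \<le> 2 ^ u"
    proof -
      have "2 * (2 * L + 1) \<le> 8 * L" using L(1) by simp
      then have "2 ^ p \<le> 8 * L" using hp(3) by linarith
      then have "real (2 ^ p) \<le> real (8 * L)" by (simp only: of_nat_le_iff)
      then have "2 powr real p \<le> 2 powr 3 * real L" by (simp add: powr_realpow)
      also have "\<dots> \<le> 2 powr 3 * 2 powr (real e * c)" using L(2) npow by (intro mult_left_mono) auto
      also have "\<dots> = 2 powr (3 + real e * c)" by (simp add: powr_add)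
      finally have "real p \<le> 3 + c * real e" by (simp add: mult.commute)
      moreover have "c * real e + c + 10 * real e + 10 \<le> 2 ^ u" using ac by (simp add: algebra_simps)
      ultimately have "real p \<le> 2 ^ u" using a(2) by linarith
      then have "real p \<le> real (2 ^ u)" by simp
      then show ?thesis by (simp only: of_nat_le_iff)
    qed
    have "1 * (e + 1) \<le> a * (e + 1)" using a10 by (intro mult_le_mono1) simp
    from order_trans[OF this hu(1)] show "e < 2 ^ u" by simp
    show "8192 * k \<le> 2 ^ b \<or> b = e" using b'(1) by (auto simp: b_def min_def)
    have "10 * 1 \<le> a * (e + 1)" using a10 by (intro mult_le_mono) auto
    from order_trans[OF this hu(1)] show "u \<ge> 1" by (cases u) auto
  qed (use n xh k L in \<open>auto simp: b_def\<close>)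
  let ?s0 = "initial_state n k L"
  have init: "wp n x (prog_setup (int a)) (\<lambda>s t. Inv 0 s \<and> card (S s) \<le> k \<and> t \<le> 200 * (e + u + b + p + 2 ^ u + 1)) ?s0"
  proof (rule wp_conseq[OF wp_setup[OF n hu(1) hu(2) b'(1) b'(2) b_def hp(1) hp(2) refl]], goal_cases)
    case (4 s t)
    have "table_ok n L s" unfolding table_ok_def using 4 by (intro exI[of _ 0]) auto
    then have "Inv 0 s" unfolding Inv_def using 4 by simp
    moreover have "S s = dft_support n x"
      using 4 xh by (auto simp: S_def dft_support_def)
    ultimately show ?case using 4 card by simp
  qed
  have loop: "exec n x (While guard (Seq (Rand ''d'' (V ''n'')) prog_pass)) s = main s" for s
  proof -
    have "1 + bcost guard = 10" by simp
    then show ?thesis by (simp only: exec.simps)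
  qed
  have run: "ewp (run (prog_sfft (int a)) n k L x) \<phi> = ewp (exec n x (prog_setup (int a)) ?s0)
      (\<lambda>s1 t1. ewp (main s1) (\<lambda>s2 t2. ewp (exec n x prog_emit s2) (\<lambda>s3 t3. \<phi> s3 (t1 + (t2 + t3)))))" for \<phi>
    unfolding run_def prog_sfft_def ewp_Seq loop ..
  have emit: "wp n x prog_emit (\<lambda>s' t. (S s = {} \<longrightarrow> outputs_dft n x s') \<and> t \<le> 50 * (2 * 2 ^ b + 1)) s"
    if I: "Inv r s" for r s
  proof -
    obtain c where c: "ivar s ''c'' = int c" "c + 2 * (2 ^ b div 2 ^ r) \<le> 2 * 2 ^ b"
      using I unfolding Inv_def by blast
    show ?thesis
    proof (rule wp_conseq[OF wp_emit[OF _ _ c(1), where n = n and L = L]], goal_cases)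
      case (3 s' t)
      have "c \<le> 2 * 2 ^ b" using c(2) by linarith
      then have "50 * (c + 1) \<le> 50 * (2 * 2 ^ b + 1)" by simp
      then have "t \<le> 50 * (2 * 2 ^ b + 1)" using 3(2) order_trans by blast
      moreover have "\<forall>f\<in>{1..int n}. dft n x f = of_int (iarr s ''z'' f)" if "S s = {}"
        using that xh by (auto simp: S_def)
      ultimately show ?case using 3(2) by blast
    qed (use I in \<open>auto simp: Inv_def\<close>)
  qed
  define X where "X = (2::nat) ^ u * 2 ^ b"
  have "ewp (run (prog_sfft (int a)) n k L x) (\<lambda>s t. of_nat t) \<le> ennreal (real (30000 * X))"
    unfolding run
  proof (rule ewp_wp[OF init])
    fix s1 t1 assume s1: "Inv 0 s1 \<and> card (S s1) \<le> k \<and> t1 \<le> 200 * (e + u + b + p + 2 ^ u + 1)"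
    let ?E = "t1 + 50 * (2 * 2 ^ b + 1)"
    have "ewp (main s1) (\<lambda>s2 t2. ewp (exec n x prog_emit s2) (\<lambda>s3 t3. of_nat (t1 + (t2 + t3)))) \<le>
        ennreal (real (remaining 0) + real ?E)"
    proof (rule main_time)
      show "Inv 0 s1" using s1 by blast
      fix r s2 t2 assume I2: "Inv r s2"
      show "ewp (exec n x prog_emit s2) (\<lambda>s3 t3. of_nat (t1 + (t2 + t3))) \<le> ennreal (real t2 + real ?E)"
      proof (rule ewp_wp[OF emit[OF I2]])
        fix s3 and t3 :: nat assume "(S s2 = {} \<longrightarrow> outputs_dft n x s3) \<and> t3 \<le> 50 * (2 * 2 ^ b + 1)"
        then have "t1 + (t2 + t3) \<le> t2 + ?E" by simp
        then have "real (t1 + (t2 + t3)) \<le> real (t2 + ?E)" by (simp only: of_nat_le_iff)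
        then have "ennreal (real (t1 + (t2 + t3))) \<le> ennreal (real t2 + real ?E)" by (intro ennreal_leI) simp
        then show "of_nat (t1 + (t2 + t3)) \<le> ennreal (real t2 + real ?E)"
          by (simp only: ennreal_of_nat_eq_real_of_nat)
      qed
    qed simp
    also have "real (remaining 0) + real ?E = real (remaining 0 + ?E)" by simp
    also have "ennreal (real (remaining 0 + ?E)) \<le> ennreal (real (30000 * X))"
    proof (intro ennreal_leI)
      have "t1 + (10 + u * (12 + 2000 * (2 ^ b * (u + 1))) + 10000 * X) + 50 * (2 * 2 ^ b + 1) \<le> 30000 * X"
        by (rule total_cost[OF X_def _ eu b]) (use s1 p(3) in auto)
      moreover have "remaining 0 = 10 + u * (12 + 2000 * (2 ^ b * (u + 1))) + 10000 * X"
        by (simp add: remaining_def X_def)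
      ultimately have "remaining 0 + ?E \<le> 30000 * X" by linarith
      then show "real (remaining 0 + ?E) \<le> real (30000 * X)" by (simp only: of_nat_le_iff)
    qed
    finally show "ewp (main s1) (\<lambda>s2 t2. ewp (exec n x prog_emit s2) (\<lambda>s3 t3. of_nat (t1 + (t2 + t3)))) \<le> ennreal (real (30000 * X))" .
  qed
  also have "\<dots> \<le> ennreal (30000 * 65536 * real a * real k * max 1 (log 2 (real n)))"
  proof (rule ennreal_leI)
    have "2 ^ b \<le> (2::nat) ^ b'" unfolding b_def by (intro power_increasing) auto
    then have "2 ^ b \<le> 16384 * k" using b'(3) by linarith
    then have "X \<le> 2 * (a * (e + 1)) * (16384 * k)" unfolding X_def using hu(3) by (intro mult_le_mono) auto
    then have "real X \<le> real (2 * (a * (e + 1)) * (16384 * k))" by (simp only: of_nat_le_iff)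
    also have "\<dots> = 32768 * real a * real k * (real e + 1)" by (simp add: algebra_simps)
    also have "\<dots> \<le> 32768 * real a * real k * (2 * max 1 (real e))" by (intro mult_left_mono) auto
    also have "real e = log 2 (real n)" by (simp add: n log_nat_power)
    finally show "real (30000 * X) \<le> 30000 * 65536 * real a * real k * max 1 (log 2 (real n))" by simp
  qed
  finally have time: "expected_time (run (prog_sfft (int a)) n k L x) \<le>
      ennreal (30000 * 65536 * real a * real k * max 1 (log 2 (real n)))"
    by (simp only: expected_time_ewp)
  have "ewp (run (prog_sfft (int a)) n k L x) (\<lambda>s t. indicator {s. \<not> outputs_dft n x s} s) \<le> ennreal (5 / 16)"
    unfolding run
  proof (rule ewp_wp[OF init])
    fix s1 t1 assume s1: "Inv 0 s1 \<and> card (S s1) \<le> k \<and> t1 \<le> 200 * (e + u + b + p + 2 ^ u + 1)"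
    have "ewp (main s1) (\<lambda>s2 t2. ewp (exec n x prog_emit s2) (\<lambda>s3 t3. indicator {s. \<not> outputs_dft n x s} s3)) \<le>
        ennreal (failure 0 (card (S s1)))"
    proof (rule main_failure)
      fix r s2 and t2 :: nat assume I2: "Inv r s2"
      show "ewp (exec n x prog_emit s2) (\<lambda>s3 t3. indicator {s. \<not> outputs_dft n x s} s3) \<le> ennreal (if S s2 = {} then 0 else 1)"
        by (rule ewp_wp[OF emit[OF I2]]) (auto simp: indicator_def)
    qed (use s1 in auto)
    \<comment> \<open>\<open>sparsity 0\<close> is k, so the initial residual, the whole support, is
      within its bound.\<close>
    also have "\<dots> \<le> ennreal (5 / 16)"
      using s1 by (intro ennreal_leI) (auto simp: failure_def sparsity_def)
    finally show "ewp (main s1) (\<lambda>s2 t2. ewp (exec n x prog_emit s2) (\<lambda>s3 t3. indicator {s. \<not> outputs_dft n x s} s3)) \<le> ennreal (5 / 16)" .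
  qed
  then have "1 - 5 / 16 \<le> success_probability n x (run (prog_sfft (int a)) n k L x)"
    by (rule success_probability_ewp) simp
  then show ?thesis using time by simp
qed

theorem theorem3p8:
  fixes c :: real
  assumes "c > 0"
  shows "\<exists>(P :: com) (C :: real). \<forall>(n :: nat) (k :: nat) (L :: nat) (x :: int \<Rightarrow> complex).
    (\<exists>m. n = 2 ^ m) \<longrightarrow> k \<ge> 1 \<longrightarrow> L \<ge> 1 \<longrightarrow> real L \<le> real n powr c \<longrightarrow>
    card (dft_support n x) \<le> k \<longrightarrow>
    (\<forall>i\<in>{1..int n}. dft n x i \<in> of_int ` {- int L..int L}) \<longrightarrow>
      expected_time (run P n k L x) \<le> ennreal (C * real k * max 1 (log 2 (real n))) \<and>
      success_probability n x (run P n k L x) \<ge> 2 / 3"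
proof -
  define a where "a = nat \<lceil>c\<rceil> + 10"
  have "c + 10 \<le> real a" using assms by (simp add: a_def)
  then show ?thesis
    using sfft_correct[of _ _ c a] assms
    by (intro exI[of _ "prog_sfft (int a)"] exI[of _ "30000 * 65536 * real a"]) blast
qed

end
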